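(* Let $d\in\mathbb{N}$, $T>0$, $\{p(n)\}_{n\in\mathbb N}\subset(0,1]$, $\lambda,\mu,W$ satisfy the assumptions listed in the context, let $\phi:\mathbb{R}\times\mathbb{R}\times\mathbb{R}^d\times\mathbb{R}^d\to\mathbb{R}$ and $\psi:\mathbb{R}\times\mathbb{R}^d\to\mathbb{R}$ be bounded functions with bounded derivatives, and assume $np(n)\to+\infty$ as $n\to+\infty$. Let $L_n,\overline{L}_n$ be the double-layer empirical measures defined in the context. Then $\{L_n\}_{n\in\mathbb{N}}$ and $\{\overline{L}_n\}_{n\in\mathbb{N}}$ are exponentially equivalent random elements of $\mathcal{M}_1(C([0,T],\mathbb{R})\times\mathbb{R}^d)$ with the $d_{BL}$ metric: $$\forall\eta>0:\quad\limsup_{n\to+\infty}\frac1n\log\mathbb{P}\big(d_{BL}(L_n,\overline{L}_n)>\eta\big)=-\infty.$$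
   Context: Assumptions. $\mu$ is a probability measure on $\mathbb{R}^d$. $\lambda$ is a probability measure on $\mathbb{R}$ with a density belonging to $L^1(\mathbb{R},dx)\cap L^r(\mathbb{R},dx)$ for some $r>1$. $W:\mathbb{R}^d\times\mathbb{R}^d\to[0,+\infty)$ is bounded, symmetric, Lipschitz, does not depend on $n$, and $p(n)\|W\|_\infty\le1$ for all $n$. Put $\overline\phi(x,y,\omega,\pi):=W(\omega,\pi)\phi(x,y,\omega,\pi)$. The systems. For each $n$, sample independently $\vec\xi^{(n)}=(\xi^{(n)}_i)_{i\in[n]}\sim\lambda^{\otimes n}$, $\vec\omega^{(n)}=(\omega^{(n)}_i)_{i\in[n]}\sim\mu^{\otimes n}$ and independent standard Brownian motions $\vec B^{(n)}=(B^{(n)}_i)_{i\in[n]}$ on $[0,T]$, where $[n]=\{1,\dots,n\}$. Conditionally on these, $A^{(n)}\in\{0,1\}^{n\times n}$ is a random symmetric matrix whose entries $A^{(n)}_{i,j}$, $1\le i\le j\le n$, are independent with $\mathbb{P}(A^{(n)}_{i,j}=1\mid\vec\xi^{(n)},\vec\omega^{(n)},\vec B^{(n)})=p(n)W(\omega^{(n)}_i,\omega^{(n)}_j)$. The processes $\theta^{(n)}$ and $\overline\theta^{(n)}$ are the strong solutions on $[0,T]$ (for $i\in[n]$) of $$d\theta_i^{(n)}(t)=\Big(\tfrac{1}{np(n)}\sum_{j=1}^nA_{i,j}^{(n)}\phi(\theta_i^{(n)}(t),\theta_j^{(n)}(t),\omega_i^{(n)},\omega_j^{(n)})\Big)dt+\psi(\theta_i^{(n)}(t),\omega_i^{(n)})dt+dB_i^{(n)}(t),\quad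 \theta^{(n)}(0)=\xi^{(n)},$$ $$d\overline\theta_i^{(n)}(t)=\Big(\tfrac{1}{n}\sum_{j=1}^n\overline\phi(\overline\theta_i^{(n)}(t),\overline\theta_j^{(n)}(t),\omega_i^{(n)},\omega_j^{(n)})\Big)dt+\psi(\overline\theta_i^{(n)}(t),\omega_i^{(n)})dt+dB_i^{(n)}(t),\quad \overline\theta^{(n)}(0)=\xi^{(n)}.$$ The double-layer empirical measures are $L_n=\frac1n\sum_{i=1}^n\delta_{(\theta_i^{(n)},\omega_i^{(n)})}$ and $\overline L_n=\frac1n\sum_{i=1}^n\delta_{(\overline\theta_i^{(n)},\omega_i^{(n)})}$, random elements of the space $\mathcal{M}_1(C([0,T],\mathbb{R})\times\mathbb{R}^d)$ of Borel probability measures. Metric. $C([0,T],\mathbb{R})\times\mathbb{R}^d$ carries the metric $\|\theta-\theta'\|_\infty+|\omega-\omega'|$ (sup norm and Euclidean norm). For a real function $f$ on a metric space, $\|f\|_{BL}:=2(\|f\|_\infty+\|f\|_{Lip})$, where $\|f\|_{Lip}$ is the least Lipschitz constant; $d_{BL}(P,Q):=\sup\{|\int f\,d(P-Q)|:\|f\|_{BL}\le1\}$. Two sequences $\{X_n\},\{Y_n\}$ of random elements of a Polish space $(S,d)$, with each pair $X_n,Y_n$ defined on the same probability space, are exponentially equivalent if $\limsup_n\frac1n\log\mathbb{P}(d(X_n,Y_n)>\eta)=-\infty$ for all $\eta>0$. *)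

theory Defs
  imports "HOL-Probability.Probability"
begin

section \<open>Measures on metric spaces and the bounded Lipschitz distance\<close>

definition borel_of_metric :: "'a metric \<Rightarrow> 'a measure" where
  "borel_of_metric m = sigma (mspace m) {U. openin (mtopology_of m) U}"

text \<open>Norms of a real function on a metric space take values in the extended nonnegative reals,
  so that an unbounded or a non-Lipschitz function has norm \<open>\<infinity>\<close>.\<close>

definition sup_norm :: "'a metric \<Rightarrow> ('a \<Rightarrow> real) \<Rightarrow> ennreal" where
  "sup_norm m f = (SUP x\<in>mspace m. ennreal \<bar>f x\<bar>)"

definition lip_norm :: "'a metric \<Rightarrow> ('a \<Rightarrow> real) \<Rightarrow> ennreal" where
  "lip_norm m f =
    (INF L\<in>{L. 0 \<le> L \<and> (\<forall>x\<in>mspace m. \<forall>y\<in>mspace m. \<bar>f x - f y\<bar> \<le> L * mdist m x y)}. ennreal L)"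

definition BL_norm :: "'a metric \<Rightarrow> ('a \<Rightarrow> real) \<Rightarrow> ennreal" where
  "BL_norm m f = 2 * (sup_norm m f + lip_norm m f)"

definition prob_measures :: "'a metric \<Rightarrow> 'a measure set" where
  "prob_measures m = {P. prob_space P \<and> sets P = sets (borel_of_metric m)}"

definition BL_dist :: "'a metric \<Rightarrow> 'a measure \<Rightarrow> 'a measure \<Rightarrow> real" where
  "BL_dist m P Q = (SUP f\<in>{f. BL_norm m f \<le> 1}. \<bar>(\<integral>x. f x \<partial>P) - (\<integral>x. f x \<partial>Q)\<bar>)"

text \<open>The value \<open>0\<close> outside the carrier is only there because \<^term>\<open>Metric_space\<close> asks for
  nonnegativity of the distance on the whole type; see \<open>mdist_BL_metric\<close> below.\<close>

definition BL_metric :: "'a metric \<Rightarrow> 'a measure metric" where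
  "BL_metric m = metric (prob_measures m,
     \<lambda>P Q. if P \<in> prob_measures m \<and> Q \<in> prob_measures m then BL_dist m P Q else 0)"

lemma space_borel_of_metric [simp]: "space (borel_of_metric m) = mspace m"
  unfolding borel_of_metric_def by (rule space_measure_of_conv)

lemma sets_borel_of_metric:
  "sets (borel_of_metric m) = sigma_sets (mspace m) {U. openin (mtopology_of m) U}"
  unfolding borel_of_metric_def
  by (rule sets_measure_of) (use openin_subset in fastforce)

lemma openin_sets_borel_of_metric:
  "openin (mtopology_of m) U \<Longrightarrow> U \<in> sets (borel_of_metric m)"
  by (auto simp: sets_borel_of_metric)

lemma BL_norm_le_1D:
  assumes "BL_norm m f \<le> 1"
  shows "x \<in> mspace m \<Longrightarrow> \<bar>f x\<bar> \<le> 1 / 2"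
    and "\<exists>L\<ge>0. \<forall>x\<in>mspace m. \<forall>y\<in>mspace m. \<bar>f x - f y\<bar> \<le> L * mdist m x y"
proof -
  have 1: "2 * sup_norm m f \<le> 1" and 2: "2 * lip_norm m f \<le> 1"
    using assms unfolding BL_norm_def distrib_left
    by (meson add_increasing add_increasing2 order_trans zero_le order_refl)+
  show "\<bar>f x\<bar> \<le> 1 / 2" if "x \<in> mspace m"
  proof -
    have "ennreal \<bar>f x\<bar> \<le> sup_norm m f"
      unfolding sup_norm_def by (rule SUP_upper) (rule that)
    then have "2 * ennreal \<bar>f x\<bar> \<le> 1"
      using 1 by (meson mult_left_mono order_trans zero_le)
    also have "2 * ennreal \<bar>f x\<bar> = ennreal (2 * \<bar>f x\<bar>)"
      by (simp add: ennreal_mult)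
    finally show ?thesis
      by (simp add: ennreal_le_1)
  qed
  have "lip_norm m f \<noteq> \<infinity>"
    using 2 by (auto simp: ennreal_mult_top top_unique)
  then have "{L. 0 \<le> L \<and> (\<forall>x\<in>mspace m. \<forall>y\<in>mspace m. \<bar>f x - f y\<bar> \<le> L * mdist m x y)} \<noteq> {}"
    unfolding lip_norm_def by (metis INF_empty infinity_ennreal_def top_ennreal_def image_empty ccInf_empty)
  then show "\<exists>L\<ge>0. \<forall>x\<in>mspace m. \<forall>y\<in>mspace m. \<bar>f x - f y\<bar> \<le> L * mdist m x y"
    by blast
qed

lemma BL_norm_le:
  assumes "0 \<le> L" "0 \<le> K" "\<And>x. x \<in> mspace m \<Longrightarrow> \<bar>f x\<bar> \<le> K"
    and "\<And>x y. x \<in> mspace m \<Longrightarrow> y \<in> mspace m \<Longrightarrow> \<bar>f x - f y\<bar> \<le> L * mdist m x y"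
  shows "BL_norm m f \<le> ennreal (2 * (K + L))"
proof -
  have "sup_norm m f \<le> ennreal K"
    unfolding sup_norm_def using assms by (intro SUP_least ennreal_leI) auto
  moreover have "lip_norm m f \<le> ennreal L"
    unfolding lip_norm_def using assms by (intro INF_lower) auto
  ultimately have "BL_norm m f \<le> 2 * (ennreal K + ennreal L)"
    unfolding BL_norm_def by (intro mult_left_mono add_mono) auto
  also have "\<dots> = ennreal (2 * (K + L))"
    using assms by (simp add: ennreal_mult ennreal_plus)
  finally show ?thesis .
qed

lemma lipschitz_borel_measurable:
  fixes f :: "'a \<Rightarrow> real"
  assumes "0 \<le> L" "\<And>x y. x \<in> mspace m \<Longrightarrow> y \<in> mspace m \<Longrightarrow> \<bar>f x - f y\<bar> \<le> L * mdist m x y"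
  shows "f \<in> borel_measurable (borel_of_metric m)"
proof (rule borel_measurableI)
  interpret Metric_space "mspace m" "mdist m" by simp
  fix S :: "real set" assume "open S"
  have "openin mtopology (f -` S \<inter> mspace m)"
    unfolding openin_mtopology
  proof (intro conjI allI impI)
    fix x assume x: "x \<in> f -` S \<inter> mspace m"
    then obtain e where e: "e > 0" "\<And>y. dist y (f x) < e \<Longrightarrow> y \<in> S"
      using \<open>open S\<close> unfolding open_dist by blast
    show "\<exists>r>0. mball x r \<subseteq> f -` S \<inter> mspace m"
    proof (intro exI conjI subsetI)
      show "e / (L + 1) > 0" using e assms by auto
      fix y assume y: "y \<in> mball x (e / (L + 1))"
      then have d: "mdist m x y < e / (L + 1)" and ym: "y \<in> mspace m" by auto
      have "\<bar>f x - f y\<bar> \<le> L * mdist m x y" using assms x ym by auto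
      also have "\<dots> \<le> (L + 1) * mdist m x y"
        by (intro mult_right_mono) auto
      also have "\<dots> < e" using d assms by (simp add: field_simps)
      finally show "y \<in> f -` S \<inter> mspace m"
        using e(2)[of "f y"] ym by (auto simp: dist_real_def abs_minus_commute)
    qed
  qed auto
  then show "f -` S \<inter> space (borel_of_metric m) \<in> sets (borel_of_metric m)"
    by (simp add: openin_sets_borel_of_metric mtopology_of_def)
qed

lemma BL_norm_le_1_integrable:
  assumes "BL_norm m f \<le> 1" "P \<in> prob_measures m"
  shows "integrable P f" "\<bar>\<integral>x. f x \<partial>P\<bar> \<le> 1 / 2"
proof -
  interpret prob_space P using assms by (simp add: prob_measures_def)
  have sets: "sets P = sets (borel_of_metric m)" using assms by (simp add: prob_measures_def)
  then have sp: "space P = mspace m" by (metis sets_eq_imp_space_eq space_borel_of_metric)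
  have "f \<in> borel_measurable P"
    using BL_norm_le_1D(2)[OF assms(1)] lipschitz_borel_measurable[of _ m f]
    unfolding measurable_cong_sets[OF sets refl] by blast
  then show int: "integrable P f"
    using BL_norm_le_1D(1)[OF assms(1)] sp
    by (intro integrable_const_bound[where B="1/2"]) auto
  have "\<bar>\<integral>x. f x \<partial>P\<bar> \<le> (\<integral>x. \<bar>f x\<bar> \<partial>P)" by (rule integral_abs_bound)
  also have "\<dots> \<le> (\<integral>x. 1 / 2 \<partial>P)"
    using int BL_norm_le_1D(1)[OF assms(1)] sp by (intro integral_mono) auto
  finally show "\<bar>\<integral>x. f x \<partial>P\<bar> \<le> 1 / 2" by (simp add: prob_space)
qed

lemma BL_norm_0: "BL_norm m (\<lambda>_. 0) \<le> 1"
  using BL_norm_le[of 0 0 m "\<lambda>_. 0"] by (simp add: order_trans)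

lemma BL_dist_upper:
  assumes "BL_norm m f \<le> 1" "P \<in> prob_measures m" "Q \<in> prob_measures m"
  shows "\<bar>(\<integral>x. f x \<partial>P) - (\<integral>x. f x \<partial>Q)\<bar> \<le> BL_dist m P Q"
  unfolding BL_dist_def
proof (rule cSUP_upper)
  show "bdd_above ((\<lambda>f. \<bar>(\<integral>x. f x \<partial>P) - (\<integral>x. f x \<partial>Q)\<bar>) ` {f. BL_norm m f \<le> 1})"
  proof (rule bdd_aboveI2)
    fix f assume "f \<in> {f. BL_norm m f \<le> 1}"
    then show "\<bar>(\<integral>x. f x \<partial>P) - (\<integral>x. f x \<partial>Q)\<bar> \<le> 1"
      using BL_norm_le_1_integrable(2)[of m f P] BL_norm_le_1_integrable(2)[of m f Q] assms by auto
  qed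
qed (use assms in auto)

lemma BL_dist_least:
  assumes "\<And>f. BL_norm m f \<le> 1 \<Longrightarrow> \<bar>(\<integral>x. f x \<partial>P) - (\<integral>x. f x \<partial>Q)\<bar> \<le> c"
  shows "BL_dist m P Q \<le> c"
  unfolding BL_dist_def using assms BL_norm_0[of m] by (intro cSUP_least) auto

lemma BL_dist_zero_imp_eq:
  assumes P: "P \<in> prob_measures m" and Q: "Q \<in> prob_measures m" and 0: "BL_dist m P Q = 0"
  shows "P = Q"
proof -
  interpret Metric_space "mspace m" "mdist m" by simp
  interpret P: prob_space P using P by (simp add: prob_measures_def)
  interpret Q: prob_space Q using Q by (simp add: prob_measures_def)
  have sP: "sets P = sets (borel_of_metric m)" and sQ: "sets Q = sets (borel_of_metric m)"
    using P Q by (auto simp: prob_measures_def)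
  have spP: "space P = mspace m" and spQ: "space Q = mspace m"
    using sP sQ by (metis sets_eq_imp_space_eq space_borel_of_metric)+
  have same: "(\<integral>x. f x \<partial>P) = (\<integral>x. f x \<partial>Q)"
    if L: "0 \<le> L" and b: "\<And>x. x \<in> mspace m \<Longrightarrow> \<bar>f x\<bar> \<le> 1"
      and l: "\<And>x y. x \<in> mspace m \<Longrightarrow> y \<in> mspace m \<Longrightarrow> \<bar>f x - f y\<bar> \<le> L * mdist m x y"
    for f and L :: real
  proof -
    define c where "c = 1 / (2 * (1 + L))"
    have c: "c > 0" using L by (simp add: c_def)
    have "BL_norm m (\<lambda>x. c * f x) \<le> ennreal (2 * (c * 1 + c * L))"
    proof (rule BL_norm_le)
      fix x y assume xy: "x \<in> mspace m" "y \<in> mspace m"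
      show "\<bar>c * f x\<bar> \<le> c * 1" using b[OF xy(1)] c by (simp add: abs_mult)
      have "\<bar>c * f x - c * f y\<bar> = c * \<bar>f x - f y\<bar>"
        using c by (simp flip: right_diff_distrib add: abs_mult)
      also have "\<dots> \<le> c * (L * mdist m x y)" using l[OF xy] c by (intro mult_left_mono) auto
      finally show "\<bar>c * f x - c * f y\<bar> \<le> c * L * mdist m x y" by (simp add: mult.assoc)
    qed (use c L in auto)
    also have "2 * (c * 1 + c * L) = 1" using L by (simp add: c_def field_simps)
    finally have "BL_norm m (\<lambda>x. c * f x) \<le> 1" by simp
    from BL_dist_upper[OF this P Q] 0 c show ?thesis by simp
  qed
  have eq: "emeasure P U = emeasure Q U" if U: "openin mtopology U" for U
  proof (cases "U = mspace m")
    case True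
    then show ?thesis using P.emeasure_space_1 Q.emeasure_space_1 spP spQ by simp
  next
    case False
    define C where "C = mspace m - U"
    have C: "C \<noteq> {}" "C \<subseteq> mspace m" using False openin_subset[OF U] by (auto simp: C_def)
    define g where "g x = (INF y\<in>C. mdist m x y)" for x
    have bdd: "bdd_below (mdist m x ` C)" for x by (rule bdd_belowI2[of _ 0]) auto
    have g0: "0 \<le> g x" for x unfolding g_def using C by (intro cINF_greatest) auto
    have gl: "g x \<le> g y + mdist m x y" if xy: "x \<in> mspace m" "y \<in> mspace m" for x y
    proof -
      have "g x - mdist m x y \<le> g y"
        unfolding g_def[of y]
      proof (rule cINF_greatest)
        fix z assume z: "z \<in> C"
        have "g x \<le> mdist m x z" unfolding g_def by (rule cINF_lower[OF bdd z])
        also have "\<dots> \<le> mdist m x y + mdist m y z" using xy z C by (intro triangle) auto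
        finally show "g x - mdist m x y \<le> mdist m y z" by simp
      qed (use C in auto)
      then show ?thesis by simp
    qed
    have glip: "\<bar>g x - g y\<bar> \<le> mdist m x y" if "x \<in> mspace m" "y \<in> mspace m" for x y
      using gl[OF that] gl[OF that(2,1)] commute[of x y] by linarith
    have gC: "g x = 0" if "x \<in> C" for x
    proof (rule antisym[OF _ g0])
      have "g x \<le> mdist m x x" unfolding g_def by (rule cINF_lower[OF bdd that])
      then show "g x \<le> 0" using that C by auto
    qed
    have gU: "0 < g x" if x: "x \<in> U" for x
    proof -
      obtain r where r: "r > 0" "mball x r \<subseteq> U" using U x unfolding openin_mtopology by blast
      have "r \<le> g x" unfolding g_def
      proof (rule cINF_greatest)
        fix y assume "y \<in> C"
        then show "r \<le> mdist m x y"
          using r(2) x openin_subset[OF U] by (force simp: C_def not_le)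
      qed (use C in auto)
      then show ?thesis using r by simp
    qed
    define f where "f k x = min 1 (real k * g x)" for k x
    have flip: "\<bar>f k x - f k y\<bar> \<le> real k * mdist m x y" if "x \<in> mspace m" "y \<in> mspace m" for k x y
    proof -
      have "\<bar>f k x - f k y\<bar> \<le> \<bar>real k * g x - real k * g y\<bar>" unfolding f_def by linarith
      also have "\<dots> = real k * \<bar>g x - g y\<bar>" by (simp flip: right_diff_distrib add: abs_mult)
      also have "\<dots> \<le> real k * mdist m x y" using glip[OF that] by (intro mult_left_mono) auto
      finally show ?thesis .
    qed
    have fb: "\<bar>f k x\<bar> \<le> 1" for k x using g0[of x] by (auto simp: f_def)
    have fm: "f k \<in> borel_measurable (borel_of_metric m)" for k
      by (rule lipschitz_borel_measurable[of "real k"]) (use flip in auto)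
    have lim: "(\<lambda>k. f k x) \<longlonglongrightarrow> indicator U x" if x: "x \<in> mspace m" for x
    proof (cases "x \<in> U")
      case True
      obtain N :: nat where N: "1 / g x < real N" using reals_Archimedean2 by blast
      have "\<forall>\<^sub>F k in sequentially. f k x = indicator U x"
        using eventually_ge_at_top[of N]
      proof eventually_elim
        case (elim k)
        then have "1 / g x \<le> real k" using N by linarith
        then show ?case using gU[OF True] True by (simp add: f_def field_simps)
      qed
      then show ?thesis by (rule tendsto_eventually)
    next
      case False
      then show ?thesis using gC[of x] x by (simp add: f_def C_def)
    qed
    have Um: "U \<in> sets (borel_of_metric m)"
      using U openin_sets_borel_of_metric by (simp add: mtopology_of_def)
    have limR: "(\<lambda>k. \<integral>x. f k x \<partial>R) \<longlonglongrightarrow> measure R U"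
      if "prob_space R" and sR: "sets R = sets (borel_of_metric m)" for R
    proof -
      interpret R: prob_space R by fact
      have sp: "space R = mspace m" using sR by (metis sets_eq_imp_space_eq space_borel_of_metric)
      have "(\<lambda>k. \<integral>x. f k x \<partial>R) \<longlonglongrightarrow> (\<integral>x. indicator U x \<partial>R)"
      proof (rule integral_dominated_convergence[where w="\<lambda>_. 1"])
        show "f k \<in> borel_measurable R" for k
          using fm unfolding measurable_cong_sets[OF sR refl] .
        show "(indicator U :: _ \<Rightarrow> real) \<in> borel_measurable R"
          using Um sR by (simp add: borel_measurable_indicator)
      qed (use lim fb sp in auto)
      then show ?thesis using Um sR by simp
    qed
    have "(\<integral>x. f k x \<partial>P) = (\<integral>x. f k x \<partial>Q)" for k
      by (rule same[of "real k"]) (use flip fb in auto)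
    then have "measure P U = measure Q U"
      using limR[OF P.prob_space_axioms sP] limR[OF Q.prob_space_axioms sQ]
      by (simp add: LIMSEQ_unique)
    then show ?thesis by (simp add: P.emeasure_eq_measure Q.emeasure_eq_measure)
  qed
  show "P = Q"
  proof (rule measure_eqI_generator_eq[where E="{U. openin mtopology U}" and \<Omega>="mspace m"
        and A="\<lambda>_. mspace m"])
    show "Int_stable {U. openin mtopology U}" by (auto simp: Int_stable_def)
    show "{U. openin mtopology U} \<subseteq> Pow (mspace m)" using openin_subset by fastforce
    show "sets P = sigma_sets (mspace m) {U. openin mtopology U}"
      and "sets Q = sigma_sets (mspace m) {U. openin mtopology U}"
      using sP sQ by (simp_all add: sets_borel_of_metric mtopology_of_def)
    show "range (\<lambda>_. mspace m) \<subseteq> {U. openin mtopology U}" by auto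
  qed (use eq in auto)
qed

lemma Metric_space_BL:
  "Metric_space (prob_measures m)
     (\<lambda>P Q. if P \<in> prob_measures m \<and> Q \<in> prob_measures m then BL_dist m P Q else 0)"
    (is "Metric_space ?M ?d")
proof
  fix P Q :: "'a measure"
  show "0 \<le> ?d P Q"
    using BL_dist_upper[OF BL_norm_0, of P m Q] by simp
  show "?d P Q = ?d Q P"
    by (simp add: BL_dist_def abs_minus_commute)
next
  fix P Q :: "'a measure" assume PQ: "P \<in> ?M" "Q \<in> ?M"
  have "BL_dist m P P \<le> 0" by (rule BL_dist_least) simp
  then show "(?d P Q = 0) = (P = Q)"
    using BL_dist_zero_imp_eq[OF PQ] BL_dist_upper[OF BL_norm_0 PQ(1) PQ(1)] PQ by auto
next
  fix P Q R :: "'a measure"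
  assume PQR: "P \<in> ?M" "Q \<in> ?M" "R \<in> ?M"
  have "BL_dist m P R \<le> BL_dist m P Q + BL_dist m Q R"
  proof (rule BL_dist_least)
    fix f assume f: "BL_norm m f \<le> 1"
    show "\<bar>(\<integral>x. f x \<partial>P) - (\<integral>x. f x \<partial>R)\<bar> \<le> BL_dist m P Q + BL_dist m Q R"
      using BL_dist_upper[OF f PQR(1,2)] BL_dist_upper[OF f PQR(2,3)] by linarith
  qed
  then show "?d P R \<le> ?d P Q + ?d Q R" using PQR by simp
qed

lemma mspace_BL_metric [simp]: "mspace (BL_metric m) = prob_measures m"
  unfolding BL_metric_def by (rule Metric_space.mspace_metric[OF Metric_space_BL])

lemma mdist_BL_metric:
  "P \<in> prob_measures m \<Longrightarrow> Q \<in> prob_measures m \<Longrightarrow> mdist (BL_metric m) P Q = BL_dist m P Q"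
  unfolding BL_metric_def by (simp add: Metric_space.mdist_metric[OF Metric_space_BL])


section \<open>The space of double-layer paths and empirical measures\<close>

definition sum_metric :: "'a metric \<Rightarrow> 'b metric \<Rightarrow> ('a \<times> 'b) metric" where
  "sum_metric m1 m2 = metric (mspace m1 \<times> mspace m2,
     \<lambda>(x, y) (x', y'). mdist m1 x x' + mdist m2 y y')"

lemma Metric_space_sum:
  "Metric_space (mspace m1 \<times> mspace m2) (\<lambda>(x, y) (x', y'). mdist m1 x x' + mdist m2 y y')"
proof -
  interpret A: Metric_space "mspace m1" "mdist m1" by simp
  interpret B: Metric_space "mspace m2" "mdist m2" by simp
  show ?thesis
  proof
    fix u v :: "'a \<times> 'b"
    show "0 \<le> (case u of (x, y) \<Rightarrow> \<lambda>(x', y'). mdist m1 x x' + mdist m2 y y') v"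
      by (auto split: prod.splits)
    show "(case u of (x, y) \<Rightarrow> \<lambda>(x', y'). mdist m1 x x' + mdist m2 y y') v =
          (case v of (x, y) \<Rightarrow> \<lambda>(x', y'). mdist m1 x x' + mdist m2 y y') u"
      by (auto split: prod.splits simp: A.commute B.commute)
  next
    fix u v :: "'a \<times> 'b" assume "u \<in> mspace m1 \<times> mspace m2" "v \<in> mspace m1 \<times> mspace m2"
    then show "((case u of (x, y) \<Rightarrow> \<lambda>(x', y'). mdist m1 x x' + mdist m2 y y') v = 0) = (u = v)"
      by (auto split: prod.splits simp: add_nonneg_eq_0_iff)
  next
    fix u v w :: "'a \<times> 'b"
    assume "u \<in> mspace m1 \<times> mspace m2" "v \<in> mspace m1 \<times> mspace m2" "w \<in> mspace m1 \<times> mspace m2"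
    then show "(case u of (x, y) \<Rightarrow> \<lambda>(x', y'). mdist m1 x x' + mdist m2 y y') w
       \<le> (case u of (x, y) \<Rightarrow> \<lambda>(x', y'). mdist m1 x x' + mdist m2 y y') v
        + (case v of (x, y) \<Rightarrow> \<lambda>(x', y'). mdist m1 x x' + mdist m2 y y') w"
      using A.triangle[of "fst u" "fst v" "fst w"] B.triangle[of "snd u" "snd v" "snd w"]
      by (auto split: prod.splits)
  qed
qed

lemma mspace_sum_metric [simp]: "mspace (sum_metric m1 m2) = mspace m1 \<times> mspace m2"
  unfolding sum_metric_def by (rule Metric_space.mspace_metric[OF Metric_space_sum])

lemma mdist_sum_metric [simp]:
  "mdist (sum_metric m1 m2) (x, y) (x', y') = mdist m1 x x' + mdist m2 y y'"
  unfolding sum_metric_def by (simp add: Metric_space.mdist_metric[OF Metric_space_sum])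

text \<open>\<open>C([0,T],\<real>)\<close> with the sup norm consists of the functions that are continuous on \<open>{0..T}\<close> and
  \<^const>\<open>undefined\<close> outside \<open>{0..T}\<close>.\<close>

definition path_metric :: "real \<Rightarrow> (real \<Rightarrow> real) metric" where
  "path_metric T = cfunspace (top_of_set {0..T}) euclidean_metric"

definition double_layer_metric :: "real \<Rightarrow> ((real \<Rightarrow> real) \<times> (real^'d)) metric" where
  "double_layer_metric T = sum_metric (path_metric T) euclidean_metric"

lemma mspace_path_metric:
  "mspace (path_metric T) = {f. continuous_on {0..T} f \<and> f \<in> extensional {0..T}}"
proof -
  have "bounded (f ` {0..T})" if "continuous_on {0..T} f" for f :: "real \<Rightarrow> real"
    using compact_continuous_image[OF that] by (simp add: compact_imp_bounded)
  moreover have "Metric_space.mbounded UNIV dist (S :: real set) \<longleftrightarrow> bounded S" for S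
    by (simp add: mbounded_iff_bounded)
  ultimately show ?thesis
    by (auto simp: path_metric_def)
qed

lemma mdist_path_metric:
  assumes "0 \<le> T" "f \<in> mspace (path_metric T)" "g \<in> mspace (path_metric T)"
  shows "mdist (path_metric T) f g = (SUP t\<in>{0..T}. \<bar>f t - g t\<bar>)"
proof -
  have "f \<in> mspace (funspace {0..T} euclidean_metric)" "g \<in> mspace (funspace {0..T} euclidean_metric)"
    using assms cfunspace_subset_funspace[of "top_of_set {0..T}" "euclidean_metric :: real metric"]
    by (auto simp: path_metric_def simp del: mspace_funspace mspace_cfunspace)
  then have "f \<in> Metric_space.fspace UNIV dist {0..T}" "g \<in> Metric_space.fspace UNIV dist {0..T}"
    by simp_all
  then show ?thesis
    using assms(1)
    by (simp add: path_metric_def mdist_cfunspace_eq_mdist_funspace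
        Metric_space.fdist_def[OF Met_TC.Metric_space_axioms] dist_real_def)
qed

text \<open>The measure \<open>(\<Sum>i=1..n. \<delta>\<^bsub>x i\<^esub>) / n\<close> on the measurable space \<open>N\<close>, as the image
  under \<open>x\<close> of the uniform distribution on \<open>{1..n}\<close>.\<close>

definition empirical_measure :: "'a measure \<Rightarrow> nat \<Rightarrow> (nat \<Rightarrow> 'a) \<Rightarrow> 'a measure" where
  "empirical_measure N n x = distr (uniform_count_measure {1..n}) N x"

lemma emeasure_empirical_measure:
  assumes "1 \<le> n" "\<And>i. i \<in> {1..n} \<Longrightarrow> x i \<in> space N" "E \<in> sets N"
  shows "emeasure (empirical_measure N n x) E = (\<Sum>i=1..n. emeasure (return N (x i)) E) / of_nat n"
proof -
  have x: "x \<in> measurable (uniform_count_measure {1..n}) N"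
    using assms(2) by (auto simp: measurable_def sets_uniform_count_measure space_uniform_count_measure)
  have fin: "finite (x -` E \<inter> {1..n})" by simp
  have "(\<Sum>i=1..n. emeasure (return N (x i)) E) = (\<Sum>i=1..n. indicator (x -` E \<inter> {1..n}) i)"
    using assms(3) by (intro sum.cong) (auto simp: indicator_def)
  also have "\<dots> = of_nat (card (x -` E \<inter> {1..n}))"
    by (simp add: indicator_def sum.If_cases) (simp add: Int_def conj_commute conj_ac vimage_def)
  finally have "(\<Sum>i=1..n. emeasure (return N (x i)) E) = of_nat (card (x -` E \<inter> {1..n}))" .
  moreover have "emeasure (empirical_measure N n x) E
      = ennreal (real (card (x -` E \<inter> {1..n})) / real n)"
    unfolding empirical_measure_def using x assms(3)
    by (simp add: emeasure_distr space_uniform_count_measure emeasure_uniform_count_measure)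
  moreover have "ennreal (real (card (x -` E \<inter> {1..n})) / real n)
      = of_nat (card (x -` E \<inter> {1..n})) / of_nat n"
    using assms(1) by (simp add: ennreal_of_nat_eq_real_of_nat divide_ennreal)
  ultimately show ?thesis by simp
qed

definition double_layer_empirical ::
    "real \<Rightarrow> nat \<Rightarrow> (nat \<Rightarrow> real \<Rightarrow> real) \<Rightarrow> (nat \<Rightarrow> real^'d) \<Rightarrow> ((real \<Rightarrow> real) \<times> (real^'d)) measure" where
  "double_layer_empirical T n \<theta> \<omega> =
     empirical_measure (borel_of_metric (double_layer_metric T)) n
       (\<lambda>i. (restrict (\<theta> i) {0..T}, \<omega> i))"


section \<open>Exponential equivalence\<close>

definition ereal_log :: "real \<Rightarrow> ereal" where
  "ereal_log x = (if x = 0 then - \<infinity> else ereal (ln x))"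

text \<open>\<open>M n\<close> is the probability space on which the random elements \<open>X n\<close> and \<open>Y n\<close> of the metric
  space \<open>m\<close> are defined. Sequences are indexed by \<open>n \<ge> 1\<close>.\<close>

definition exponentially_equivalent ::
    "(nat \<Rightarrow> 'w measure) \<Rightarrow> 's metric \<Rightarrow> (nat \<Rightarrow> 'w \<Rightarrow> 's) \<Rightarrow> (nat \<Rightarrow> 'w \<Rightarrow> 's) \<Rightarrow> bool" where
  "exponentially_equivalent M m X Y \<longleftrightarrow>
     (\<forall>n\<ge>1. X n \<in> measurable (M n) (borel_of_metric m) \<and>
            Y n \<in> measurable (M n) (borel_of_metric m)) \<and>
     (\<forall>\<eta>>0. limsup (\<lambda>n. ereal (1 / real n) *
        ereal_log (measure (M n) {w \<in> space (M n). mdist m (X n w) (Y n w) > \<eta>})) = - \<infinity>)"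


section \<open>The random inputs of the particle systems\<close>

definition standard_brownian_motion :: "'w measure \<Rightarrow> real \<Rightarrow> (real \<Rightarrow> 'w \<Rightarrow> real) \<Rightarrow> bool" where
  "standard_brownian_motion M T B \<longleftrightarrow>
     (\<forall>t\<in>{0..T}. B t \<in> borel_measurable M) \<and>
     (AE w in M. B 0 w = 0) \<and>
     (AE w in M. continuous_on {0..T} (\<lambda>t. B t w)) \<and>
     (\<forall>s t. 0 \<le> s \<longrightarrow> s < t \<longrightarrow> t \<le> T \<longrightarrow>
        distributed M lborel (\<lambda>w. B t w - B s w) (normal_density 0 (sqrt (t - s)))) \<and>
     (\<forall>(k::nat) (\<tau>::nat \<Rightarrow> real). strict_mono_on {..k} \<tau> \<longrightarrow> \<tau> ` {..k} \<subseteq> {0..T} \<longrightarrow>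
        prob_space.indep_vars M (\<lambda>_. borel) (\<lambda>i w. B (\<tau> (Suc i)) w - B (\<tau> i) w) {..<k})"

text \<open>The inputs have different value types (initial positions in \<open>\<real>\<close>, environments in
  \<open>\<real>\<^sup>d\<close>, paths of Brownian motions), so their independence is expressed through the sigma-algebras
  they generate. The last one is \<open>\<sigma>(B i s; 0 \<le> s \<le> t)\<close>.\<close>

datatype input = Init nat | Env nat | Noise nat

definition inputs :: "nat \<Rightarrow> input set" where
  "inputs n = Init ` {1..n} \<union> Env ` {1..n} \<union> Noise ` {1..n}"

definition input_algebra ::
    "'w measure \<Rightarrow> real \<Rightarrow> (nat \<Rightarrow> 'w \<Rightarrow> real) \<Rightarrow> (nat \<Rightarrow> 'w \<Rightarrow> real^'d) \<Rightarrow> (nat \<Rightarrow> real \<Rightarrow> 'w \<Rightarrow> real) \<Rightarrow>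
     input \<Rightarrow> 'w measure" where
  "input_algebra M t \<xi> \<omega> B k = (case k of
       Init i \<Rightarrow> vimage_algebra (space M) (\<xi> i) borel
     | Env i \<Rightarrow> vimage_algebra (space M) (\<omega> i) borel
     | Noise i \<Rightarrow> vimage_algebra (space M) (\<lambda>w. \<lambda>s\<in>{0..t}. B i s w) (Pi\<^sub>M {0..t} (\<lambda>_. borel)))"

definition input_sigma ::
    "'w measure \<Rightarrow> real \<Rightarrow> nat \<Rightarrow> (nat \<Rightarrow> 'w \<Rightarrow> real) \<Rightarrow> (nat \<Rightarrow> 'w \<Rightarrow> real^'d) \<Rightarrow>
     (nat \<Rightarrow> real \<Rightarrow> 'w \<Rightarrow> real) \<Rightarrow> 'w measure" where
  "input_sigma M t n \<xi> \<omega> B = sigma (space M) (\<Union>k\<in>inputs n. sets (input_algebra M t \<xi> \<omega> B k))"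

definition independent_inputs ::
    "'w measure \<Rightarrow> real \<Rightarrow> nat \<Rightarrow> real measure \<Rightarrow> (real^'d) measure \<Rightarrow> (nat \<Rightarrow> 'w \<Rightarrow> real) \<Rightarrow>
     (nat \<Rightarrow> 'w \<Rightarrow> real^'d) \<Rightarrow> (nat \<Rightarrow> real \<Rightarrow> 'w \<Rightarrow> real) \<Rightarrow> bool" where
  "independent_inputs M T n lam \<mu> \<xi> \<omega> B \<longleftrightarrow>
     (\<forall>i\<in>{1..n}. \<xi> i \<in> borel_measurable M \<and> distr M borel (\<xi> i) = lam) \<and>
     (\<forall>i\<in>{1..n}. \<omega> i \<in> borel_measurable M \<and> distr M borel (\<omega> i) = \<mu>) \<and>
     (\<forall>i\<in>{1..n}. standard_brownian_motion M T (B i)) \<and>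
     prob_space.indep_sets M (\<lambda>k. sets (input_algebra M T \<xi> \<omega> B k)) (inputs n)"


section \<open>Conditional independence and the random graph\<close>

definition cond_prob :: "'w measure \<Rightarrow> 'w measure \<Rightarrow> 'w set \<Rightarrow> 'w \<Rightarrow> real" where
  "cond_prob M G E = real_cond_exp M G (indicator E)"

definition cond_indep_vars ::
    "'w measure \<Rightarrow> 'w measure \<Rightarrow> ('i \<Rightarrow> 'b measure) \<Rightarrow> ('i \<Rightarrow> 'w \<Rightarrow> 'b) \<Rightarrow> 'i set \<Rightarrow> bool" where
  "cond_indep_vars M G N X I \<longleftrightarrow>
     (\<forall>i\<in>I. X i \<in> measurable M (N i)) \<and>
     (\<forall>J\<subseteq>I. J \<noteq> {} \<longrightarrow> finite J \<longrightarrow> (\<forall>E\<in>(\<Pi> i\<in>J. sets (N i)).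
        AE w in M. cond_prob M G {v \<in> space M. \<forall>i\<in>J. X i v \<in> E i} w
                 = (\<Prod>i\<in>J. cond_prob M G {v \<in> space M. X i v \<in> E i} w)))"

definition random_symmetric_graph ::
    "'w measure \<Rightarrow> 'w measure \<Rightarrow> nat \<Rightarrow> (nat \<Rightarrow> nat \<Rightarrow> 'w \<Rightarrow> real) \<Rightarrow> (nat \<Rightarrow> nat \<Rightarrow> 'w \<Rightarrow> real) \<Rightarrow> bool" where
  "random_symmetric_graph M G n q A \<longleftrightarrow>
     (\<forall>i\<in>{1..n}. \<forall>j\<in>{1..n}. \<forall>w\<in>space M. A i j w \<in> {0, 1} \<and> A i j w = A j i w) \<and>
     cond_indep_vars M G (\<lambda>_. borel) (\<lambda>(i, j). A i j) {(i, j). 1 \<le> i \<and> i \<le> j \<and> j \<le> n} \<and>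
     (\<forall>i j. 1 \<le> i \<longrightarrow> i \<le> j \<longrightarrow> j \<le> n \<longrightarrow>
        (AE w in M. cond_prob M G {v \<in> space M. A i j v = 1} w = q i j w))"


section \<open>The stochastic differential equations\<close>

text \<open>Time-\<open>t\<close> sigma-algebra of the filtration generated by the initial positions, the environments,
  the graph and the Brownian motions up to time \<open>t\<close>, augmented by the null sets.\<close>

definition system_filtration ::
    "'w measure \<Rightarrow> nat \<Rightarrow> (nat \<Rightarrow> 'w \<Rightarrow> real) \<Rightarrow> (nat \<Rightarrow> 'w \<Rightarrow> real^'d) \<Rightarrow> (nat \<Rightarrow> real \<Rightarrow> 'w \<Rightarrow> real) \<Rightarrow>
     (nat \<Rightarrow> nat \<Rightarrow> 'w \<Rightarrow> real) \<Rightarrow> real \<Rightarrow> 'w measure" where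
  "system_filtration M n \<xi> \<omega> B A t = sigma (space M)
     ((\<Union>k\<in>inputs n. sets (input_algebra M t \<xi> \<omega> B k)) \<union>
      (\<Union>(i, j)\<in>{1..n} \<times> {1..n}. sets (vimage_algebra (space M) (A i j) borel)) \<union>
      null_sets M)"

text \<open>Strong solution on \<open>[0,T]\<close>, adapted to \<open>F\<close>, of \<open>dX\<^sub>i(t) = b i (X(t)) dt + dB\<^sub>i(t)\<close>,
  \<open>X\<^sub>i(0) = \<xi>\<^sub>i\<close>, \<open>i = 1,...,n\<close>, with a random drift \<open>b\<close>. As the noise is additive, the stochastic
  integral of the constant \<open>1\<close> is \<open>B i t\<close> and the equation is a pathwise integral equation.\<close>

definition strong_solution ::
    "'w measure \<Rightarrow> real \<Rightarrow> nat \<Rightarrow> (real \<Rightarrow> 'w measure) \<Rightarrow> (nat \<Rightarrow> 'w \<Rightarrow> real) \<Rightarrow>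
     (nat \<Rightarrow> (nat \<Rightarrow> real) \<Rightarrow> 'w \<Rightarrow> real) \<Rightarrow> (nat \<Rightarrow> real \<Rightarrow> 'w \<Rightarrow> real) \<Rightarrow> (nat \<Rightarrow> real \<Rightarrow> 'w \<Rightarrow> real) \<Rightarrow> bool" where
  "strong_solution M T n F \<xi> b B X \<longleftrightarrow>
     (\<forall>i\<in>{1..n}. \<forall>w\<in>space M. continuous_on {0..T} (\<lambda>t. X i t w)) \<and>
     (\<forall>i\<in>{1..n}. \<forall>t\<in>{0..T}. X i t \<in> borel_measurable (F t)) \<and>
     (AE w in M. \<forall>i\<in>{1..n}. \<forall>t\<in>{0..T}.
        (\<lambda>s. b i (\<lambda>j. X j s w) w) integrable_on {0..t} \<and>
        X i t w = \<xi> i w + integral {0..t} (\<lambda>s. b i (\<lambda>j. X j s w) w) + B i t w)"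

definition graph_drift ::
    "nat \<Rightarrow> real \<Rightarrow> (real \<times> real \<times> (real^'d) \<times> (real^'d) \<Rightarrow> real) \<Rightarrow> (real \<times> (real^'d) \<Rightarrow> real) \<Rightarrow>
     (nat \<Rightarrow> nat \<Rightarrow> 'w \<Rightarrow> real) \<Rightarrow> (nat \<Rightarrow> 'w \<Rightarrow> real^'d) \<Rightarrow> nat \<Rightarrow> (nat \<Rightarrow> real) \<Rightarrow> 'w \<Rightarrow> real" where
  "graph_drift n p \<phi> \<psi> A \<omega> i x w =
     1 / (real n * p) * (\<Sum>j=1..n. A i j w * \<phi> (x i, x j, \<omega> i w, \<omega> j w)) + \<psi> (x i, \<omega> i w)"

definition mean_field_drift ::
    "nat \<Rightarrow> (real \<times> real \<times> (real^'d) \<times> (real^'d) \<Rightarrow> real) \<Rightarrow> (real \<times> (real^'d) \<Rightarrow> real) \<Rightarrow>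
     (nat \<Rightarrow> 'w \<Rightarrow> real^'d) \<Rightarrow> nat \<Rightarrow> (nat \<Rightarrow> real) \<Rightarrow> 'w \<Rightarrow> real" where
  "mean_field_drift n \<phi> \<psi> \<omega> i x w =
     1 / real n * (\<Sum>j=1..n. \<phi> (x i, x j, \<omega> i w, \<omega> j w)) + \<psi> (x i, \<omega> i w)"

definition weighted_interaction ::
    "((real^'d) \<times> (real^'d) \<Rightarrow> real) \<Rightarrow> (real \<times> real \<times> (real^'d) \<times> (real^'d) \<Rightarrow> real) \<Rightarrow>
     real \<times> real \<times> (real^'d) \<times> (real^'d) \<Rightarrow> real" where
  "weighted_interaction W \<phi> = (\<lambda>(x, y, u, v). W (u, v) * \<phi> (x, y, u, v))"

definition bounded_with_bounded_derivative :: "('a::real_normed_vector \<Rightarrow> real) \<Rightarrow> bool" where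
  "bounded_with_bounded_derivative f \<longleftrightarrow>
     bounded (range f) \<and> (\<forall>z. f differentiable (at z)) \<and>
     bounded (range (\<lambda>z. onorm (frechet_derivative f (at z))))"

end

theory Submission
  imports Defs
begin

text \<open>Both systems are driven by the same noise, so the difference of the solutions is controlled
  pathwise by Gronwall's inequality. Splitting the interaction at the mean-field solution \<open>\<theta>'\<close>
  leaves two error terms of the form \<open>\<Sum>\<^sub>i \<bar>\<Sum>\<^sub>j (A i j - p W(\<omega>\<^sub>i, \<omega>\<^sub>j)) c i j\<bar> / (n\<^sup>2 p)\<close>:
  with \<open>c = 1\<close> it bounds the total excess degree, and with \<open>c\<close> the interaction evaluated along \<open>\<theta>'\<close> it
  bounds the fluctuation of the graph around its mean. Given the inputs, \<open>\<theta>'\<close> is deterministic, so that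
  expanding the absolute values into \<open>2 ^ n\<close> choices of signs and bounding the exponential moment of a
  sum of independent centred Bernoulli variables gives a deviation probability of order
  \<open>2 ^ n exp (- c n\<^sup>2 p)\<close>, which is superexponentially small as \<open>n p \<rightarrow> \<infinity>\<close>. The measurability of \<open>\<theta>'\<close>
  with respect to the inputs is replaced by its Euler approximations, which are explicit functions of
  the inputs and converge to \<open>\<theta>'\<close> along every path.\<close>

section \<open>Pathwise estimates\<close>

text \<open>The probability has to fall below exp (- K n) for every K. The degree of a single vertex
  deviates from its mean, of order n p, with probability of order exp (- c n p), so for small p no
  bound uniform over the vertices is available at this scale. The total deviation over all vertices
  has exponent n^2 p. Hence every estimate is averaged over the vertices, and the symmetry of
  \<open>A\<close> turns column sums into row sums, so that degrees are all that is needed. The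
  price is one sign per vertex, an entropy of n log 2, and this is where n p tending to infinity
  enters. Adaptedness in \<open>strong_solution\<close> refers to a filtration that contains the
  graph, so it does not present \<open>\<theta>'\<close> as a function of the inputs; this is why
  the Euler scheme is needed. No rate of its convergence holds for all realisations at once. The
  tail bound is therefore made uniform in the number N of steps, by Jensen's inequality for the time
  average instead of a union bound, and the limit is taken through the event that the estimate fails
  for all large N.\<close>

lemma gronwall:
  fixes u :: "real \<Rightarrow> real"
  assumes cont: "continuous_on {0..T} u" and K: "0 < K" and T: "0 \<le> T"
    and le: "\<And>t. t \<in> {0..T} \<Longrightarrow> u t \<le> a + K * integral {0..t} u"
    and nonneg: "\<And>t. t \<in> {0..T} \<Longrightarrow> 0 \<le> u t"
    and t: "t \<in> {0..T}"
  shows "u t \<le> 2 * a * exp (2 * K * T)"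
proof -
  \<comment> \<open>The rate 2 K of the weight is twice the Gronwall rate: at the maximum point
    \<open>r\<close> of \<open>v\<close> the integral term is then at most half of
    \<open>u r\<close> and can be absorbed, which gives the factor 2 in front of
    \<open>a\<close>.\<close>
  define v where "v s = exp (- (2 * K * s)) * u s" for s
  have "continuous_on {0..T} v"
    unfolding v_def by (intro continuous_intros cont)
  then obtain r where r: "r \<in> {0..T}" "\<And>s. s \<in> {0..T} \<Longrightarrow> v s \<le> v r"
    using continuous_attains_sup[of "{0..T}" v] T by auto
  have u_v: "u s = exp (2 * K * s) * v s" for s
    by (simp add: v_def flip: mult.assoc exp_add)
  have "((\<lambda>s. exp (2 * K * s) * v r) has_integral
      exp (2 * K * r) / (2 * K) * v r - exp (2 * K * 0) / (2 * K) * v r) {0..r}"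
    using r(1) K by (intro fundamental_theorem_of_calculus)
      (auto intro!: derivative_eq_intros simp flip: has_real_derivative_iff_has_vector_derivative)
  then have "((\<lambda>s. exp (2 * K * s) * v r) has_integral (exp (2 * K * r) - 1) * v r / (2 * K)) {0..r}"
    by (simp add: diff_divide_distrib left_diff_distrib)
  note I = integral_unique[OF this] and int = has_integral_integrable[OF this]
  have vr: "0 \<le> v r"
    using nonneg[OF r(1)] by (simp add: v_def)
  have sub: "{0..r} \<subseteq> {0..T}"
    using r(1) by auto
  have "integral {0..r} u \<le> integral {0..r} (\<lambda>s. exp (2 * K * s) * v r)"
    using r sub by (intro integral_le int integrable_continuous_interval continuous_on_subset[OF cont])
      (auto simp: u_v intro!: mult_left_mono)
  then have "u r \<le> a + K * ((exp (2 * K * r) - 1) * v r / (2 * K))"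
    using le[OF r(1)] K unfolding I by (meson add_left_mono mult_left_mono less_imp_le order_trans)
  also have "\<dots> = a + (exp (2 * K * r) - 1) * v r / 2"
    using K by simp
  also have "\<dots> \<le> a + u r / 2"
    using u_v[of r] vr by (simp add: left_diff_distrib)
  finally have ur: "u r \<le> 2 * a" by simp
  have "u t \<le> exp (2 * K * t) * v r"
    using r(2)[OF t] unfolding u_v[of t] by (intro mult_left_mono) auto
  also have "\<dots> \<le> exp (2 * K * T) * u r"
    using t r(1) K nonneg[OF r(1)] unfolding v_def
    by (intro mult_mono mult_left_le_one_le) auto
  also have "\<dots> \<le> exp (2 * K * T) * (2 * a)"
    using ur by (intro mult_left_mono) auto
  finally show ?thesis by (simp add: mult_ac)
qed

text \<open>Equivalently the maximum over signs \<sigma> of the sum of \<sigma> i * e i j. The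
  absolute values stand outside the row sums, so only n signs have to be chosen.\<close>

definition fluctuation :: "nat \<Rightarrow> (nat \<Rightarrow> nat \<Rightarrow> real) \<Rightarrow> real" where
  "fluctuation n e = (\<Sum>i=1..n. \<bar>\<Sum>j=1..n. e i j\<bar>)"

text \<open>One realisation: the environments are frozen into the indices of \<open>f\<close> and
  \<open>g\<close>. The two drifts then differ only in the coefficient matrix \<open>c\<close> of
  \<open>interaction_drift\<close>.\<close>

locale interaction =
  fixes n :: nat and b L :: real
    and f :: "nat \<Rightarrow> nat \<Rightarrow> real \<Rightarrow> real \<Rightarrow> real" and g :: "nat \<Rightarrow> real \<Rightarrow> real"
  assumes n: "1 \<le> n" and b: "0 \<le> b" and L: "0 \<le> L"
    and f_bound: "\<And>i j u v. \<bar>f i j u v\<bar> \<le> b"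
    and f_lipschitz: "\<And>i j u v u' v'. \<bar>f i j u v - f i j u' v'\<bar> \<le> L * (\<bar>u - u'\<bar> + \<bar>v - v'\<bar>)"
    and g_lipschitz: "\<And>i u u'. \<bar>g i u - g i u'\<bar> \<le> L * \<bar>u - u'\<bar>"
begin

definition interaction_drift :: "(nat \<Rightarrow> nat \<Rightarrow> real) \<Rightarrow> nat \<Rightarrow> (nat \<Rightarrow> real) \<Rightarrow> real" where
  "interaction_drift c i v = (\<Sum>j=1..n. c i j * f i j (v i) (v j)) + g i (v i)"

text \<open>Boundedness takes over from the Lipschitz property once a distance exceeds 1: one of the
  minima is then 1, and \<open>2 * b\<close> already bounds the difference.\<close>

lemma f_lipschitz_truncated:
  "\<bar>f i j u v - f i j u' v'\<bar> \<le> (L + 2 * b) * (min 1 \<bar>u - u'\<bar> + min 1 \<bar>v - v'\<bar>)"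
proof (cases "\<bar>u - u'\<bar> \<le> 1 \<and> \<bar>v - v'\<bar> \<le> 1")
  case True
  then have "L * (\<bar>u - u'\<bar> + \<bar>v - v'\<bar>) \<le> (L + 2 * b) * (min 1 \<bar>u - u'\<bar> + min 1 \<bar>v - v'\<bar>)"
    using b L by (intro mult_mono) auto
  then show ?thesis using f_lipschitz[of i j u v u' v'] by linarith
next
  case False
  then have "2 * b * 1 \<le> (L + 2 * b) * (min 1 \<bar>u - u'\<bar> + min 1 \<bar>v - v'\<bar>)"
    using L b by (intro mult_mono) auto
  then show ?thesis using f_bound[of i j u v] f_bound[of i j u' v'] by linarith
qed

lemma abs_le_sum: "j \<in> {1..n} \<Longrightarrow> \<bar>u j - v j\<bar> \<le> (\<Sum>i=1..n. \<bar>u i - v i :: real\<bar>)"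
  by (rule member_le_sum) auto

text \<open>The constant depends on \<open>n\<close> and on the realised coefficients. This is
  harmless, because the estimate only serves the convergence of the Euler scheme along a fixed path;
  the stability estimate does not use it.\<close>

lemma sum_f_lipschitz:
  assumes i: "i \<in> {1..n}"
  shows "\<bar>(\<Sum>j=1..n. c i j * f i j (u i) (u j)) - (\<Sum>j=1..n. c i j * f i j (v i) (v j))\<bar>
    \<le> 2 * L * (\<Sum>j=1..n. \<bar>c i j\<bar>) * (\<Sum>j=1..n. \<bar>u j - v j\<bar>)"
proof -
  have "\<bar>(\<Sum>j=1..n. c i j * f i j (u i) (u j)) - (\<Sum>j=1..n. c i j * f i j (v i) (v j))\<bar>
      \<le> (\<Sum>j=1..n. \<bar>c i j\<bar> * \<bar>f i j (u i) (u j) - f i j (v i) (v j)\<bar>)"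
    by (simp flip: sum_subtractf right_diff_distrib abs_mult add: sum_abs)
  also have "\<dots> \<le> (\<Sum>j=1..n. \<bar>c i j\<bar> * (L * (2 * (\<Sum>j=1..n. \<bar>u j - v j\<bar>))))"
  proof (intro sum_mono mult_left_mono)
    fix j assume j: "j \<in> {1..n}"
    have "\<bar>f i j (u i) (u j) - f i j (v i) (v j)\<bar> \<le> L * (\<bar>u i - v i\<bar> + \<bar>u j - v j\<bar>)"
      by (rule f_lipschitz)
    also have "\<dots> \<le> L * (2 * (\<Sum>j=1..n. \<bar>u j - v j\<bar>))"
      using abs_le_sum[OF i, of u v] abs_le_sum[OF j, of u v] L by (intro mult_left_mono) linarith+
    finally show "\<bar>f i j (u i) (u j) - f i j (v i) (v j)\<bar> \<le> L * (2 * (\<Sum>j=1..n. \<bar>u j - v j\<bar>))" .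
  qed auto
  also have "\<dots> = 2 * L * (\<Sum>j=1..n. \<bar>c i j\<bar>) * (\<Sum>j=1..n. \<bar>u j - v j\<bar>)"
    by (subst sum_distrib_right[symmetric]) (simp add: mult_ac)
  finally show ?thesis .
qed

lemma interaction_drift_lipschitz:
  assumes i: "i \<in> {1..n}"
  shows "\<bar>interaction_drift c i u - interaction_drift c i v\<bar>
    \<le> (2 * L * (\<Sum>i=1..n. \<Sum>j=1..n. \<bar>c i j\<bar>) + L) * (\<Sum>j=1..n. \<bar>u j - v j\<bar>)"
proof -
  let ?s = "\<Sum>j=1..n. \<bar>u j - v j\<bar>"
  have "\<bar>(\<Sum>j=1..n. c i j * f i j (u i) (u j)) - (\<Sum>j=1..n. c i j * f i j (v i) (v j))\<bar>
      \<le> 2 * L * (\<Sum>j=1..n. \<bar>c i j\<bar>) * ?s"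
    by (rule sum_f_lipschitz[OF i])
  also have "\<dots> \<le> 2 * L * (\<Sum>i=1..n. \<Sum>j=1..n. \<bar>c i j\<bar>) * ?s"
    using L i by (intro mult_left_mono mult_right_mono member_le_sum[of i _ "\<lambda>i. \<Sum>j=1..n. \<bar>c i j\<bar>"])
      (auto intro!: sum_nonneg)
  moreover have "\<bar>g i (u i) - g i (v i)\<bar> \<le> L * ?s"
    using g_lipschitz[of i "u i" "v i"] mult_left_mono[OF abs_le_sum[OF i, of u v] L] by linarith
  ultimately show ?thesis
    unfolding interaction_drift_def distrib_right by linarith
qed

lemma fluctuation_lipschitz:
  "\<bar>fluctuation n (\<lambda>i j. c i j * f i j (u i) (u j)) - fluctuation n (\<lambda>i j. c i j * f i j (v i) (v j))\<bar>
    \<le> 2 * L * (\<Sum>i=1..n. \<Sum>j=1..n. \<bar>c i j\<bar>) * (\<Sum>j=1..n. \<bar>u j - v j\<bar>)"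
proof -
  have "\<bar>fluctuation n (\<lambda>i j. c i j * f i j (u i) (u j)) - fluctuation n (\<lambda>i j. c i j * f i j (v i) (v j))\<bar>
      \<le> (\<Sum>i=1..n. \<bar>(\<Sum>j=1..n. c i j * f i j (u i) (u j)) - (\<Sum>j=1..n. c i j * f i j (v i) (v j))\<bar>)"
    unfolding fluctuation_def by (subst sum_subtractf[symmetric])
      (intro order_trans[OF sum_abs] sum_mono abs_triangle_ineq3)
  also have "\<dots> \<le> (\<Sum>i=1..n. 2 * L * (\<Sum>j=1..n. \<bar>c i j\<bar>) * (\<Sum>j=1..n. \<bar>u j - v j\<bar>))"
    by (intro sum_mono sum_f_lipschitz)
  also have "\<dots> = 2 * L * (\<Sum>i=1..n. \<Sum>j=1..n. \<bar>c i j\<bar>) * (\<Sum>j=1..n. \<bar>u j - v j\<bar>)"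
    unfolding sum_distrib_right[symmetric] sum_distrib_left[symmetric] ..
  finally show ?thesis .
qed

lemma continuous_on_f:
  assumes "continuous_on S u" "continuous_on S v"
  shows "continuous_on S (\<lambda>s. f i j (u s) (v s))"
proof -
  have "(2 * L)-lipschitz_on UNIV (\<lambda>z. f i j (fst z) (snd z))"
  proof (rule lipschitz_onI)
    fix z z' :: "real \<times> real"
    have "\<bar>f i j (fst z) (snd z) - f i j (fst z') (snd z')\<bar> \<le> L * (dist (fst z) (fst z') + dist (snd z) (snd z'))"
      using f_lipschitz by (simp add: dist_real_def)
    also have "\<dots> \<le> L * (dist z z' + dist z z')"
      using L by (intro mult_left_mono add_mono dist_fst_le dist_snd_le)
    finally show "dist (f i j (fst z) (snd z)) (f i j (fst z') (snd z')) \<le> 2 * L * dist z z'"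
      by (simp add: dist_real_def)
  qed (use L in auto)
  then have "continuous_on UNIV (\<lambda>z. f i j (fst z) (snd z))"
    by (rule lipschitz_on_continuous_on)
  from continuous_on_compose2[OF this continuous_on_Pair[OF assms]] show ?thesis
    by simp
qed

lemma continuous_on_g:
  assumes "continuous_on S u"
  shows "continuous_on S (\<lambda>s. g i (u s))"
proof -
  have "L-lipschitz_on UNIV (g i)"
    using g_lipschitz L by (intro lipschitz_onI) (auto simp: dist_real_def)
  then show ?thesis
    using continuous_on_compose2[OF lipschitz_on_continuous_on assms] by auto
qed

lemma continuous_on_interaction_drift:
  assumes "\<And>j. j \<in> {1..n} \<Longrightarrow> continuous_on S (y j)" "i \<in> {1..n}"
  shows "continuous_on S (\<lambda>s. interaction_drift c i (\<lambda>j. y j s))"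
  unfolding interaction_drift_def using assms
  by (intro continuous_intros continuous_on_f continuous_on_g) auto

lemma continuous_on_fluctuation:
  assumes "\<And>j. j \<in> {1..n} \<Longrightarrow> continuous_on S (y j)"
  shows "continuous_on S (\<lambda>s. fluctuation n (\<lambda>i j. c i j * f i j (y i s) (y j s)))"
  unfolding fluctuation_def using assms
  by (intro continuous_intros continuous_on_f) auto

text \<open>The Gronwall rate: \<open>w\<close> bounds the normalised mean degree, the factor 2
  counts the two endpoints of an edge, \<open>L\<close> comes from \<open>g\<close>, and the summand
  1 makes the rate positive.\<close>

definition growth_const :: "real \<Rightarrow> real" where
  "growth_const w = 2 * (L + 2 * b) * w + L + 1"

text \<open>The first factor is the Gronwall bound put back once into the integral inequality; the
  second compares the weights of the two error terms. Neither \<open>n\<close> nor \<open>p\<close>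
  nor the graph enters, so one constant serves all systems.\<close>

definition stability_const :: "real \<Rightarrow> real \<Rightarrow> real" where
  "stability_const w T =
     (2 * growth_const w * T * exp (2 * growth_const w * T) + 1) * (2 * (L + 2 * b) + 1)"

text \<open>The interaction difference is bounded by the truncated distances \<open>min 1 \<bar>x\<^sub>i - y\<^sub>i\<bar>\<close>, so that
  vertices of exceptionally large degree cost no more than their excess degree.\<close>

lemma interaction_stability:
  fixes a V :: "nat \<Rightarrow> nat \<Rightarrow> real" and x y :: "nat \<Rightarrow> real \<Rightarrow> real"
  assumes T: "0 < T" and p: "0 < p" and w: "0 \<le> w"
    and a: "\<And>i j. i \<in> {1..n} \<Longrightarrow> j \<in> {1..n} \<Longrightarrow> 0 \<le> a i j"
    and a_sym: "\<And>i j. i \<in> {1..n} \<Longrightarrow> j \<in> {1..n} \<Longrightarrow> a i j = a j i"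
    and V: "\<And>i j. V i j \<le> w"
    and x: "\<And>i. i \<in> {1..n} \<Longrightarrow> continuous_on {0..T} (x i)"
    and y: "\<And>i. i \<in> {1..n} \<Longrightarrow> continuous_on {0..T} (y i)"
    and eq: "\<And>i t. i \<in> {1..n} \<Longrightarrow> t \<in> {0..T} \<Longrightarrow> x i t - y i t =
      integral {0..t} (\<lambda>s. interaction_drift (\<lambda>i j. a i j / (real n * p)) i (\<lambda>j. x j s)) -
      integral {0..t} (\<lambda>s. interaction_drift (\<lambda>i j. V i j / real n) i (\<lambda>j. y j s))"
  defines "e \<equiv> \<lambda>i j. a i j - p * V i j"
  obtains D where "\<And>i t. i \<in> {1..n} \<Longrightarrow> t \<in> {0..T} \<Longrightarrow> \<bar>x i t - y i t\<bar> \<le> D i"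
    and "(\<Sum>i=1..n. D i) / real n \<le> stability_const w T *
      (T * (fluctuation n e / ((real n)\<^sup>2 * p)) +
       integral {0..T} (\<lambda>s. fluctuation n (\<lambda>i j. e i j * f i j (y i s) (y j s)) / ((real n)\<^sup>2 * p)))"
proof -
  define C where "C = L + 2 * b"
  define K where "K = growth_const w"
  have C: "0 \<le> C" using b L by (simp add: C_def)
  have K: "0 < K" using b L w by (auto simp: K_def growth_const_def intro!: add_nonneg_pos)
  have n0: "0 < real n" using n by simp
  define m where "m i s = min 1 \<bar>x i s - y i s\<bar>" for i s
  define u where "u s = (\<Sum>i=1..n. \<bar>x i s - y i s\<bar>) / real n" for s
  define \<rho> where "\<rho> i s = \<bar>\<Sum>j=1..n. e i j * f i j (y i s) (y j s)\<bar> / (real n * p)" for i s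
  define G where "G i s = C * (\<Sum>j=1..n. a i j * (m i s + m j s)) / (real n * p) + \<rho> i s + L * \<bar>x i s - y i s\<bar>"
    for i s
  define R where "R s = fluctuation n (\<lambda>i j. e i j * f i j (y i s) (y j s)) / ((real n)\<^sup>2 * p)" for s
  define Q where "Q = fluctuation n e / ((real n)\<^sup>2 * p)"
  have m: "0 \<le> m i s" "m i s \<le> 1" "m i s \<le> \<bar>x i s - y i s\<bar>" for i s
    by (auto simp: m_def)
  have Q0: "0 \<le> Q" and R0: "0 \<le> R s" for s
    using n0 p by (auto simp: Q_def R_def fluctuation_def intro!: divide_nonneg_pos sum_nonneg)
  have m_cont: "continuous_on {0..T} (m i)" if "i \<in> {1..n}" for i
    unfolding m_def using x[OF that] y[OF that] by (intro continuous_intros)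
  have \<rho>_cont: "continuous_on {0..T} (\<rho> i)" if "i \<in> {1..n}" for i
    unfolding \<rho>_def using y that n0 p by (intro continuous_intros continuous_on_f) auto
  have u_cont: "continuous_on {0..T} u"
    unfolding u_def using x y n0 by (intro continuous_intros) auto
  have R_cont: "continuous_on {0..T} R"
    unfolding R_def using y n0 p by (intro continuous_intros continuous_on_fluctuation) auto
  have G_cont: "continuous_on {0..T} (G i)" if "i \<in> {1..n}" for i
    unfolding G_def using x y that n0 p by (intro continuous_intros m_cont \<rho>_cont) auto
  have G0: "0 \<le> G i s" if "i \<in> {1..n}" for i s
    unfolding G_def \<rho>_def using a[OF that] C L n0 p m
    by (intro add_nonneg_nonneg mult_nonneg_nonneg divide_nonneg_pos sum_nonneg) auto
  have drift: "\<bar>interaction_drift (\<lambda>i j. a i j / (real n * p)) i (\<lambda>j. x j s) -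
      interaction_drift (\<lambda>i j. V i j / real n) i (\<lambda>j. y j s)\<bar> \<le> G i s" if i: "i \<in> {1..n}" for i s
  proof -
    have "\<bar>\<Sum>j=1..n. a i j / (real n * p) * (f i j (x i s) (x j s) - f i j (y i s) (y j s))\<bar>
        \<le> (\<Sum>j=1..n. a i j / (real n * p) * (C * (m i s + m j s)))"
    proof (intro order_trans[OF sum_abs] sum_mono)
      fix j assume "j \<in> {1..n}"
      then have "0 \<le> a i j / (real n * p)" using a[OF i] n0 p by auto
      then show "\<bar>a i j / (real n * p) * (f i j (x i s) (x j s) - f i j (y i s) (y j s))\<bar>
          \<le> a i j / (real n * p) * (C * (m i s + m j s))"
        unfolding abs_mult C_def m_def using f_lipschitz_truncated
        by (simp only: abs_of_nonneg mult_left_mono)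
    qed
    also have "\<dots> = C * (\<Sum>j=1..n. a i j * (m i s + m j s)) / (real n * p)"
      unfolding sum_distrib_left sum_divide_distrib by (intro sum.cong) auto
    finally have 1: "\<bar>\<Sum>j=1..n. a i j / (real n * p) * (f i j (x i s) (x j s) - f i j (y i s) (y j s))\<bar>
        \<le> C * (\<Sum>j=1..n. a i j * (m i s + m j s)) / (real n * p)" .
    have "(\<Sum>j=1..n. (a i j / (real n * p) - V i j / real n) * f i j (y i s) (y j s))
        = (\<Sum>j=1..n. e i j * f i j (y i s) (y j s)) / (real n * p)"
      unfolding sum_divide_distrib e_def using n0 p by (intro sum.cong) (auto simp: field_simps)
    then have 2: "\<bar>\<Sum>j=1..n. (a i j / (real n * p) - V i j / real n) * f i j (y i s) (y j s)\<bar> = \<rho> i s"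
      using n0 p by (simp add: \<rho>_def)
    have "interaction_drift (\<lambda>i j. a i j / (real n * p)) i (\<lambda>j. x j s) -
        interaction_drift (\<lambda>i j. V i j / real n) i (\<lambda>j. y j s)
      = (\<Sum>j=1..n. a i j / (real n * p) * (f i j (x i s) (x j s) - f i j (y i s) (y j s)))
        + (\<Sum>j=1..n. (a i j / (real n * p) - V i j / real n) * f i j (y i s) (y j s))
        + (g i (x i s) - g i (y i s))"
      unfolding interaction_drift_def by (simp add: algebra_simps sum.distrib sum_subtractf)
    then show ?thesis
      unfolding G_def using 1 2 g_lipschitz[of i "x i s" "y i s"] by linarith
  qed
  have G_avg: "(\<Sum>i=1..n. G i s) / real n \<le> K * u s + (2 * C * Q + R s)" for s
  proof -
    have "(\<Sum>i=1..n. \<Sum>j=1..n. a i j * (m i s + m j s))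
        = (\<Sum>i=1..n. \<Sum>j=1..n. a i j * m i s) + (\<Sum>i=1..n. \<Sum>j=1..n. a i j * m j s)"
      by (simp add: distrib_left sum.distrib)
    \<comment> \<open>Symmetry of \<open>a\<close> turns the sum weighted by the second endpoint
      into one weighted by the first, so that only row sums, that is degrees, remain.\<close>
    also have "(\<Sum>i=1..n. \<Sum>j=1..n. a i j * m j s) = (\<Sum>i=1..n. \<Sum>j=1..n. a i j * m i s)"
      by (subst sum.swap) (intro sum.cong refl, simp add: a_sym)
    also have "(\<Sum>i=1..n. \<Sum>j=1..n. a i j * m i s) + (\<Sum>i=1..n. \<Sum>j=1..n. a i j * m i s)
        = 2 * (\<Sum>i=1..n. (\<Sum>j=1..n. a i j) * m i s)"
      by (simp add: sum_distrib_right)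
    \<comment> \<open>Each degree is its excess plus a mean part. The two bounds on
      \<open>m i s\<close> are used separately: 1 for the excess, the distance itself for the mean
      part.\<close>
    also have "(\<Sum>i=1..n. (\<Sum>j=1..n. a i j) * m i s)
        \<le> (\<Sum>i=1..n. \<bar>\<Sum>j=1..n. e i j\<bar> + real n * p * w * \<bar>x i s - y i s\<bar>)"
    proof (rule sum_mono)
      fix i
      have "(\<Sum>j=1..n. a i j) = (\<Sum>j=1..n. e i j) + p * (\<Sum>j=1..n. V i j)"
        by (simp add: e_def sum_subtractf sum_distrib_left)
      moreover have "p * (\<Sum>j=1..n. V i j) \<le> p * (real n * w)"
        using sum_bounded_above[of "{1..n}" "V i" w] V p by (intro mult_left_mono) auto
      ultimately have "(\<Sum>j=1..n. a i j) * m i s \<le> (\<bar>\<Sum>j=1..n. e i j\<bar> + real n * p * w) * m i s"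
        using m by (intro mult_right_mono) (auto simp: mult_ac)
      also have "\<dots> \<le> \<bar>\<Sum>j=1..n. e i j\<bar> + real n * p * w * \<bar>x i s - y i s\<bar>"
        unfolding distrib_right using m n0 p w
        by (intro add_mono mult_left_mono mult_right_le_one_le) auto
      finally show "(\<Sum>j=1..n. a i j) * m i s \<le> \<bar>\<Sum>j=1..n. e i j\<bar> + real n * p * w * \<bar>x i s - y i s\<bar>" .
    qed
    also have "\<dots> = fluctuation n e + real n * p * w * (real n * u s)"
      using n0 by (simp add: fluctuation_def u_def sum.distrib flip: sum_distrib_left)
    finally have A: "(\<Sum>i=1..n. \<Sum>j=1..n. a i j * (m i s + m j s))
        \<le> 2 * (fluctuation n e + real n * p * w * (real n * u s))" by simp
    have "(\<Sum>i=1..n. G i s) = C * (\<Sum>i=1..n. \<Sum>j=1..n. a i j * (m i s + m j s)) / (real n * p)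
        + fluctuation n (\<lambda>i j. e i j * f i j (y i s) (y j s)) / (real n * p) + L * (\<Sum>i=1..n. \<bar>x i s - y i s\<bar>)"
      by (simp only: G_def \<rho>_def fluctuation_def sum.distrib flip: sum_distrib_left sum_divide_distrib)
    then have "(\<Sum>i=1..n. G i s) / real n
        = C / ((real n)\<^sup>2 * p) * (\<Sum>i=1..n. \<Sum>j=1..n. a i j * (m i s + m j s)) + R s + L * u s"
      using n0 p by (simp only: R_def u_def power2_eq_square) (simp add: add_divide_distrib mult_ac)
    also have "\<dots> \<le> C / ((real n)\<^sup>2 * p) * (2 * (fluctuation n e + real n * p * w * (real n * u s))) + R s + L * u s"
      using A C n0 p by (intro add_right_mono mult_left_mono) auto
    also have "\<dots> = (2 * C * w + L) * u s + (2 * C * Q + R s)"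
      using n0 p by (simp add: Q_def field_simps power2_eq_square)
    also have "\<dots> \<le> K * u s + (2 * C * Q + R s)"
      unfolding K_def growth_const_def C_def u_def
      by (intro add_right_mono mult_right_mono) (auto intro!: divide_nonneg_nonneg sum_nonneg)
    finally show ?thesis .
  qed
  define c where "c = 2 * C * T * Q + integral {0..T} R"
  have R_int: "R integrable_on {0..t}" and u_int: "u integrable_on {0..t}"
    if "t \<in> {0..T}" for t
    using that by (auto intro!: integrable_continuous_interval intro: continuous_on_subset[OF R_cont]
        continuous_on_subset[OF u_cont])
  have G_int: "G i integrable_on {0..t}" if "i \<in> {1..n}" "t \<in> {0..T}" for i t
    using that by (auto intro!: integrable_continuous_interval intro: continuous_on_subset[OF G_cont])
  have bound: "\<bar>x i t - y i t\<bar> \<le> integral {0..t} (G i)" if i: "i \<in> {1..n}" and t: "t \<in> {0..T}" for i t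
  proof -
    have ci: "(\<lambda>s. interaction_drift (\<lambda>i j. a i j / (real n * p)) i (\<lambda>j. x j s)) integrable_on {0..t}"
      "(\<lambda>s. interaction_drift (\<lambda>i j. V i j / real n) i (\<lambda>j. y j s)) integrable_on {0..t}"
      using t i by (auto intro!: integrable_continuous_interval continuous_on_interaction_drift
          intro: continuous_on_subset[OF x] continuous_on_subset[OF y])
    show ?thesis
      unfolding eq[OF i t] integral_diff[OF ci, symmetric] real_norm_def[symmetric]
      by (rule integral_norm_bound_integral[OF integrable_diff[OF ci] G_int[OF i t]])
        (use drift[OF i] in auto)
  qed
  have avg: "(\<Sum>i=1..n. integral {0..t} (G i)) / real n \<le> c + K * integral {0..t} u"
    if t: "t \<in> {0..T}" for t
  proof -
    have "(\<Sum>i=1..n. integral {0..t} (G i)) / real n = integral {0..t} (\<lambda>s. (\<Sum>i=1..n. G i s) / real n)"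
      using G_int[OF _ t] by (subst integral_divide, subst integral_sum) auto
    also have "\<dots> \<le> K * integral {0..t} u + (t * (2 * C * Q) + integral {0..t} R)"
    proof (rule has_integral_le[OF integrable_integral])
      show "(\<lambda>s. (\<Sum>i=1..n. G i s) / real n) integrable_on {0..t}"
        using G_int[OF _ t] by (intro integrable_on_divide integrable_sum) auto
      have "((\<lambda>_. 2 * C * Q) has_integral t * (2 * C * Q)) {0..t}"
        using has_integral_const_real[of "2 * C * Q" 0 t] t by simp
      then show "((\<lambda>s. K * u s + (2 * C * Q + R s)) has_integral
          K * integral {0..t} u + (t * (2 * C * Q) + integral {0..t} R)) {0..t}"
        by (intro has_integral_add has_integral_mult_right integrable_integral u_int R_int t)
    qed (rule G_avg)
    also have "\<dots> \<le> K * integral {0..t} u + (T * (2 * C * Q) + integral {0..T} R)"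
      using t Q0 C R0 R_int[OF t] R_int[of T]
      by (intro add_left_mono add_mono mult_right_mono integral_subset_le) simp_all
    finally show ?thesis by (simp add: c_def mult_ac)
  qed
  have u0: "0 \<le> u s" for s
    unfolding u_def by (intro divide_nonneg_nonneg sum_nonneg) auto
  \<comment> \<open>This controls the average distance at each time, whereas the average of the
    suprema over time is wanted. The bound is therefore put back into \<open>avg\<close> at time
    \<open>T\<close>: the integrals of \<open>G i\<close> over the whole interval dominate the
    single distances at all times, and they serve as \<open>D\<close>.\<close>
  have "u t \<le> 2 * c * exp (2 * K * T)" if "t \<in> {0..T}" for t
  proof (rule gronwall[OF u_cont K _ _ _ that])
    fix t assume t: "t \<in> {0..T}"
    have "u t \<le> (\<Sum>i=1..n. integral {0..t} (G i)) / real n"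
      unfolding u_def using bound t by (intro divide_right_mono sum_mono) auto
    then show "u t \<le> c + K * integral {0..t} u" using avg[OF t] by linarith
  qed (use T u0 in auto)
  then have "integral {0..T} u \<le> integral {0..T} (\<lambda>_. 2 * c * exp (2 * K * T))"
    using T u_int by (intro integral_le) auto
  then have "integral {0..T} u \<le> T * (2 * c * exp (2 * K * T))"
    using T by (simp add: mult_ac)
  then have "c + K * integral {0..T} u \<le> c + K * (T * (2 * c * exp (2 * K * T)))"
    using K by (intro add_left_mono mult_left_mono) auto
  then have "(\<Sum>i=1..n. integral {0..T} (G i)) / real n \<le> (2 * K * T * exp (2 * K * T) + 1) * c"
    using avg[of T] T by (simp add: algebra_simps)
  also have "\<dots> \<le> (2 * K * T * exp (2 * K * T) + 1) * ((2 * C + 1) * (T * Q + integral {0..T} R))"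
  proof (rule mult_left_mono)
    have "0 \<le> T * Q" "0 \<le> C * integral {0..T} R"
      using T Q0 C R0 R_int[of T] by (auto intro!: mult_nonneg_nonneg integral_nonneg)
    then show "c \<le> (2 * C + 1) * (T * Q + integral {0..T} R)"
      unfolding c_def by (simp add: algebra_simps)
  qed (use K T in auto)
  also have "\<dots> = stability_const w T * (T * Q + integral {0..T} R)"
    by (simp add: stability_const_def K_def C_def)
  finally have "(\<Sum>i=1..n. integral {0..T} (G i)) / real n \<le> stability_const w T * (T * Q + integral {0..T} R)" .
  moreover have "\<bar>x i t - y i t\<bar> \<le> integral {0..T} (G i)" if "i \<in> {1..n}" "t \<in> {0..T}" for i t
  proof -
    have "integral {0..t} (G i) \<le> integral {0..T} (G i)"
      using that T G0[OF that(1)] by (intro integral_subset_le G_int) auto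
    then show ?thesis
      using bound[OF that] by linarith
  qed
  ultimately show ?thesis
    using that[of "\<lambda>i. integral {0..T} (G i)"] unfolding Q_def R_def by blast
qed

end

section \<open>Euler approximations with exact noise increments\<close>

primrec euler :: "(nat \<Rightarrow> (nat \<Rightarrow> real) \<Rightarrow> real) \<Rightarrow> real \<Rightarrow> (nat \<Rightarrow> real) \<Rightarrow> (nat \<Rightarrow> real \<Rightarrow> real) \<Rightarrow>
    nat \<Rightarrow> nat \<Rightarrow> real" where
  "euler d h x\<^sub>0 \<beta> 0 = x\<^sub>0"
| "euler d h x\<^sub>0 \<beta> (Suc k) = (\<lambda>i. euler d h x\<^sub>0 \<beta> k i + h * d i (euler d h x\<^sub>0 \<beta> k) +
     (\<beta> i (real (Suc k) * h) - \<beta> i (real k * h)))"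

lemma integral_near_const:
  fixes F :: "real \<Rightarrow> real"
  assumes "a \<le> b" "F integrable_on {a..b}" "\<And>s. s \<in> {a..b} \<Longrightarrow> \<bar>F s - c\<bar> \<le> B"
  shows "\<bar>integral {a..b} F - (b - a) * c\<bar> \<le> (b - a) * B"
proof -
  have c: "((\<lambda>_. r) has_integral (b - a) * r) {a..b}" for r :: real
    using has_integral_const_real[of r a b] assms(1) by simp
  have "integral {a..b} F \<le> (b - a) * (c + B)" "(b - a) * (c - B) \<le> integral {a..b} F"
    using has_integral_le[OF integrable_integral[OF assms(2)] c] has_integral_le[OF c integrable_integral[OF assms(2)]]
      assms(3) by (smt (verit))+
  then show ?thesis
    by (simp add: algebra_simps abs_le_iff)
qed

text \<open>The noise increments are exact, so a step only errs by freezing the drift on one cell,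
  where the path moves by at most \<epsilon>. Adding \<epsilon> to the error makes the recursion
  purely multiplicative: each step multiplies the sum by at most
  \<open>1 + h * real n * K\<close>.\<close>

lemma euler_error:
  assumes h: "0 < h" and K: "0 \<le> K" and \<epsilon>: "0 \<le> \<epsilon>"
    and lip: "\<And>i u v. i \<in> {1..n} \<Longrightarrow> \<bar>d i u - d i v\<bar> \<le> K * (\<Sum>j=1..n. \<bar>u j - v j\<bar>)"
    and int: "\<And>i. i \<in> {1..n} \<Longrightarrow> (\<lambda>s. d i (\<lambda>j. y j s)) integrable_on {0..T}"
    and eq: "\<And>i t. i \<in> {1..n} \<Longrightarrow> t \<in> {0..T} \<Longrightarrow>
      y i t = x\<^sub>0 i + integral {0..t} (\<lambda>s. d i (\<lambda>j. y j s)) + \<beta> i t"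
    and \<beta>: "\<And>i. i \<in> {1..n} \<Longrightarrow> \<beta> i 0 = 0"
    and modulus: "\<And>s t. s \<in> {0..T} \<Longrightarrow> t \<in> {0..T} \<Longrightarrow> \<bar>s - t\<bar> \<le> h \<Longrightarrow> (\<Sum>j=1..n. \<bar>y j s - y j t\<bar>) \<le> \<epsilon>"
    and k: "real k * h \<le> T"
  shows "(\<Sum>i=1..n. \<bar>euler d h x\<^sub>0 \<beta> k i - y i (real k * h)\<bar>) + \<epsilon> \<le> (1 + h * real n * K) ^ k * \<epsilon>"
  using k
proof (induction k)
  case 0
  have "\<bar>euler d h x\<^sub>0 \<beta> 0 i - y i (real 0 * h)\<bar> = 0" if "i \<in> {1..n}" for i
    using eq[OF that, of 0] \<beta>[OF that] 0 by simp
  then show ?case by simp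
next
  case (Suc k)
  let ?X = "euler d h x\<^sub>0 \<beta> k" and ?t = "real k * h" and ?t' = "real (Suc k) * h"
  let ?E = "\<Sum>i=1..n. \<bar>?X i - y i ?t\<bar>"
  have t: "0 \<le> ?t" "?t \<le> ?t'" "?t' - ?t = h" "?t' \<le> T"
    using h Suc.prems by (auto simp: distrib_right)
  have step: "\<bar>euler d h x\<^sub>0 \<beta> (Suc k) i - y i ?t'\<bar> \<le> \<bar>?X i - y i ?t\<bar> + h * (K * (?E + \<epsilon>))"
    if i: "i \<in> {1..n}" for i
  proof -
    let ?F = "\<lambda>s. d i (\<lambda>j. y j s)"
    have I: "?F integrable_on {a..b}" if "0 \<le> a" "b \<le> T" for a b
      by (rule integrable_on_subinterval[OF int[OF i]]) (use that in auto)
    have "\<bar>integral {?t..?t'} ?F - (?t' - ?t) * d i ?X\<bar> \<le> (?t' - ?t) * (K * (?E + \<epsilon>))"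
    proof (rule integral_near_const)
      fix s assume "s \<in> {?t..?t'}"
      then have s: "s \<in> {0..T}" "?t \<in> {0..T}" "\<bar>s - ?t\<bar> \<le> h"
        using t unfolding atLeastAtMost_iff abs_le_iff by linarith+
      have "(\<Sum>j=1..n. \<bar>y j s - ?X j\<bar>) \<le> (\<Sum>j=1..n. \<bar>?X j - y j ?t\<bar> + \<bar>y j s - y j ?t\<bar>)"
        by (intro sum_mono) linarith
      also have "\<dots> \<le> ?E + \<epsilon>"
        unfolding sum.distrib by (intro add_left_mono modulus s)
      finally show "\<bar>?F s - d i ?X\<bar> \<le> K * (?E + \<epsilon>)"
        using lip[OF i, of "\<lambda>j. y j s" ?X] K by (meson mult_left_mono order_trans)
    qed (use t I in auto)
    moreover have "integral {0..?t} ?F + integral {?t..?t'} ?F = integral {0..?t'} ?F"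
      using t I by (intro Henstock_Kurzweil_Integration.integral_combine) auto
    ultimately show ?thesis
      using eq[OF i, of ?t] eq[OF i, of ?t'] t by (auto simp: abs_le_iff)
  qed
  have "(\<Sum>i=1..n. \<bar>euler d h x\<^sub>0 \<beta> (Suc k) i - y i ?t'\<bar>) \<le> (\<Sum>i=1..n. \<bar>?X i - y i ?t\<bar> + h * (K * (?E + \<epsilon>)))"
    by (intro sum_mono step)
  also have "\<dots> = ?E + h * real n * K * (?E + \<epsilon>)"
    unfolding sum.distrib by simp
  finally have "(\<Sum>i=1..n. \<bar>euler d h x\<^sub>0 \<beta> (Suc k) i - y i ?t'\<bar>) + \<epsilon> \<le> (1 + h * real n * K) * (?E + \<epsilon>)"
    by (simp only: distrib_right) simp
  also have "\<dots> \<le> (1 + h * real n * K) * ((1 + h * real n * K) ^ k * \<epsilon>)"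
    using Suc.IH t h K by (intro mult_left_mono) auto
  finally show ?case by simp
qed

lemma uniform_modulus:
  fixes y :: "nat \<Rightarrow> real \<Rightarrow> real"
  assumes cont: "\<And>i. i \<in> {1..n} \<Longrightarrow> continuous_on {0..T} (y i)" and \<epsilon>: "0 < \<epsilon>"
  shows "\<exists>\<rho>>0. \<forall>s\<in>{0..T}. \<forall>t\<in>{0..T}. \<bar>s - t\<bar> < \<rho> \<longrightarrow> (\<Sum>j=1..n. \<bar>y j s - y j t\<bar>) \<le> \<epsilon>"
proof -
  define \<epsilon>' where "\<epsilon>' = \<epsilon> / (real n + 1)"
  have \<epsilon>': "0 < \<epsilon>'" using \<epsilon> by (simp add: \<epsilon>'_def)
  have "\<exists>\<rho>>0. \<forall>s\<in>{0..T}. \<forall>t\<in>{0..T}. \<bar>s - t\<bar> < \<rho> \<longrightarrow> \<bar>y j s - y j t\<bar> < \<epsilon>'"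
    if "j \<in> {1..n}" for j
  proof -
    have "uniformly_continuous_on {0..T} (y j)"
      using cont[OF that] by (intro compact_uniformly_continuous) auto
    then show ?thesis
      using \<epsilon>' unfolding uniformly_continuous_on_def by (auto simp: dist_real_def abs_minus_commute)
  qed
  then have "\<exists>\<rho>. \<forall>j\<in>{1..n}. 0 < \<rho> j \<and>
      (\<forall>s\<in>{0..T}. \<forall>t\<in>{0..T}. \<bar>s - t\<bar> < \<rho> j \<longrightarrow> \<bar>y j s - y j t\<bar> < \<epsilon>')"
    by (intro bchoice ballI) blast
  then obtain \<rho> where \<rho>: "\<And>j. j \<in> {1..n} \<Longrightarrow> 0 < \<rho> j"
    "\<And>j s t. j \<in> {1..n} \<Longrightarrow> s \<in> {0..T} \<Longrightarrow> t \<in> {0..T} \<Longrightarrow> \<bar>s - t\<bar> < \<rho> j \<Longrightarrow> \<bar>y j s - y j t\<bar> < \<epsilon>'"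
    by blast
  define r where "r = Min (insert 1 (\<rho> ` {1..n}))"
  have r: "0 < r" "\<And>j. j \<in> {1..n} \<Longrightarrow> r \<le> \<rho> j"
    unfolding r_def using \<rho>(1) by (auto simp del: Min_insert intro: Min_le)
  show ?thesis
  proof (intro exI conjI ballI impI)
    fix s t assume st: "s \<in> {0..T}" "t \<in> {0..T}" "\<bar>s - t\<bar> < r"
    have "\<bar>y j s - y j t\<bar> \<le> \<epsilon>'" if "j \<in> {1..n}" for j
      using \<rho>(2)[OF that st(1,2)] st(3) r(2)[OF that] by linarith
    then have "(\<Sum>j=1..n. \<bar>y j s - y j t\<bar>) \<le> real n * \<epsilon>'"
      using sum_bounded_above[of "{1..n}" "\<lambda>j. \<bar>y j s - y j t\<bar>" \<epsilon>'] by simp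
    also have "\<dots> \<le> \<epsilon>" using \<epsilon> by (simp add: \<epsilon>'_def field_simps)
    finally show "(\<Sum>j=1..n. \<bar>y j s - y j t\<bar>) \<le> \<epsilon>" .
  qed (rule r)
qed

text \<open>The integral along the solution is compared with a Riemann sum along the Euler points.
  The index from which the bound holds depends on the modulus of continuity of \<open>y\<close>,
  hence on the realisation; only an eventual statement is made.\<close>

lemma integral_le_euler_sum:
  assumes T: "0 < T" and K: "0 \<le> K" and L: "0 \<le> L" and \<delta>: "0 < \<delta>"
    and lip: "\<And>i u v. i \<in> {1..n} \<Longrightarrow> \<bar>d i u - d i v\<bar> \<le> K * (\<Sum>j=1..n. \<bar>u j - v j\<bar>)"
    and int: "\<And>i. i \<in> {1..n} \<Longrightarrow> (\<lambda>s. d i (\<lambda>j. y j s)) integrable_on {0..T}"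
    and cont: "\<And>i. i \<in> {1..n} \<Longrightarrow> continuous_on {0..T} (y i)"
    and eq: "\<And>i t. i \<in> {1..n} \<Longrightarrow> t \<in> {0..T} \<Longrightarrow>
      y i t = x\<^sub>0 i + integral {0..t} (\<lambda>s. d i (\<lambda>j. y j s)) + \<beta> i t"
    and \<beta>: "\<And>i. i \<in> {1..n} \<Longrightarrow> \<beta> i 0 = 0"
    and F_lip: "\<And>u v. \<bar>F u - F v\<bar> \<le> L * (\<Sum>j=1..n. \<bar>u j - v j\<bar>)"
    and F_int: "(\<lambda>s. F (\<lambda>j. y j s)) integrable_on {0..T}"
  shows "\<forall>\<^sub>F N in sequentially. integral {0..T} (\<lambda>s. F (\<lambda>j. y j s)) \<le>
    T * ((\<Sum>k<N. F (euler d (T / real N) x\<^sub>0 \<beta> k)) / real N) + \<delta>"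
proof -
  \<comment> \<open>This bounds the growth factor \<open>(1 + h * real n * K) ^ k\<close> on all
    grid points, since \<open>real k * h\<close> is at most \<open>T\<close>.\<close>
  define c where "c = exp (real n * K * T)"
  \<comment> \<open>Chosen so that the final error \<open>T * (L * (c * \<epsilon>))\<close> is at
    most \<delta>; \<open>L + 1\<close> avoids a division by zero when \<open>L\<close> is
    0.\<close>
  define \<epsilon> where "\<epsilon> = \<delta> / (T * (L + 1) * c)"
  have \<epsilon>: "0 < \<epsilon>" using \<delta> T L by (simp add: \<epsilon>_def c_def)
  obtain \<rho> where \<rho>: "0 < \<rho>" "\<And>s t. s \<in> {0..T} \<Longrightarrow> t \<in> {0..T} \<Longrightarrow> \<bar>s - t\<bar> < \<rho> \<Longrightarrow>
      (\<Sum>j=1..n. \<bar>y j s - y j t\<bar>) \<le> \<epsilon>"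
    using uniform_modulus[of n T y, OF cont \<epsilon>] by blast
  have "\<forall>\<^sub>F N in sequentially. T / real N < \<rho>"
    by (rule order_tendstoD(2)[OF lim_const_over_n]) (rule \<rho>)
  then show ?thesis
    using eventually_gt_at_top[of 0]
  proof eventually_elim
    case (elim N)
    define h where "h = T / real N"
    have h: "0 < h" "real N * h = T" using T elim(2) by (simp_all add: h_def)
    let ?X = "euler d h x\<^sub>0 \<beta>"
    have h_le: "real k * h \<le> T" if "k \<le> N" for k
      using that h by (metis mult_right_mono of_nat_le_iff less_imp_le)
    have E: "(\<Sum>i=1..n. \<bar>?X k i - y i (real k * h)\<bar>) + \<epsilon> \<le> c * \<epsilon>" if "k \<le> N" for k
    proof -
      have "(\<Sum>i=1..n. \<bar>?X k i - y i (real k * h)\<bar>) + \<epsilon> \<le> (1 + h * real n * K) ^ k * \<epsilon>"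
        using \<rho>(2) elim(1) \<epsilon>
        by (intro euler_error[OF h(1) K _ lip int eq \<beta>] h_le that) (auto simp: h_def)
      also have "\<dots> \<le> c * \<epsilon>"
      proof (intro mult_right_mono)
        have "(1 + h * real n * K) ^ k \<le> exp (h * real n * K) ^ k"
          using h K by (intro power_mono exp_ge_add_one_self) auto
        also have "\<dots> = exp (real n * K * (real k * h))"
          by (simp add: mult_ac flip: exp_of_nat_mult)
        also have "\<dots> \<le> c"
          unfolding c_def exp_le_cancel_iff using h_le[OF that] K by (intro mult_left_mono) auto
        finally show "(1 + h * real n * K) ^ k \<le> c" .
      qed (use \<epsilon> in simp)
      finally show ?thesis .
    qed
    let ?G = "\<lambda>s. F (\<lambda>j. y j s)"
    have I: "?G integrable_on {a..b}" if "0 \<le> a" "b \<le> T" for a b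
      by (rule integrable_on_subinterval[OF F_int]) (use that in auto)
    have "integral {0..real k * h} ?G \<le> h * (\<Sum>l<k. F (?X l)) + real k * h * (L * (c * \<epsilon>))" if "k \<le> N" for k
      using that
    proof (induction k)
      case (Suc k)
      let ?t = "real k * h" and ?t' = "real (Suc k) * h"
      have t: "0 \<le> ?t" "?t \<le> ?t'" "?t' - ?t = h" "?t' \<le> T"
        using h(1) h_le[OF Suc.prems] by (auto simp: distrib_right)
      have "\<bar>integral {?t..?t'} ?G - (?t' - ?t) * F (?X k)\<bar> \<le> (?t' - ?t) * (L * (c * \<epsilon>))"
      proof (rule integral_near_const)
        fix s assume "s \<in> {?t..?t'}"
        then have s: "s \<in> {0..T}" "?t \<in> {0..T}" "\<bar>s - ?t\<bar> < \<rho>"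
          using t elim(1) unfolding atLeastAtMost_iff abs_less_iff h_def[symmetric] by linarith+
        have "(\<Sum>j=1..n. \<bar>y j s - ?X k j\<bar>) \<le> (\<Sum>j=1..n. \<bar>?X k j - y j ?t\<bar> + \<bar>y j s - y j ?t\<bar>)"
          by (intro sum_mono) linarith
        also have "\<dots> \<le> (\<Sum>j=1..n. \<bar>?X k j - y j ?t\<bar>) + \<epsilon>"
          unfolding sum.distrib by (rule add_left_mono[OF \<rho>(2)[OF s]])
        also have "\<dots> \<le> c * \<epsilon>" using E[of k] Suc.prems by simp
        finally show "\<bar>?G s - F (?X k)\<bar> \<le> L * (c * \<epsilon>)"
          using F_lip[of "\<lambda>j. y j s" "?X k"] L by (meson mult_left_mono order_trans)
      qed (use t I in auto)
      moreover have "integral {0..?t} ?G + integral {?t..?t'} ?G = integral {0..?t'} ?G"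
        using t I by (intro Henstock_Kurzweil_Integration.integral_combine) auto
      moreover have "integral {0..?t} ?G \<le> h * (\<Sum>l<k. F (?X l)) + ?t * (L * (c * \<epsilon>))"
        using Suc by simp
      ultimately show ?case
        unfolding t(3) by (simp only: sum.lessThan_Suc distrib_left distrib_right of_nat_Suc)
    qed simp
    from this[of N] have "integral {0..T} ?G \<le> h * (\<Sum>l<N. F (?X l)) + T * (L * (c * \<epsilon>))"
      using h(2) by simp
    also have "T * (L * (c * \<epsilon>)) \<le> T * ((L + 1) * (c * \<epsilon>))"
      using T \<epsilon> by (intro mult_left_mono mult_right_mono) (auto simp: c_def)
    also have "\<dots> = \<delta>"
      using T L by (simp add: \<epsilon>_def c_def)
    finally show ?case by (simp add: h_def)
  qed
qed

section \<open>Exponential moments of the random graph\<close>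

text \<open>For negative x the claim follows from (1 + x + x^2) (1 - x) = 1 - x^3, which is at least
  1, and from 1 - x being at most exp (- x).\<close>

lemma exp_le_quadratic:
  fixes x :: real
  assumes "\<bar>x\<bar> \<le> 1"
  shows "exp x \<le> 1 + x + x\<^sup>2"
proof (cases "0 \<le> x")
  case True
  then show ?thesis using assms by (intro exp_bound) auto
next
  case False
  have "0 \<le> 1 + x + x\<^sup>2"
    using assms zero_le_power2[of x] by linarith
  have "1 \<le> 1 - x ^ 3"
    using False by (simp add: power3_eq_cube mult_nonneg_nonpos mult_nonpos_nonpos)
  also have "\<dots> = (1 + x + x\<^sup>2) * (1 + - x)"
    by (simp add: algebra_simps power2_eq_square power3_eq_cube)
  also have "\<dots> \<le> (1 + x + x\<^sup>2) * exp (- x)"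
    using \<open>0 \<le> 1 + x + x\<^sup>2\<close> by (intro mult_left_mono exp_ge_add_one_self)
  finally show ?thesis
    by (simp add: exp_minus field_simps)
qed

text \<open>The left side is the expectation of exp (c (X - q)) for a Bernoulli variable X of
  parameter q, written as a value at X = 0 plus an increment times q. The exponent keeps the factor
  \<kappa>, the bound for the variance.\<close>

lemma centered_bernoulli_mgf_le:
  fixes c q \<delta> \<kappa> :: real
  assumes "\<bar>c\<bar> \<le> \<delta>" "\<delta> \<le> 1" "0 \<le> q" "q \<le> \<kappa>"
  shows "exp (- (c * q)) + exp (- (c * q)) * (exp c - 1) * q \<le> exp (\<kappa> * \<delta>\<^sup>2)"
proof -
  have "exp c - 1 \<le> c + c\<^sup>2"
    using exp_le_quadratic[of c] assms by simp
  then have "1 + (exp c - 1) * q \<le> exp ((c + c\<^sup>2) * q)"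
    using assms(3) exp_ge_add_one_self[of "(c + c\<^sup>2) * q"] by (smt (verit) mult_right_mono)
  then have "exp (- (c * q)) * (1 + (exp c - 1) * q) \<le> exp (- (c * q)) * exp ((c + c\<^sup>2) * q)"
    by (intro mult_left_mono) auto
  also have "\<dots> = exp (q * c\<^sup>2)"
    by (simp add: algebra_simps flip: exp_add)
  also have "\<dots> \<le> exp (\<kappa> * \<delta>\<^sup>2)"
    using assms power_mono[of "\<bar>c\<bar>" \<delta> 2] by (simp add: mult_mono)
  finally show ?thesis by (simp add: algebra_simps)
qed

section \<open>Folding the symmetric matrix onto its independent entries\<close>

definition edges :: "nat \<Rightarrow> (nat \<times> nat) set" where
  "edges n = {(i, j). 1 \<le> i \<and> i \<le> j \<and> j \<le> n}"

lemma edges_subset: "edges n \<subseteq> {1..n} \<times> {1..n}"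
  by (auto simp: edges_def)

lemma finite_edges [simp]: "finite (edges n)"
  by (rule finite_subset[OF edges_subset]) auto

lemma card_edges_le: "real (card (edges n)) \<le> (real n)\<^sup>2"
proof -
  have "card (edges n) \<le> card ({1..n} \<times> {1..n})"
    by (intro card_mono edges_subset) auto
  then show ?thesis by (simp add: power2_eq_square flip: of_nat_mult)
qed

text \<open>Only the entries on and above the diagonal are conditionally independent. An
  off-diagonal entry collects the two coefficients of its mirror images, a diagonal entry just
  one.\<close>

lemma sum_square_eq_sum_edges:
  fixes F :: "nat \<Rightarrow> nat \<Rightarrow> real"
  shows "(\<Sum>i=1..n. \<Sum>j=1..n. F i j) = (\<Sum>(i, j)\<in>edges n. if i = j then F i j else F i j + F j i)"
proof -
  let ?U = "{(i, j). 1 \<le> i \<and> i < j \<and> j \<le> n}" and ?L = "{(i, j). 1 \<le> j \<and> j < i \<and> i \<le> n}"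
  have fin: "finite ?U" "finite ?L"
    by (rule finite_subset[of _ "{1..n} \<times> {1..n}"]; auto)+
  have "(\<Sum>i=1..n. \<Sum>j=1..n. F i j) = (\<Sum>(i, j)\<in>{1..n} \<times> {1..n}. F i j)"
    by (simp add: sum.cartesian_product)
  also have "{1..n} \<times> {1..n} = edges n \<union> ?L"
    by (auto simp: edges_def)
  also have "(\<Sum>(i, j)\<in>edges n \<union> ?L. F i j) = (\<Sum>(i, j)\<in>edges n. F i j) + (\<Sum>(i, j)\<in>?L. F i j)"
    using fin by (intro sum.union_disjoint finite_edges) (auto simp: edges_def)
  also have "(\<Sum>(i, j)\<in>?L. F i j) = (\<Sum>(i, j)\<in>?U. F j i)"
    by (rule sum.reindex_bij_witness[of _ prod.swap prod.swap]) auto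
  also have "\<dots> = (\<Sum>(i, j)\<in>edges n. if i = j then 0 else F j i)"
    by (rule sum.mono_neutral_cong_left[OF finite_edges]) (auto simp: edges_def split: if_splits)
  also have "(\<Sum>(i, j)\<in>edges n. F i j) + \<dots> = (\<Sum>(i, j)\<in>edges n. if i = j then F i j else F i j + F j i)"
    unfolding sum.distrib[symmetric] by (intro sum.cong) auto
  finally show ?thesis .
qed

text \<open>Each factor satisfies exp |x| \<le> exp x + exp (- x); expanding the product of these
  sums gives one term for each set of indices with positive sign.\<close>

lemma exp_sum_abs_le:
  fixes x :: "'i \<Rightarrow> real"
  assumes "finite I"
  shows "exp (\<Sum>i\<in>I. \<bar>x i\<bar>) \<le> (\<Sum>S\<in>Pow I. exp (\<Sum>i\<in>I. (if i \<in> S then 1 else - 1) * x i))"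
proof -
  have "exp (\<Sum>i\<in>I. \<bar>x i\<bar>) = (\<Prod>i\<in>I. exp \<bar>x i\<bar>)"
    using assms by (rule exp_sum)
  also have "\<dots> \<le> (\<Prod>i\<in>I. exp (x i) + exp (- x i))"
    by (intro prod_mono) (auto simp: abs_if)
  also have "\<dots> = (\<Sum>S\<in>Pow I. (\<Prod>i\<in>S. exp (x i)) * (\<Prod>i\<in>I - S. exp (- x i)))"
    by (rule prod_add[OF assms])
  also have "\<dots> = (\<Sum>S\<in>Pow I. exp (\<Sum>i\<in>I. (if i \<in> S then 1 else - 1) * x i))"
  proof (rule sum.cong[OF refl])
    fix S assume "S \<in> Pow I"
    then have S: "S \<subseteq> I" by auto
    have "(\<Sum>i\<in>I. (if i \<in> S then 1 else - 1) * x i)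
        = (\<Sum>i\<in>I - S. (if i \<in> S then 1 else - 1) * x i) + (\<Sum>i\<in>S. (if i \<in> S then 1 else - 1) * x i)"
      by (rule sum.subset_diff[OF S assms])
    also have "\<dots> = (\<Sum>i\<in>I - S. - x i) + (\<Sum>i\<in>S. x i)"
      by (intro arg_cong2[where f="(+)"] sum.cong) auto
    finally show "(\<Prod>i\<in>S. exp (x i)) * (\<Prod>i\<in>I - S. exp (- x i))
        = exp (\<Sum>i\<in>I. (if i \<in> S then 1 else - 1) * x i)"
      using finite_subset[OF S assms] assms by (simp add: exp_add exp_sum mult.commute)
  qed
  finally show ?thesis .
qed

text \<open>Besides the bound 1 for a probability there is a separate bound \<kappa>, later of order
  p. It controls the conditional variance of an entry, and keeping it in the exponent yields n^2 p
  rather than n^2.\<close>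

locale random_graph = prob_space M for M :: "'w measure" +
  fixes G :: "'w measure" and n :: nat and q A :: "nat \<Rightarrow> nat \<Rightarrow> 'w \<Rightarrow> real" and \<kappa> :: real
  assumes sub: "subalgebra M G"
    and graph: "random_symmetric_graph M G n q A"
    and q_measurable: "\<And>i j. i \<in> {1..n} \<Longrightarrow> j \<in> {1..n} \<Longrightarrow> q i j \<in> borel_measurable G"
    and q_bounds: "\<And>i j w. 0 \<le> q i j w \<and> q i j w \<le> \<kappa> \<and> q i j w \<le> 1"
    and q_sym: "\<And>i j w. q i j w = q j i w"
begin

sublocale finite_measure_subalgebra M G
  by standard (rule sub)

lemma A_01: "i \<in> {1..n} \<Longrightarrow> j \<in> {1..n} \<Longrightarrow> w \<in> space M \<Longrightarrow> A i j w = 0 \<or> A i j w = 1"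
  and A_sym: "i \<in> {1..n} \<Longrightarrow> j \<in> {1..n} \<Longrightarrow> w \<in> space M \<Longrightarrow> A i j w = A j i w"
  using graph unfolding random_symmetric_graph_def by auto

lemma A_edge_measurable: "e \<in> edges n \<Longrightarrow> A (fst e) (snd e) \<in> borel_measurable M"
  using graph unfolding random_symmetric_graph_def cond_indep_vars_def edges_def by auto

lemma A_measurable:
  assumes "i \<in> {1..n}" "j \<in> {1..n}"
  shows "A i j \<in> borel_measurable M"
proof (cases "i \<le> j")
  case True
  then show ?thesis using A_edge_measurable[of "(i, j)"] assms by (auto simp: edges_def)
next
  case False
  then have "A j i \<in> borel_measurable M"
    using A_edge_measurable[of "(j, i)"] assms by (auto simp: edges_def)
  then show ?thesis
    using A_sym[OF assms] by (subst measurable_cong) auto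
qed

lemma q_measurable_M: "i \<in> {1..n} \<Longrightarrow> j \<in> {1..n} \<Longrightarrow> q i j \<in> borel_measurable M"
  by (rule measurable_from_subalg[OF sub q_measurable])

lemma integrable_boundedI:
  fixes f :: "'w \<Rightarrow> real"
  assumes "f \<in> borel_measurable M" "\<And>w. w \<in> space M \<Longrightarrow> \<bar>f w\<bar> \<le> C"
  shows "integrable M f"
  using assms by (intro integrable_const_bound[where B=C]) auto

text \<open>As the entries are 0 or 1, the product over \<open>J\<close> is the indicator of the
  event that all of them equal 1, and its conditional probability factorises. The empty
  \<open>J\<close> is treated apart because \<open>cond_indep_vars\<close> speaks of nonempty sets
  only.\<close>

lemma expectation_edge_set:
  assumes J: "J \<subseteq> edges n"
    and h: "h \<in> borel_measurable G" "\<And>w. w \<in> space M \<Longrightarrow> \<bar>h w\<bar> \<le> H"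
  shows "(\<integral>w. h w * (\<Prod>(i, j)\<in>J. A i j w) \<partial>M) = (\<integral>w. h w * (\<Prod>(i, j)\<in>J. q i j w) \<partial>M)"
proof (cases "J = {}")
  case False
  have fin: "finite J" using J by (rule finite_subset) simp
  let ?E = "{v \<in> space M. \<forall>e\<in>J. (case e of (i, j) \<Rightarrow> A i j) v \<in> {1}}"
  have A: "A (fst e) (snd e) \<in> borel_measurable M" if "e \<in> J" for e
    using A_edge_measurable J that by auto
  have E: "?E \<in> sets M"
    using fin A by (intro sets.sets_Collect_finite_All measurable_sets_Collect[of _ M borel])
      (auto simp: case_prod_beta)
  have ind: "(\<Prod>(i, j)\<in>J. A i j w) = indicator ?E w" if w: "w \<in> space M" for w
  proof (cases "w \<in> ?E")
    case True
    then have "(\<Prod>(i, j)\<in>J. A i j w) = (\<Prod>(i, j)\<in>J. 1)"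
      by (intro prod.cong) auto
    then show ?thesis using True by simp
  next
    case False
    then obtain i j where "(i, j) \<in> J" "A i j w \<noteq> 1" using w by auto
    then have "A i j w = 0" using A_01[of i j w] w J edges_subset by blast
    then have "\<exists>e\<in>J. (case e of (i, j) \<Rightarrow> A i j w) = 0"
      using \<open>(i, j) \<in> J\<close> by (intro bexI[of _ "(i, j)"]) simp_all
    then have "(\<Prod>(i, j)\<in>J. A i j w) = 0" by (rule prod_zero[OF fin])
    then show ?thesis by (subst indicator_simps(2)[OF False])
  qed
  have "(\<integral>w. h w * (\<Prod>(i, j)\<in>J. A i j w) \<partial>M) = (\<integral>w. h w * indicator ?E w \<partial>M)"
    using ind by (intro Bochner_Integration.integral_cong) auto
  also have "\<dots> = (\<integral>w. h w * real_cond_exp M G (indicator ?E) w \<partial>M)"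
  proof (rule real_cond_exp_intg(2)[symmetric])
    have "h \<in> borel_measurable M" by (rule measurable_from_subalg[OF sub h(1)])
    then show "integrable M (\<lambda>w. h w * indicator ?E w)"
      using E h(2) by (intro integrable_boundedI[where C=H] borel_measurable_times borel_measurable_indicator)
        (fastforce simp: indicator_def intro: order_trans[OF abs_ge_zero])+
  qed (use h E in auto)
  also have "\<dots> = (\<integral>w. h w * (\<Prod>(i, j)\<in>J. q i j w) \<partial>M)"
  proof (rule integral_cong_AE)
    have "AE w in M. cond_prob M G ?E w = (\<Prod>e\<in>J. cond_prob M G {v \<in> space M. (case e of (i, j) \<Rightarrow> A i j) v \<in> {1}} w)"
    proof -
      have "cond_indep_vars M G (\<lambda>_. borel) (\<lambda>(i, j). A i j) (edges n)"
        using graph unfolding random_symmetric_graph_def edges_def by simp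
      then show ?thesis
        using J False fin unfolding cond_indep_vars_def by (auto dest!: spec[of _ J] bspec[of _ _ "\<lambda>_. {1}"])
    qed
    moreover have "AE w in M. \<forall>e\<in>J. cond_prob M G {v \<in> space M. (case e of (i, j) \<Rightarrow> A i j) v \<in> {1}} w = (case e of (i, j) \<Rightarrow> q i j w)"
    proof (rule AE_finite_allI[OF fin])
      fix e assume "e \<in> J"
      then have "e \<in> edges n" using J by auto
      then show "AE w in M. cond_prob M G {v \<in> space M. (case e of (i, j) \<Rightarrow> A i j) v \<in> {1}} w = (case e of (i, j) \<Rightarrow> q i j w)"
        using graph unfolding random_symmetric_graph_def edges_def by (cases e) auto
    qed
    ultimately have "AE w in M. real_cond_exp M G (indicator ?E) w = (\<Prod>(i, j)\<in>J. q i j w)"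
      unfolding cond_prob_def by eventually_elim auto
    then show "AE w in M. h w * real_cond_exp M G (indicator ?E) w = h w * (\<Prod>(i, j)\<in>J. q i j w)"
      by eventually_elim simp
    show "(\<lambda>w. h w * real_cond_exp M G (indicator ?E) w) \<in> borel_measurable M"
      using measurable_from_subalg[OF sub h(1)] by (intro borel_measurable_times) auto
    show "(\<lambda>w. h w * (\<Prod>(i, j)\<in>J. q i j w)) \<in> borel_measurable M"
      using measurable_from_subalg[OF sub h(1)] q_measurable_M J edges_subset[of n]
      by (intro borel_measurable_times borel_measurable_prod) auto
  qed
  finally show ?thesis .
qed simp

text \<open>Every function of a 0/1 entry is affine in it. Expanding the product over subsets of
  edges thus reduces independence of arbitrary functions of the entries, with coefficients known
  given \<open>G\<close>, to \<open>expectation_edge_set\<close>, and no regular conditional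
  distribution is required.\<close>

lemma expectation_edge_product:
  fixes \<alpha> \<gamma> :: "nat \<times> nat \<Rightarrow> 'w \<Rightarrow> real"
  assumes meas: "\<And>e. e \<in> edges n \<Longrightarrow> \<alpha> e \<in> borel_measurable G" "\<And>e. e \<in> edges n \<Longrightarrow> \<gamma> e \<in> borel_measurable G"
    and bound: "\<And>e w. e \<in> edges n \<Longrightarrow> w \<in> space M \<Longrightarrow> \<bar>\<alpha> e w\<bar> \<le> C" "\<And>e w. e \<in> edges n \<Longrightarrow> w \<in> space M \<Longrightarrow> \<bar>\<gamma> e w\<bar> \<le> C"
  shows "(\<integral>w. (\<Prod>(i, j)\<in>edges n. \<alpha> (i, j) w + \<gamma> (i, j) w * A i j w) \<partial>M) =
    (\<integral>w. (\<Prod>(i, j)\<in>edges n. \<alpha> (i, j) w + \<gamma> (i, j) w * q i j w) \<partial>M)"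
proof -
  define h where "h J w = (\<Prod>e\<in>J. \<gamma> e w) * (\<Prod>e\<in>edges n - J. \<alpha> e w)" for J w
  have h_meas: "h J \<in> borel_measurable G" if "J \<subseteq> edges n" for J
    unfolding h_def using that meas by (intro borel_measurable_times borel_measurable_prod) auto
  have h_bound: "\<bar>h J w\<bar> \<le> C ^ card J * C ^ card (edges n - J)" if J: "J \<subseteq> edges n" and w: "w \<in> space M" for J w
  proof -
    have "\<bar>\<Prod>e\<in>J. \<gamma> e w\<bar> \<le> C ^ card J" "\<bar>\<Prod>e\<in>edges n - J. \<alpha> e w\<bar> \<le> C ^ card (edges n - J)"
      unfolding abs_prod using bound J w by (auto simp flip: prod_constant intro!: prod_mono)
    then show ?thesis
      unfolding h_def abs_mult by (intro mult_mono) (auto intro: order_trans[OF abs_ge_zero])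
  qed
  have expand: "(\<Prod>(i, j)\<in>edges n. \<alpha> (i, j) w + \<gamma> (i, j) w * z i j)
      = (\<Sum>J\<in>Pow (edges n). h J w * (\<Prod>(i, j)\<in>J. z i j))" for z :: "nat \<Rightarrow> nat \<Rightarrow> real" and w
  proof -
    have "(\<Prod>(i, j)\<in>edges n. \<alpha> (i, j) w + \<gamma> (i, j) w * z i j)
        = (\<Prod>e\<in>edges n. \<gamma> e w * z (fst e) (snd e) + \<alpha> e w)"
      by (intro prod.cong) auto
    also have "\<dots> = (\<Sum>J\<in>Pow (edges n). (\<Prod>e\<in>J. \<gamma> e w * z (fst e) (snd e)) * (\<Prod>e\<in>edges n - J. \<alpha> e w))"
      by (rule prod_add) simp
    finally show ?thesis
      by (simp add: h_def prod.distrib case_prod_beta mult_ac)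
  qed
  have int: "integrable M (\<lambda>w. h J w * (\<Prod>(i, j)\<in>J. z i j w))"
    if J: "J \<subseteq> edges n" and z: "\<And>i j. i \<in> {1..n} \<Longrightarrow> j \<in> {1..n} \<Longrightarrow> z i j \<in> borel_measurable M"
      "\<And>i j w. i \<in> {1..n} \<Longrightarrow> j \<in> {1..n} \<Longrightarrow> w \<in> space M \<Longrightarrow> \<bar>z i j w\<bar> \<le> D"
    for J and z :: "nat \<Rightarrow> nat \<Rightarrow> 'w \<Rightarrow> real" and D
  proof (rule integrable_boundedI)
    show "(\<lambda>w. h J w * (\<Prod>(i, j)\<in>J. z i j w)) \<in> borel_measurable M"
      using measurable_from_subalg[OF sub h_meas[OF J]] z(1) J edges_subset[of n]
      by (intro borel_measurable_times borel_measurable_prod) auto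
    fix w assume w: "w \<in> space M"
    have "\<bar>\<Prod>(i, j)\<in>J. z i j w\<bar> \<le> (\<Prod>(i, j)\<in>J. D)"
      unfolding abs_prod using z(2) w J edges_subset[of n] by (intro prod_mono) auto
    then show "\<bar>h J w * (\<Prod>(i, j)\<in>J. z i j w)\<bar> \<le> C ^ card J * C ^ card (edges n - J) * (\<Prod>(i, j)\<in>J. D)"
      unfolding abs_mult using h_bound[OF J w] by (intro mult_mono) (auto intro: order_trans[OF abs_ge_zero])
  qed
  have int_A: "integrable M (\<lambda>w. h J w * (\<Prod>(i, j)\<in>J. A i j w))" if "J \<subseteq> edges n" for J
  proof (rule int[OF that A_measurable])
    show "\<bar>A i j w\<bar> \<le> 1" if "i \<in> {1..n}" "j \<in> {1..n}" "w \<in> space M" for i j w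
      using A_01[OF that] by auto
  qed
  have int_q: "integrable M (\<lambda>w. h J w * (\<Prod>(i, j)\<in>J. q i j w))" if "J \<subseteq> edges n" for J
  proof (rule int[OF that q_measurable_M])
    show "\<bar>q i j w\<bar> \<le> 1" for i j w
      using q_bounds[of i j w] by simp
  qed
  have "(\<integral>w. (\<Sum>J\<in>Pow (edges n). h J w * (\<Prod>(i, j)\<in>J. A i j w)) \<partial>M)
      = (\<Sum>J\<in>Pow (edges n). \<integral>w. h J w * (\<Prod>(i, j)\<in>J. A i j w) \<partial>M)"
    by (intro Bochner_Integration.integral_sum int_A) auto
  also have "\<dots> = (\<Sum>J\<in>Pow (edges n). \<integral>w. h J w * (\<Prod>(i, j)\<in>J. q i j w) \<partial>M)"
    by (intro sum.cong refl expectation_edge_set[OF _ h_meas h_bound]) auto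
  also have "\<dots> = (\<integral>w. (\<Sum>J\<in>Pow (edges n). h J w * (\<Prod>(i, j)\<in>J. q i j w)) \<partial>M)"
    by (intro Bochner_Integration.integral_sum[symmetric] int_q) auto
  finally show ?thesis
    unfolding expand .
qed

lemma edge_mgf_le:
  fixes c :: "nat \<times> nat \<Rightarrow> 'w \<Rightarrow> real"
  assumes meas: "\<And>e. e \<in> edges n \<Longrightarrow> c e \<in> borel_measurable G"
    and bound: "\<And>e w. e \<in> edges n \<Longrightarrow> w \<in> space M \<Longrightarrow> \<bar>c e w\<bar> \<le> \<delta>" and \<delta>: "0 \<le> \<delta>" "\<delta> \<le> 1"
  shows "(\<integral>w. exp (\<Sum>(i, j)\<in>edges n. c (i, j) w * (A i j w - q i j w)) \<partial>M) \<le> exp (\<kappa> * \<delta>\<^sup>2 * (real n)\<^sup>2)"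
proof -
  \<comment> \<open>The factor exp (c (A - q)) equals \<open>\<alpha>\<close> at A = 0 and
    \<open>\<alpha> + \<gamma>\<close> at A = 1, so it is the affine function
    \<open>\<alpha> + \<gamma> * A\<close>.\<close>
  define \<alpha> where "\<alpha> e w = exp (- (c e w * q (fst e) (snd e) w))" for e w
  define \<gamma> where "\<gamma> e w = \<alpha> e w * (exp (c e w) - 1)" for e w
  have ij: "fst e \<in> {1..n}" "snd e \<in> {1..n}" if "e \<in> edges n" for e
    using subsetD[OF edges_subset that] by auto
  have \<alpha>_meas: "\<alpha> e \<in> borel_measurable G" and \<gamma>_meas: "\<gamma> e \<in> borel_measurable G" if "e \<in> edges n" for e
    unfolding \<gamma>_def \<alpha>_def using meas[OF that] q_measurable ij[OF that] by measurable
  have \<kappa>: "0 \<le> \<kappa>" using q_bounds[of undefined undefined undefined] by linarith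
  have \<alpha>_bound: "\<bar>\<alpha> e w\<bar> \<le> exp \<kappa>" if "e \<in> edges n" "w \<in> space M" for e w
  proof -
    have "\<bar>c e w * q (fst e) (snd e) w\<bar> \<le> 1 * \<kappa>"
      unfolding abs_mult using bound[OF that] \<delta> q_bounds \<kappa> by (intro mult_mono) auto
    then show ?thesis by (simp add: \<alpha>_def abs_le_iff)
  qed
  have \<gamma>_bound: "\<bar>\<gamma> e w\<bar> \<le> exp \<kappa> * 3" if "e \<in> edges n" "w \<in> space M" for e w
  proof -
    have "c e w \<le> 1" using bound[OF that] \<delta> by linarith
    then have "exp (c e w) \<le> 3" using exp_le by (meson exp_le_cancel_iff order_trans)
    then have "\<bar>exp (c e w) - 1\<bar> \<le> 3" using exp_gt_zero[of "c e w"] by linarith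
    then show ?thesis
      unfolding \<gamma>_def abs_mult using \<alpha>_bound[OF that] by (intro mult_mono) auto
  qed
  have "(\<integral>w. exp (\<Sum>(i, j)\<in>edges n. c (i, j) w * (A i j w - q i j w)) \<partial>M)
      = (\<integral>w. (\<Prod>(i, j)\<in>edges n. \<alpha> (i, j) w + \<gamma> (i, j) w * A i j w) \<partial>M)"
  proof (rule Bochner_Integration.integral_cong[OF refl])
    fix w assume w: "w \<in> space M"
    have "exp (c (i, j) w * (A i j w - q i j w)) = \<alpha> (i, j) w + \<gamma> (i, j) w * A i j w" if "(i, j) \<in> edges n" for i j
      using A_01[of i j w] ij[OF that] w
      by (auto simp: \<alpha>_def \<gamma>_def right_diff_distrib exp_diff exp_minus field_simps)
    then show "exp (\<Sum>(i, j)\<in>edges n. c (i, j) w * (A i j w - q i j w)) =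
        (\<Prod>(i, j)\<in>edges n. \<alpha> (i, j) w + \<gamma> (i, j) w * A i j w)"
      unfolding exp_sum[OF finite_edges] by (intro prod.cong) auto
  qed
  also have "\<dots> = (\<integral>w. (\<Prod>(i, j)\<in>edges n. \<alpha> (i, j) w + \<gamma> (i, j) w * q i j w) \<partial>M)"
    using \<alpha>_meas \<gamma>_meas \<alpha>_bound \<gamma>_bound
    by (intro expectation_edge_product[where C="exp \<kappa> * 3"]) (fastforce intro: order_trans)+
  also have "\<dots> \<le> (\<integral>w. exp (\<kappa> * \<delta>\<^sup>2 * (real n)\<^sup>2) \<partial>M)"
  proof (rule integral_mono')
    fix w assume w: "w \<in> space M"
    have "\<bar>\<alpha> (i, j) w + \<gamma> (i, j) w * q i j w\<bar> \<le> exp (\<kappa> * \<delta>\<^sup>2)" if e: "(i, j) \<in> edges n" for i j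
    proof -
      \<comment> \<open>Each factor is a mean of positive values under a Bernoulli law. Its sign is
        needed because the product is bounded through the absolute values of its factors.\<close>
      have "0 \<le> \<alpha> (i, j) w * ((1 - q i j w) + exp (c (i, j) w) * q i j w)"
        using q_bounds[of i j w] by (intro mult_nonneg_nonneg add_nonneg_nonneg) (auto simp: \<alpha>_def)
      then have "0 \<le> \<alpha> (i, j) w + \<gamma> (i, j) w * q i j w"
        by (simp add: \<gamma>_def algebra_simps)
      then show ?thesis
        using centered_bernoulli_mgf_le[OF bound[OF e w] \<delta>(2), of "q i j w" \<kappa>] q_bounds
        by (simp add: \<alpha>_def \<gamma>_def)
    qed
    then have "\<bar>\<Prod>(i, j)\<in>edges n. \<alpha> (i, j) w + \<gamma> (i, j) w * q i j w\<bar> \<le> (\<Prod>(i, j)\<in>edges n. exp (\<kappa> * \<delta>\<^sup>2))"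
      unfolding abs_prod by (intro prod_mono) auto
    also have "\<dots> = exp (\<kappa> * \<delta>\<^sup>2 * real (card (edges n)))"
      by (simp add: case_prod_beta exp_of_nat_mult[symmetric] mult_ac)
    also have "\<dots> \<le> exp (\<kappa> * \<delta>\<^sup>2 * (real n)\<^sup>2)"
      using \<kappa> card_edges_le[of n] by (simp add: mult_left_mono)
    finally show "(\<Prod>(i, j)\<in>edges n. \<alpha> (i, j) w + \<gamma> (i, j) w * q i j w) \<le> exp (\<kappa> * \<delta>\<^sup>2 * (real n)\<^sup>2)"
      by linarith
  qed auto
  also have "\<dots> = exp (\<kappa> * \<delta>\<^sup>2 * (real n)\<^sup>2)" by (simp add: prob_space)
  finally show ?thesis .
qed

text \<open>After folding, an off-diagonal entry carries \<open>a i j + a j i\<close>, which is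
  bounded by \<open>2 * s\<close>. This explains both the factor 4 and the restriction of
  \<open>s\<close> to at most 1/2.\<close>

lemma signed_mgf_le:
  fixes a :: "nat \<Rightarrow> nat \<Rightarrow> 'w \<Rightarrow> real"
  assumes meas: "\<And>i j. i \<in> {1..n} \<Longrightarrow> j \<in> {1..n} \<Longrightarrow> a i j \<in> borel_measurable G"
    and bound: "\<And>i j w. i \<in> {1..n} \<Longrightarrow> j \<in> {1..n} \<Longrightarrow> w \<in> space M \<Longrightarrow> \<bar>a i j w\<bar> \<le> s"
    and s: "0 \<le> s" "s \<le> 1 / 2"
  shows "(\<integral>w. exp (\<Sum>i=1..n. \<Sum>j=1..n. a i j w * (A i j w - q i j w)) \<partial>M) \<le> exp (4 * \<kappa> * s\<^sup>2 * (real n)\<^sup>2)"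
proof -
  define c where "c e w = (if fst e = snd e then a (fst e) (snd e) w else a (fst e) (snd e) w + a (snd e) (fst e) w)"
    for e w
  have ij: "fst e \<in> {1..n}" "snd e \<in> {1..n}" if "e \<in> edges n" for e
    using subsetD[OF edges_subset that] by auto
  have c_meas: "c e \<in> borel_measurable G" if "e \<in> edges n" for e
    unfolding c_def using meas ij[OF that] by (cases "fst e = snd e") auto
  have c_bound: "\<bar>c e w\<bar> \<le> 2 * s" if "e \<in> edges n" "w \<in> space M" for e w
    unfolding c_def
    using bound[of "fst e" "snd e" w] bound[of "snd e" "fst e" w] ij[OF that(1)] that(2) by auto
  have "(\<integral>w. exp (\<Sum>i=1..n. \<Sum>j=1..n. a i j w * (A i j w - q i j w)) \<partial>M)
      = (\<integral>w. exp (\<Sum>(i, j)\<in>edges n. c (i, j) w * (A i j w - q i j w)) \<partial>M)"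
  proof (rule Bochner_Integration.integral_cong[OF refl])
    fix w assume w: "w \<in> space M"
    have "(\<Sum>i=1..n. \<Sum>j=1..n. a i j w * (A i j w - q i j w)) = (\<Sum>(i, j)\<in>edges n. c (i, j) w * (A i j w - q i j w))"
      unfolding sum_square_eq_sum_edges
    proof (rule sum.cong[OF refl], clarify)
      fix i j assume "(i, j) \<in> edges n"
      then have "A j i w = A i j w" using A_sym[of i j w] ij[of "(i, j)"] w by simp
      then show "(if i = j then a i j w * (A i j w - q i j w)
          else a i j w * (A i j w - q i j w) + a j i w * (A j i w - q j i w)) = c (i, j) w * (A i j w - q i j w)"
        using q_sym[of j i w] by (simp add: c_def distrib_right)
    qed
    then show "exp (\<Sum>i=1..n. \<Sum>j=1..n. a i j w * (A i j w - q i j w)) =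
        exp (\<Sum>(i, j)\<in>edges n. c (i, j) w * (A i j w - q i j w))" by simp
  qed
  also have "\<dots> \<le> exp (\<kappa> * (2 * s)\<^sup>2 * (real n)\<^sup>2)"
    using s by (intro edge_mgf_le c_meas c_bound) auto
  finally show ?thesis by (simp add: power2_eq_square mult_ac)
qed

text \<open>A choice of signs attaches one sign to each row and keeps the coefficients measurable
  with respect to \<open>G\<close> and bounded by \<open>s\<close>, so every choice falls under
  \<open>signed_mgf_le\<close>. There are \<open>2 ^ n\<close> choices, not one for each set of
  entries, which keeps the prefactor small against an exponent of order n^2 p.\<close>

lemma fluctuation_mgf_le:
  fixes c :: "nat \<Rightarrow> nat \<Rightarrow> 'w \<Rightarrow> real"
  assumes meas: "\<And>i j. i \<in> {1..n} \<Longrightarrow> j \<in> {1..n} \<Longrightarrow> c i j \<in> borel_measurable G"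
    and bound: "\<And>i j w. i \<in> {1..n} \<Longrightarrow> j \<in> {1..n} \<Longrightarrow> w \<in> space M \<Longrightarrow> \<bar>c i j w\<bar> \<le> 1"
    and s: "0 \<le> s" "s \<le> 1 / 2"
  shows "integrable M (\<lambda>w. exp (s * fluctuation n (\<lambda>i j. (A i j w - q i j w) * c i j w)))"
    and "(\<integral>w. exp (s * fluctuation n (\<lambda>i j. (A i j w - q i j w) * c i j w)) \<partial>M)
      \<le> 2 ^ n * exp (4 * \<kappa> * s\<^sup>2 * (real n)\<^sup>2)"
proof -
  define x where "x i w = s * (\<Sum>j=1..n. (A i j w - q i j w) * c i j w)" for i w
  define \<sigma> where "\<sigma> S i = (if i \<in> S then 1 else - 1 :: real)" for S :: "nat set" and i
  have term_bound: "\<bar>(A i j w - q i j w) * c i j w\<bar> \<le> 1"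
    if "i \<in> {1..n}" "j \<in> {1..n}" "w \<in> space M" for i j w
  proof -
    have "\<bar>A i j w - q i j w\<bar> \<le> 1"
      using A_01[OF that] q_bounds[of i j w] by auto
    then show ?thesis
      unfolding abs_mult using bound[OF that] by (intro mult_le_one) auto
  qed
  have c_meas: "c i j \<in> borel_measurable M" if "i \<in> {1..n}" "j \<in> {1..n}" for i j
    by (rule measurable_from_subalg[OF sub meas[OF that]])
  have x_meas: "x i \<in> borel_measurable M" if "i \<in> {1..n}" for i
    unfolding x_def using that A_measurable q_measurable_M c_meas
    by (intro borel_measurable_times borel_measurable_sum borel_measurable_diff) auto
  have x_bound: "\<bar>x i w\<bar> \<le> s * real n" if "i \<in> {1..n}" "w \<in> space M" for i w
  proof -
    have "\<bar>\<Sum>j=1..n. (A i j w - q i j w) * c i j w\<bar> \<le> (\<Sum>j=1..n. 1)"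
      using term_bound that by (intro order_trans[OF sum_abs] sum_mono) auto
    then show ?thesis
      unfolding x_def abs_mult using s by (simp add: mult_left_mono)
  qed
  have int: "integrable M (\<lambda>w. exp (\<Sum>i=1..n. y i w))"
    if "\<And>i. i \<in> {1..n} \<Longrightarrow> y i \<in> borel_measurable M"
      "\<And>i w. i \<in> {1..n} \<Longrightarrow> w \<in> space M \<Longrightarrow> \<bar>y i w\<bar> \<le> s * real n" for y
  proof (rule integrable_boundedI)
    have "(\<lambda>w. \<Sum>i=1..n. y i w) \<in> borel_measurable M"
      using that(1) by (intro borel_measurable_sum) auto
    then show "(\<lambda>w. exp (\<Sum>i=1..n. y i w)) \<in> borel_measurable M"
      by measurable
    fix w assume "w \<in> space M"
    then have "(\<Sum>i=1..n. y i w) \<le> (\<Sum>i=1..n. s * real n)"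
      using that(2) by (intro sum_mono) fastforce
    then show "\<bar>exp (\<Sum>i=1..n. y i w)\<bar> \<le> exp (\<Sum>i=1..n. s * real n)"
      by simp
  qed
  have fl: "s * fluctuation n (\<lambda>i j. (A i j w - q i j w) * c i j w) = (\<Sum>i=1..n. \<bar>x i w\<bar>)" for w
    unfolding fluctuation_def x_def using s by (simp add: abs_mult flip: sum_distrib_left)
  show int_fl: "integrable M (\<lambda>w. exp (s * fluctuation n (\<lambda>i j. (A i j w - q i j w) * c i j w)))"
    unfolding fl using x_meas x_bound by (intro int) auto
  have int_\<sigma>: "integrable M (\<lambda>w. exp (\<Sum>i=1..n. \<sigma> S i * x i w))" for S
    using x_meas x_bound by (intro int borel_measurable_times) (auto simp: \<sigma>_def)
  have "(\<integral>w. exp (s * fluctuation n (\<lambda>i j. (A i j w - q i j w) * c i j w)) \<partial>M)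
      \<le> (\<integral>w. (\<Sum>S\<in>Pow {1..n}. exp (\<Sum>i=1..n. \<sigma> S i * x i w)) \<partial>M)"
    using int_fl int_\<sigma> exp_sum_abs_le[of "{1..n}"] unfolding fl \<sigma>_def
    by (intro Bochner_Integration.integral_mono Bochner_Integration.integrable_sum) auto
  also have "\<dots> = (\<Sum>S\<in>Pow {1..n}. \<integral>w. exp (\<Sum>i=1..n. \<sigma> S i * x i w) \<partial>M)"
    by (intro Bochner_Integration.integral_sum int_\<sigma>)
  also have "\<dots> \<le> (\<Sum>S\<in>Pow {1..n}. exp (4 * \<kappa> * s\<^sup>2 * (real n)\<^sup>2))"
  proof (rule sum_mono)
    fix S
    have "(\<Sum>i=1..n. \<sigma> S i * x i w) = (\<Sum>i=1..n. \<Sum>j=1..n. (\<sigma> S i * s * c i j w) * (A i j w - q i j w))" for w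
      unfolding x_def sum_distrib_left by (intro sum.cong refl) (simp add: mult_ac)
    moreover have "(\<integral>w. exp (\<Sum>i=1..n. \<Sum>j=1..n. (\<sigma> S i * s * c i j w) * (A i j w - q i j w)) \<partial>M)
        \<le> exp (4 * \<kappa> * s\<^sup>2 * (real n)\<^sup>2)"
    proof (rule signed_mgf_le)
      show "(\<lambda>w. \<sigma> S i * s * c i j w) \<in> borel_measurable G" if "i \<in> {1..n}" "j \<in> {1..n}" for i j
        using meas[OF that] by (intro borel_measurable_times) auto
      show "\<bar>\<sigma> S i * s * c i j w\<bar> \<le> s" if "i \<in> {1..n}" "j \<in> {1..n}" "w \<in> space M" for i j w
        using mult_left_mono[OF bound[OF that] s(1)] s by (simp add: abs_mult \<sigma>_def)
    qed (use s in auto)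
    ultimately show "(\<integral>w. exp (\<Sum>i=1..n. \<sigma> S i * x i w) \<partial>M) \<le> exp (4 * \<kappa> * s\<^sup>2 * (real n)\<^sup>2)"
      by simp
  qed
  also have "\<dots> = 2 ^ n * exp (4 * \<kappa> * s\<^sup>2 * (real n)\<^sup>2)"
    by (simp add: card_Pow)
  finally show "(\<integral>w. exp (s * fluctuation n (\<lambda>i j. (A i j w - q i j w) * c i j w)) \<partial>M)
      \<le> 2 ^ n * exp (4 * \<kappa> * s\<^sup>2 * (real n)\<^sup>2)" .
qed

text \<open>Convexity of exp moves the exponential inside the average over the \<open>N\<close> grid
  times, so the moment bound of a single time survives without any factor \<open>N\<close>. This
  uniformity is what allows \<open>N\<close> to tend to infinity afterwards; Markov's inequality
  then gives the tail.\<close>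

lemma fluctuation_average_tail:
  fixes c :: "nat \<Rightarrow> nat \<Rightarrow> nat \<Rightarrow> 'w \<Rightarrow> real"
  assumes N: "0 < N"
    and meas: "\<And>k i j. k < N \<Longrightarrow> i \<in> {1..n} \<Longrightarrow> j \<in> {1..n} \<Longrightarrow> c k i j \<in> borel_measurable G"
    and bound: "\<And>k i j w. k < N \<Longrightarrow> i \<in> {1..n} \<Longrightarrow> j \<in> {1..n} \<Longrightarrow> w \<in> space M \<Longrightarrow> \<bar>c k i j w\<bar> \<le> 1"
    and s: "0 < s" "s \<le> 1 / 2"
  defines "Z \<equiv> \<lambda>w. (\<Sum>k<N. fluctuation n (\<lambda>i j. (A i j w - q i j w) * c k i j w)) / real N"
  shows "Z \<in> borel_measurable M"
    and "prob {w \<in> space M. t < Z w} \<le> 2 ^ n * exp (4 * \<kappa> * s\<^sup>2 * (real n)\<^sup>2 - s * t)"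
proof -
  let ?\<Phi> = "\<lambda>k w. fluctuation n (\<lambda>i j. (A i j w - q i j w) * c k i j w)"
  let ?B = "2 ^ n * exp (4 * \<kappa> * s\<^sup>2 * (real n)\<^sup>2)"
  have fl_meas: "?\<Phi> k \<in> borel_measurable M" if "k < N" for k
    unfolding fluctuation_def using A_measurable q_measurable_M measurable_from_subalg[OF sub meas[OF that]]
    by (intro borel_measurable_sum borel_measurable_abs borel_measurable_times borel_measurable_diff) auto
  show Z_meas: "Z \<in> borel_measurable M"
    unfolding Z_def using fl_meas by (intro borel_measurable_divide borel_measurable_sum) auto
  have int: "integrable M (\<lambda>w. exp (s * ?\<Phi> k w))"
    and le: "(\<integral>w. exp (s * ?\<Phi> k w) \<partial>M) \<le> ?B" if "k < N" for k
    using fluctuation_mgf_le[of "c k" s, OF meas[OF that] bound[OF that]] s by auto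
  have jensen: "exp (s * Z w) \<le> (\<Sum>k<N. exp (s * ?\<Phi> k w)) / real N" for w
  proof -
    have "exp (\<Sum>k<N. (1 / real N) *\<^sub>R (s * ?\<Phi> k w)) \<le> (\<Sum>k<N. (1 / real N) * exp (s * ?\<Phi> k w))"
      using N by (intro convex_on_sum[OF _ _ exp_convex]) auto
    then show ?thesis
      by (simp add: Z_def sum_distrib_left sum_divide_distrib mult_ac)
  qed
  have int_avg: "integrable M (\<lambda>w. (\<Sum>k<N. exp (s * ?\<Phi> k w)) / real N)"
    using int by (intro integrable_divide Bochner_Integration.integrable_sum) auto
  have int_Z: "integrable M (\<lambda>w. exp (s * Z w))"
  proof (rule Bochner_Integration.integrable_bound[OF int_avg])
    show "AE w in M. norm (exp (s * Z w)) \<le> norm ((\<Sum>k<N. exp (s * ?\<Phi> k w)) / real N)"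
      unfolding real_norm_def abs_exp_cancel by (intro AE_I2 order_trans[OF jensen abs_ge_self])
  qed (use Z_meas in measurable)
  have "(\<integral>w. exp (s * Z w) \<partial>M) \<le> (\<integral>w. (\<Sum>k<N. exp (s * ?\<Phi> k w)) / real N \<partial>M)"
    using int_Z int_avg jensen by (intro Bochner_Integration.integral_mono)
  also have "\<dots> = (\<Sum>k<N. \<integral>w. exp (s * ?\<Phi> k w) \<partial>M) / real N"
    unfolding integral_divide_zero by (subst Bochner_Integration.integral_sum) (auto intro: int)
  also have "\<dots> \<le> (\<Sum>k<N. ?B) / real N"
    by (intro divide_right_mono sum_mono le) auto
  also have "\<dots> = ?B" using N by simp
  finally have EZ: "(\<integral>w. exp (s * Z w) \<partial>M) \<le> ?B" .
  have "prob {w \<in> space M. t < Z w} \<le> prob {w \<in> space M. exp (s * t) \<le> exp (s * Z w)}"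
    using Z_meas s by (intro finite_measure_mono) auto
  also have "\<dots> \<le> (\<integral>w. exp (s * Z w) \<partial>M) / exp (s * t)"
    by (rule integral_Markov_inequality_measure[OF int_Z, of "{}"]) auto
  also have "\<dots> \<le> ?B / exp (s * t)"
    by (intro divide_right_mono EZ) auto
  also have "\<dots> = 2 ^ n * exp (4 * \<kappa> * s\<^sup>2 * (real n)\<^sup>2 - s * t)"
    by (simp add: exp_diff)
  finally show "prob {w \<in> space M. t < Z w} \<le> 2 ^ n * exp (4 * \<kappa> * s\<^sup>2 * (real n)\<^sup>2 - s * t)" .
qed

end

section \<open>Empirical measures\<close>

text \<open>The infimum in \<open>lip_norm\<close> is not known to be attained. The factor 2 in
  \<open>BL_norm\<close> puts it strictly below 1, so some admissible constant lies below 1.\<close>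

lemma BL_norm_le_1_lipschitz:
  assumes "BL_norm m f \<le> 1" "x \<in> mspace m" "y \<in> mspace m"
  shows "\<bar>f x - f y\<bar> \<le> mdist m x y"
proof -
  have "2 * lip_norm m f \<le> 1"
    using assms(1) unfolding BL_norm_def distrib_left
    by (meson add_increasing order_trans zero_le order_refl)
  then have le: "lip_norm m f + lip_norm m f \<le> 1"
    by (simp add: mult_2)
  have "lip_norm m f < 1"
  proof (rule ccontr)
    assume "\<not> lip_norm m f < 1"
    then have "1 + 1 \<le> lip_norm m f + lip_norm m f" by (intro add_mono) auto
    then have "(1 + 1 :: ennreal) \<le> 1" using le by (rule order_trans)
    then show False by simp
  qed
  then obtain l where l: "0 \<le> l" "ennreal l < 1" "\<bar>f x - f y\<bar> \<le> l * mdist m x y"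
    using assms(2,3) unfolding lip_norm_def INF_less_iff by auto
  then have "l * mdist m x y \<le> 1 * mdist m x y"
    by (intro mult_right_mono) auto
  then show ?thesis using l(3) by simp
qed

lemma empirical_measure_measurable:
  "(\<And>i. i \<in> {1..n} \<Longrightarrow> x i \<in> space N) \<Longrightarrow> x \<in> measurable (uniform_count_measure {1..n}) N"
  by (auto simp: measurable_def sets_uniform_count_measure space_uniform_count_measure)

lemma empirical_measure_in_prob_measures:
  assumes "1 \<le> n" "\<And>i. i \<in> {1..n} \<Longrightarrow> x i \<in> mspace m"
  shows "empirical_measure (borel_of_metric m) n x \<in> prob_measures m"
proof -
  interpret prob_space "uniform_count_measure {1..n}"
    using assms(1) by (intro prob_space_uniform_count_measure) auto
  show ?thesis
    using assms(2) unfolding prob_measures_def empirical_measure_def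
    using prob_space_distr[OF empirical_measure_measurable[of n x "borel_of_metric m"]] by simp
qed

lemma integral_empirical_measure:
  fixes f :: "'a \<Rightarrow> real"
  assumes "\<And>i. i \<in> {1..n} \<Longrightarrow> x i \<in> space N" "f \<in> borel_measurable N"
  shows "(\<integral>z. f z \<partial>empirical_measure N n x) = (\<Sum>i=1..n. f (x i)) / real n"
  unfolding empirical_measure_def using assms(2)
  by (subst integral_distr[OF empirical_measure_measurable[OF assms(1)]])
    (simp_all add: integral_uniform_count_measure)

text \<open>Matching the atoms of equal index is a coupling of the two measures, and test functions
  are 1-Lipschitz.\<close>

lemma BL_dist_empirical_measure_le:
  assumes x: "\<And>i. i \<in> {1..n} \<Longrightarrow> x i \<in> mspace m" and y: "\<And>i. i \<in> {1..n} \<Longrightarrow> y i \<in> mspace m"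
  shows "BL_dist m (empirical_measure (borel_of_metric m) n x) (empirical_measure (borel_of_metric m) n y)
    \<le> (\<Sum>i=1..n. mdist m (x i) (y i)) / real n"
proof (rule BL_dist_least)
  fix f assume f: "BL_norm m f \<le> 1"
  have meas: "f \<in> borel_measurable (borel_of_metric m)"
  proof -
    obtain l where "0 \<le> l" "\<forall>x\<in>mspace m. \<forall>y\<in>mspace m. \<bar>f x - f y\<bar> \<le> l * mdist m x y"
      using BL_norm_le_1D(2)[OF f] by auto
    then show ?thesis by (intro lipschitz_borel_measurable[of l]) auto
  qed
  have "\<bar>(\<Sum>i=1..n. f (x i)) - (\<Sum>i=1..n. f (y i))\<bar> \<le> (\<Sum>i=1..n. mdist m (x i) (y i))"
    unfolding sum_subtractf[symmetric]
    by (intro order_trans[OF sum_abs] sum_mono BL_norm_le_1_lipschitz[OF f] x y)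
  then show "\<bar>(\<integral>z. f z \<partial>empirical_measure (borel_of_metric m) n x) -
      (\<integral>z. f z \<partial>empirical_measure (borel_of_metric m) n y)\<bar> \<le> (\<Sum>i=1..n. mdist m (x i) (y i)) / real n"
    using integral_empirical_measure[of n x, OF _ meas] integral_empirical_measure[of n y, OF _ meas] x y
    by (simp only: space_borel_of_metric) (simp add: divide_right_mono flip: diff_divide_distrib)
qed

text \<open>The approximating maps take countably many values in the applications, which is how the
  preimages of arbitrary sets come to be measurable.\<close>

lemma measurable_metric_limit:
  assumes F: "\<And>w. w \<in> space M \<Longrightarrow> F w \<in> mspace m"
    and Fk: "\<And>k w. w \<in> space M \<Longrightarrow> Fk k w \<in> mspace m"
    and meas: "\<And>k S. {w \<in> space M. Fk k w \<in> S} \<in> sets M"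
    and lim: "\<And>w. w \<in> space M \<Longrightarrow> (\<lambda>k. mdist m (Fk k w) (F w)) \<longlonglongrightarrow> 0"
  shows "F \<in> measurable M (borel_of_metric m)"
proof (rule measurable_sigma_sets[OF sets_borel_of_metric])
  interpret Metric_space "mspace m" "mdist m" by simp
  show "{U. openin (mtopology_of m) U} \<subseteq> Pow (mspace m)"
    using openin_subset by fastforce
  show "F \<in> space M \<rightarrow> mspace m" using F by auto
  fix U assume "U \<in> {U. openin (mtopology_of m) U}"
  then have U: "openin mtopology U" by (simp add: mtopology_of_def)
  \<comment> \<open>Points of \<open>U\<close> with a definite margin. A margin independent of
    \<open>k\<close> is essential: approximations that merely lie in \<open>U\<close> could converge
    to a boundary point outside of it.\<close>
  define V where "V r = {x \<in> mspace m. mball x (1 / real (Suc r)) \<subseteq> U}" for r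
  have iff: "F w \<in> U \<longleftrightarrow> (\<exists>r K. \<forall>k\<ge>K. Fk k w \<in> V r)" if w: "w \<in> space M" for w
  proof
    assume "F w \<in> U"
    then obtain \<epsilon> where \<epsilon>: "0 < \<epsilon>" "mball (F w) \<epsilon> \<subseteq> U"
      using U unfolding openin_mtopology by blast
    obtain r where r: "1 / real (Suc r) < \<epsilon> / 2"
      using nat_approx_posE[of "\<epsilon> / 2"] \<epsilon> by auto
    obtain K where K: "\<And>k. K \<le> k \<Longrightarrow> mdist m (Fk k w) (F w) < \<epsilon> / 2"
      using order_tendstoD(2)[OF lim[OF w], of "\<epsilon> / 2"] \<epsilon> unfolding eventually_sequentially by auto
    have "Fk k w \<in> V r" if k: "K \<le> k" for k
      unfolding V_def
    proof (intro CollectI conjI Fk[OF w] subsetI)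
      fix y assume y: "y \<in> mball (Fk k w) (1 / real (Suc r))"
      then have "mdist m (F w) y \<le> mdist m (F w) (Fk k w) + mdist m (Fk k w) y"
        using F[OF w] Fk[OF w] by (intro triangle) auto
      then have "mdist m (F w) y < \<epsilon>"
        using y K[OF k] r commute[of "F w" "Fk k w"] by auto
      then show "y \<in> U" using \<epsilon> y F[OF w] by auto
    qed
    then show "\<exists>r K. \<forall>k\<ge>K. Fk k w \<in> V r" by blast
  next
    assume "\<exists>r K. \<forall>k\<ge>K. Fk k w \<in> V r"
    then obtain r K where rK: "\<And>k. K \<le> k \<Longrightarrow> Fk k w \<in> V r" by blast
    have "\<forall>\<^sub>F k in sequentially. mdist m (Fk k w) (F w) < 1 / real (Suc r)"
      using order_tendstoD(2)[OF lim[OF w], of "1 / real (Suc r)"] by simp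
    then have "\<forall>\<^sub>F k in sequentially. mdist m (Fk k w) (F w) < 1 / real (Suc r) \<and> K \<le> k"
      using eventually_ge_at_top by (rule eventually_conj)
    then obtain k where "mdist m (Fk k w) (F w) < 1 / real (Suc r)" "K \<le> k"
      using eventually_happens by force
    then show "F w \<in> U"
      using rK[of k] F[OF w] Fk[OF w] unfolding V_def by (auto simp: subset_iff)
  qed
  have "F -` U \<inter> space M = {w \<in> space M. \<exists>r K. \<forall>k. K \<le> k \<longrightarrow> Fk k w \<in> V r}"
    using iff by auto
  also have "\<dots> \<in> sets M"
    by (intro sets.sets_Collect_countable_Ex sets.sets_Collect_countable_All sets.sets_Collect_imp meas) simp
  finally show "F -` U \<inter> space M \<in> sets M" .
qed

text \<open>The tuple takes countably many values, each on a measurable set, so \<open>H\<close> and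
  \<open>S\<close> may be arbitrary. This makes measurability of maps into a space of measures free
  of charge.\<close>

lemma measurable_countable_tuple:
  fixes X :: "'i \<Rightarrow> 'w \<Rightarrow> 'c::countable"
  assumes I: "finite I" and X: "\<And>i. i \<in> I \<Longrightarrow> X i \<in> measurable M (count_space UNIV)"
  shows "{w \<in> space M. H (\<lambda>i\<in>I. X i w) \<in> S} \<in> sets M"
proof -
  let ?Z = "{z \<in> PiE I (\<lambda>_. UNIV). H z \<in> S}"
  have "countable (PiE I (\<lambda>_. UNIV :: 'c set))"
    using I by (intro countable_PiE) auto
  then have Z: "countable ?Z" by (rule countable_subset[rotated]) auto
  have "{w \<in> space M. H (\<lambda>i\<in>I. X i w) \<in> S} = (\<Union>z\<in>?Z. {w \<in> space M. \<forall>i\<in>I. X i w = z i})"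
  proof (intro set_eqI iffI)
    fix w assume "w \<in> {w \<in> space M. H (\<lambda>i\<in>I. X i w) \<in> S}"
    then show "w \<in> (\<Union>z\<in>?Z. {w \<in> space M. \<forall>i\<in>I. X i w = z i})"
      by (intro UN_I[of "\<lambda>i\<in>I. X i w"]) auto
  next
    fix w assume "w \<in> (\<Union>z\<in>?Z. {w \<in> space M. \<forall>i\<in>I. X i w = z i})"
    then obtain z where z: "z \<in> ?Z" "w \<in> space M" "\<forall>i\<in>I. X i w = z i" by auto
    then have "(\<lambda>i\<in>I. X i w) = z"
      by (intro extensionalityI[of _ I]) (auto simp: PiE_iff)
    then show "w \<in> {w \<in> space M. H (\<lambda>i\<in>I. X i w) \<in> S}" using z by auto
  qed
  also have "\<dots> \<in> sets M"
  proof (intro sets.countable_UN''[OF Z] sets.sets_Collect_finite_All I)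
    fix z i assume "i \<in> I"
    have "X i -` {z i} \<inter> space M \<in> sets M"
      by (rule measurable_sets[OF X[OF \<open>i \<in> I\<close>]]) simp
    also have "X i -` {z i} \<inter> space M = {w \<in> space M. X i w = z i}" by auto
    finally show "{w \<in> space M. X i w = z i} \<in> sets M" .
  qed
  finally show ?thesis .
qed

text \<open>The Bernstein polynomial on [0,T] whose node values are multiples of 1/m: a continuous
  path coded by \<open>m + 1\<close> integers. It is cut off outside [0,T] because paths are
  extensional functions.\<close>

definition rounded_path :: "real \<Rightarrow> nat \<Rightarrow> (nat \<Rightarrow> int) \<Rightarrow> real \<Rightarrow> real" where
  "rounded_path T m z = (\<lambda>t\<in>{0..T}. \<Sum>l\<le>m. of_int (z l) / real m * Bernstein m l (t / T))"

definition rounded_vec :: "nat \<Rightarrow> ('d::finite \<Rightarrow> int) \<Rightarrow> real^'d" where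
  "rounded_vec m z = (\<chi> c. of_int (z c) / real m)"

lemma rounding_error:
  fixes a :: real
  assumes "0 < m"
  shows "\<bar>of_int \<lfloor>real m * a\<rfloor> / real m - a\<bar> \<le> 1 / real m"
proof -
  have "\<bar>of_int \<lfloor>real m * a\<rfloor> - real m * a\<bar> \<le> 1"
    by linarith
  then have "\<bar>of_int \<lfloor>real m * a\<rfloor> - real m * a\<bar> / real m \<le> 1 / real m"
    by (intro divide_right_mono) auto
  moreover have "of_int \<lfloor>real m * a\<rfloor> / real m - a = (of_int \<lfloor>real m * a\<rfloor> - real m * a) / real m"
    using assms by (simp add: diff_divide_distrib)
  ultimately show ?thesis by simp
qed

lemma restrict_in_mspace: "continuous_on {0..T} f \<Longrightarrow> restrict f {0..T} \<in> mspace (path_metric T)"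
  using continuous_on_cong[OF refl, of "{0..T}" "restrict f {0..T}" f] by (simp add: mspace_path_metric)

lemma rounded_path_in_mspace: "rounded_path T m z \<in> mspace (path_metric T)"
  unfolding rounded_path_def Bernstein_def
  by (rule restrict_in_mspace, unfold divide_inverse)
    (intro continuous_on_sum continuous_on_mult continuous_on_power continuous_on_diff continuous_on_const
      continuous_on_id)

lemma mdist_path_metric_le:
  assumes "0 \<le> T" "f \<in> mspace (path_metric T)" "g \<in> mspace (path_metric T)"
    and "\<And>t. t \<in> {0..T} \<Longrightarrow> \<bar>f t - g t\<bar> \<le> c"
  shows "mdist (path_metric T) f g \<le> c"
  unfolding mdist_path_metric[OF assms(1-3)] using assms(1,4) by (intro cSUP_least) auto

text \<open>The Bernstein weights are nonnegative with sum 1, so rounding the node values moves the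
  polynomial by at most 1/m; the rest is the Weierstrass approximation by Bernstein
  polynomials.\<close>

lemma rounded_path_tendsto:
  assumes T: "0 < T" and f: "continuous_on {0..T} f"
  shows "(\<lambda>m. mdist (path_metric T)
    (rounded_path T m (\<lambda>l. \<lfloor>real m * f (T * (real l / real m))\<rfloor>)) (restrict f {0..T})) \<longlonglongrightarrow> 0"
    (is "(\<lambda>m. mdist _ (?r m) _) \<longlonglongrightarrow> 0")
proof (rule LIMSEQ_I)
  fix \<epsilon> :: real assume \<epsilon>: "0 < \<epsilon>"
  have "continuous_on {0..1} (\<lambda>x. f (T * x))"
    using T by (intro continuous_on_compose2[OF f] continuous_intros) (auto simp: mult_left_le)
  then obtain N where N: "\<And>m x. N \<le> m \<Longrightarrow> x \<in> {0..1} \<Longrightarrow>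
      \<bar>f (T * x) - (\<Sum>l\<le>m. f (T * (real l / real m)) * Bernstein m l x)\<bar> < \<epsilon> / 4"
    using Bernstein_Weierstrass[of "\<lambda>x. f (T * x)" "\<epsilon> / 4"] \<epsilon> by auto
  obtain N' :: nat where N': "4 / \<epsilon> < real N'" using reals_Archimedean2 by blast
  show "\<exists>no. \<forall>m\<ge>no. norm (mdist (path_metric T) (?r m) (restrict f {0..T}) - 0) < \<epsilon>"
  proof (intro exI allI impI)
    fix m assume m: "max N N' \<le> m"
    have "0 < real N'" using \<epsilon> N' by (meson divide_pos_pos less_trans zero_less_numeral)
    then have m0: "0 < m" using m by auto
    have "4 / \<epsilon> < real m" using N' m by linarith
    then have m\<epsilon>: "1 / real m \<le> \<epsilon> / 4" using \<epsilon> m0 by (simp add: field_simps)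
    have "mdist (path_metric T) (?r m) (restrict f {0..T}) \<le> \<epsilon> / 2"
    proof (rule mdist_path_metric_le)
      fix t assume t: "t \<in> {0..T}"
      define x where "x = t / T"
      have x: "x \<in> {0..1}" "t = T * x" using t T by (auto simp: x_def)
      have "\<bar>(\<Sum>l\<le>m. of_int \<lfloor>real m * f (T * (real l / real m))\<rfloor> / real m * Bernstein m l x) -
          (\<Sum>l\<le>m. f (T * (real l / real m)) * Bernstein m l x)\<bar> \<le> (\<Sum>l\<le>m. 1 / real m * Bernstein m l x)"
        unfolding sum_subtractf[symmetric] left_diff_distrib[symmetric]
      proof (intro order_trans[OF sum_abs] sum_mono)
        fix l
        have "0 \<le> Bernstein m l x" using x(1) by (auto intro: Bernstein_nonneg)
        then show "\<bar>(of_int \<lfloor>real m * f (T * (real l / real m))\<rfloor> / real m - f (T * (real l / real m))) * Bernstein m l x\<bar>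
            \<le> 1 / real m * Bernstein m l x"
          unfolding abs_mult by (simp only: abs_of_nonneg mult_right_mono[OF rounding_error[OF m0]])
      qed
      also have "\<dots> = 1 / real m" by (simp only: sum_Bernstein mult_1_right flip: sum_distrib_left)
      finally have \<Delta>: "\<bar>(\<Sum>l\<le>m. of_int \<lfloor>real m * f (T * (real l / real m))\<rfloor> / real m * Bernstein m l x) -
          (\<Sum>l\<le>m. f (T * (real l / real m)) * Bernstein m l x)\<bar> \<le> 1 / real m" .
      have r: "?r m t = (\<Sum>l\<le>m. of_int \<lfloor>real m * f (T * (real l / real m))\<rfloor> / real m * Bernstein m l x)"
        "restrict f {0..T} t = f t"
        unfolding rounded_path_def x_def using t by simp_all
      show "\<bar>?r m t - restrict f {0..T} t\<bar> \<le> \<epsilon> / 2"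
        using \<Delta> N[OF _ x(1), of m] m m\<epsilon> unfolding r x(2)[symmetric] by linarith
    qed (intro less_imp_le T rounded_path_in_mspace restrict_in_mspace f)+
    moreover have "0 \<le> mdist (path_metric T) (?r m) (restrict f {0..T})"
      by (rule Metric_space.nonneg[OF Metric_space_mspace_mdist])
    ultimately show "norm (mdist (path_metric T) (?r m) (restrict f {0..T}) - 0) < \<epsilon>"
      using \<epsilon> by simp
  qed
qed

lemma rounded_vec_tendsto:
  fixes v :: "real^'d"
  shows "(\<lambda>m. dist (rounded_vec m (\<lambda>c. \<lfloor>real m * v $ c\<rfloor>)) v) \<longlonglongrightarrow> 0"
proof (rule tendsto_sandwich[OF _ _ tendsto_const])
  show "\<forall>\<^sub>F m in sequentially. dist (rounded_vec m (\<lambda>c. \<lfloor>real m * v $ c\<rfloor>)) v \<le> real CARD('d) / real m"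
    using eventually_gt_at_top[of 0]
  proof eventually_elim
    case (elim m)
    have "dist (rounded_vec m (\<lambda>c. \<lfloor>real m * v $ c\<rfloor>)) v \<le> (\<Sum>c\<in>UNIV. \<bar>of_int \<lfloor>real m * v $ c\<rfloor> / real m - v $ c\<bar>)"
      unfolding dist_norm by (rule order_trans[OF norm_le_l1_cart]) (simp add: rounded_vec_def)
    also have "\<dots> \<le> (\<Sum>c\<in>(UNIV::'d set). 1 / real m)"
      by (intro sum_mono rounding_error elim)
    finally show ?case by simp
  qed
qed (auto intro: lim_const_over_n)

text \<open>The Borel sets here are those of the metric on measures. Instead of a description of
  this sigma-algebra by evaluations, the random measure is a pointwise limit in
  \<open>BL_metric\<close> of empirical measures coded by finitely many integers.\<close>

lemma double_layer_empirical_measurable: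
  fixes \<theta> :: "nat \<Rightarrow> real \<Rightarrow> 'w \<Rightarrow> real" and \<omega> :: "nat \<Rightarrow> 'w \<Rightarrow> real^'d"
  assumes n: "1 \<le> n" and T: "0 < T"
    and cont: "\<And>i w. i \<in> {1..n} \<Longrightarrow> w \<in> space M \<Longrightarrow> continuous_on {0..T} (\<lambda>t. \<theta> i t w)"
    and \<theta>: "\<And>i t. i \<in> {1..n} \<Longrightarrow> t \<in> {0..T} \<Longrightarrow> \<theta> i t \<in> borel_measurable M"
    and \<omega>: "\<And>i. i \<in> {1..n} \<Longrightarrow> \<omega> i \<in> borel_measurable M"
  shows "(\<lambda>w. double_layer_empirical T n (\<lambda>i t. \<theta> i t w) (\<lambda>i. \<omega> i w))
    \<in> measurable M (borel_of_metric (BL_metric (double_layer_metric T)))"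
proof -
  let ?m = "double_layer_metric T :: ((real \<Rightarrow> real) \<times> (real^'d)) metric"
  \<comment> \<open>Labels of the integer codes at level \<open>k\<close>: on the left the node
    values of the paths, on the right the coordinates of the environments.\<close>
  define I :: "nat \<Rightarrow> (nat \<times> nat + nat \<times> 'd) set" where
    "I k = Inl ` ({1..n} \<times> {..k}) \<union> Inr ` ({1..n} \<times> UNIV)" for k
  define X :: "nat \<Rightarrow> nat \<times> nat + nat \<times> 'd \<Rightarrow> 'w \<Rightarrow> int" where
    "X k j w = (case j of Inl (i, l) \<Rightarrow> \<lfloor>real k * \<theta> i (T * (real l / real k)) w\<rfloor>
      | Inr (i, c) \<Rightarrow> \<lfloor>real k * \<omega> i w $ c\<rfloor>)" for k j w
  define P :: "nat \<Rightarrow> (nat \<times> nat + nat \<times> 'd \<Rightarrow> int) \<Rightarrow> nat \<Rightarrow> (real \<Rightarrow> real) \<times> (real^'d)" where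
    "P k z i = (rounded_path T k (\<lambda>l. z (Inl (i, l))), rounded_vec k (\<lambda>c. z (Inr (i, c))))" for k z i
  define H where "H k z = empirical_measure (borel_of_metric ?m) n (P k z)" for k z
  define E where "E k w = H k (\<lambda>j\<in>I k. X k j w)" for k w
  have P_in: "P k z i \<in> mspace ?m" for k z i
    by (simp add: P_def double_layer_metric_def rounded_path_in_mspace)
  have x_in: "(restrict (\<lambda>t. \<theta> i t w) {0..T}, \<omega> i w) \<in> mspace ?m" if "i \<in> {1..n}" "w \<in> space M" for i w
    using restrict_in_mspace[OF cont[OF that]] by (simp add: double_layer_metric_def)
  \<comment> \<open>Only nodes \<open>l \<le> k\<close> enter the polynomial, so cutting the tuple
    down to \<open>I k\<close> loses nothing.\<close>
  have P_eval: "P k (\<lambda>j\<in>I k. X k j w) i =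
      (rounded_path T k (\<lambda>l. \<lfloor>real k * \<theta> i (T * (real l / real k)) w\<rfloor>), rounded_vec k (\<lambda>c. \<lfloor>real k * \<omega> i w $ c\<rfloor>))"
    if "i \<in> {1..n}" for k i w
    using that unfolding P_def by (auto simp: I_def X_def rounded_path_def image_iff intro!: ext sum.cong)
  show ?thesis
  proof (rule measurable_metric_limit[where Fk=E])
    fix w assume w: "w \<in> space M"
    show L: "double_layer_empirical T n (\<lambda>i t. \<theta> i t w) (\<lambda>i. \<omega> i w) \<in> mspace (BL_metric ?m)"
      unfolding double_layer_empirical_def mspace_BL_metric using n x_in w
      by (intro empirical_measure_in_prob_measures)
    show E_in: "E k w \<in> mspace (BL_metric ?m)" for k
      unfolding E_def H_def mspace_BL_metric using n P_in
      by (intro empirical_measure_in_prob_measures)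
    define D where "D k = (\<Sum>i=1..n. mdist (path_metric T)
        (rounded_path T k (\<lambda>l. \<lfloor>real k * \<theta> i (T * (real l / real k)) w\<rfloor>)) (restrict (\<lambda>t. \<theta> i t w) {0..T}) +
        dist (rounded_vec k (\<lambda>c. \<lfloor>real k * \<omega> i w $ c\<rfloor>)) (\<omega> i w)) / real n" for k
    have "D \<longlonglongrightarrow> (\<Sum>i=1..n. 0 + 0) / real n"
      unfolding D_def using n w
      by (intro tendsto_intros rounded_path_tendsto T cont rounded_vec_tendsto) auto
    then have D: "D \<longlonglongrightarrow> 0" by simp
    have "mdist (BL_metric ?m) (E k w) (double_layer_empirical T n (\<lambda>i t. \<theta> i t w) (\<lambda>i. \<omega> i w)) \<le> D k" for k
    proof -
      have "mdist (BL_metric ?m) (E k w) (double_layer_empirical T n (\<lambda>i t. \<theta> i t w) (\<lambda>i. \<omega> i w))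
          = BL_dist ?m (E k w) (double_layer_empirical T n (\<lambda>i t. \<theta> i t w) (\<lambda>i. \<omega> i w))"
        using L E_in by (simp add: mdist_BL_metric)
      also have "\<dots> \<le> (\<Sum>i=1..n. mdist ?m (P k (\<lambda>j\<in>I k. X k j w) i) (restrict (\<lambda>t. \<theta> i t w) {0..T}, \<omega> i w)) / real n"
        unfolding E_def H_def double_layer_empirical_def
        using P_in x_in w by (intro BL_dist_empirical_measure_le)
      also have "\<dots> = D k"
        unfolding D_def by (intro arg_cong2[where f="(/)"] sum.cong refl) (simp add: P_eval double_layer_metric_def)
      finally show ?thesis .
    qed
    then show "(\<lambda>k. mdist (BL_metric ?m) (E k w) (double_layer_empirical T n (\<lambda>i t. \<theta> i t w) (\<lambda>i. \<omega> i w))) \<longlonglongrightarrow> 0"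
      by (intro tendsto_sandwich[OF _ _ tendsto_const D] always_eventually allI
          Metric_space.nonneg[OF Metric_space_mspace_mdist])
  next
    fix k S
    show "{w \<in> space M. E k w \<in> S} \<in> sets M"
      unfolding E_def
    proof (rule measurable_countable_tuple)
      fix j assume j: "j \<in> I k"
      show "X k j \<in> measurable M (count_space UNIV)"
      proof (cases j)
        case (Inl a)
        then obtain i l where il: "j = Inl (i, l)" "i \<in> {1..n}" "l \<le> k" using j by (auto simp: I_def)
        \<comment> \<open>At level 0 the quotient is 0 by convention, so the only node is time 0 and
          still lies in [0,T].\<close>
        have "real l / real k \<le> 1"
          using il(3) by (cases "k = 0") auto
        from mult_left_mono[OF this, of T] have "\<theta> i (T * (real l / real k)) \<in> borel_measurable M"
          using T by (intro \<theta> il(2)) simp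
        then have "(\<lambda>w. real k * \<theta> i (T * (real l / real k)) w) \<in> borel_measurable M"
          by (intro borel_measurable_times) auto
        then show ?thesis
          unfolding X_def il(1) by (simp add: measurable_compose[OF _ measurable_real_floor])
      next
        case (Inr a)
        then obtain i c where ic: "j = Inr (i, c)" "i \<in> {1..n}" using j by (auto simp: I_def)
        have "(\<lambda>w. real k * \<omega> i w $ c) \<in> borel_measurable M"
          by (intro borel_measurable_times borel_measurable_const
              borel_measurable_continuous_on[OF _ \<omega>[OF ic(2)]] continuous_intros)
        then show ?thesis
          unfolding X_def ic(1) by (simp add: measurable_compose[OF _ measurable_real_floor])
      qed
    qed (simp add: I_def)
  qed
qed

section \<open>The particle system for a fixed number of particles\<close>

lemma fluctuation_divide:
  assumes "0 < b"
  shows "fluctuation n (\<lambda>i j. e i j * (x i j / b)) = fluctuation n (\<lambda>i j. e i j * x i j) / b"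
  using assms by (simp add: fluctuation_def abs_divide flip: sum_divide_distrib)

lemma bounded_with_bounded_derivativeD:
  fixes f :: "'a::real_normed_vector \<Rightarrow> real"
  assumes "bounded_with_bounded_derivative f"
  shows "\<exists>b. \<forall>z. \<bar>f z\<bar> \<le> b" and "\<exists>L. \<forall>z z'. \<bar>f z - f z'\<bar> \<le> L * norm (z - z')"
    and "continuous_on UNIV f"
proof -
  have diff: "\<And>z. f differentiable (at z)"
    using assms by (simp add: bounded_with_bounded_derivative_def)
  show "\<exists>b. \<forall>z. \<bar>f z\<bar> \<le> b"
    using assms unfolding bounded_with_bounded_derivative_def bounded_iff by auto
  obtain L where L: "\<And>z. \<bar>onorm (frechet_derivative f (at z))\<bar> \<le> L"
    using assms unfolding bounded_with_bounded_derivative_def bounded_iff by auto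
  have "norm (f z - f z') \<le> L * norm (z - z')" for z z'
  proof (rule differentiable_bound[of UNIV])
    show "(f has_derivative frechet_derivative f (at z)) (at z within UNIV)" for z
      using diff frechet_derivative_works by auto
    show "onorm (frechet_derivative f (at z)) \<le> L" for z
      using L[of z] by linarith
  qed auto
  then show "\<exists>L. \<forall>z z'. \<bar>f z - f z'\<bar> \<le> L * norm (z - z')"
    by auto
  show "continuous_on UNIV f"
    using diff by (simp add: continuous_on_eq_continuous_at differentiable_imp_continuous_within)
qed

text \<open>The union over \<open>m\<close> is increasing and its \<open>m\<close>-th member lies
  inside \<open>E m\<close>. This passes to the limit with no summability and no rate, where a bound
  on the limes superior of the events would fail.\<close>

lemma (in finite_measure) measure_liminf_le:
  fixes E :: "nat \<Rightarrow> 'a set"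
  assumes E: "\<And>N. E N \<in> sets M" "\<And>N. measure M (E N) \<le> \<beta>"
  shows "(\<Union>m. \<Inter>N\<in>{m..}. E N) \<in> sets M" "measure M (\<Union>m. \<Inter>N\<in>{m..}. E N) \<le> \<beta>"
proof -
  have S: "(\<Inter>N\<in>{m..}. E N) \<in> sets M" for m
    using E(1) by (intro sets.countable_INT') auto
  then show "(\<Union>m. \<Inter>N\<in>{m..}. E N) \<in> sets M"
    by auto
  have "(\<lambda>m. measure M (\<Inter>N\<in>{m..}. E N)) \<longlonglongrightarrow> measure M (\<Union>m. \<Inter>N\<in>{m..}. E N)"
    using S by (intro finite_Lim_measure_incseq) (auto simp: incseq_def)
  moreover have "measure M (\<Inter>N\<in>{m..}. E N) \<le> \<beta>" for m
    using finite_measure_mono[of "\<Inter>N\<in>{m..}. E N" "E m"] E by (meson INT_lower atLeast_iff order_refl order_trans)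
  ultimately show "measure M (\<Union>m. \<Inter>N\<in>{m..}. E N) \<le> \<beta>"
    by (intro LIMSEQ_le_const2) auto
qed

lemma measurable_imp_vimage_algebra_subset:
  "f \<in> measurable M N \<Longrightarrow> sets (vimage_algebra (space M) f N) \<subseteq> sets M"
  by (rule conjunct2[OF iffD1[OF measurable_iff_sets]])

text \<open>The system for one fixed \<open>n\<close>. The constants \<open>b\<close>,
  \<open>L\<close>, \<open>W_max\<close> will be chosen independently of \<open>n\<close>, and
  \<open>1 \<le> b\<close> permits the normalisation of \<phi> to absolute value at most 1.\<close>

locale particle_system = prob_space M for M :: "'w measure" +
  fixes T p b L W_max :: real and n :: nat and lam :: "real measure" and \<mu> :: "(real^'d) measure"
    and W :: "(real^'d) \<times> (real^'d) \<Rightarrow> real"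
    and \<phi> :: "real \<times> real \<times> (real^'d) \<times> (real^'d) \<Rightarrow> real"
    and \<psi> :: "real \<times> (real^'d) \<Rightarrow> real"
    and \<xi> :: "nat \<Rightarrow> 'w \<Rightarrow> real" and \<omega> :: "nat \<Rightarrow> 'w \<Rightarrow> real^'d" and B :: "nat \<Rightarrow> real \<Rightarrow> 'w \<Rightarrow> real"
    and A :: "nat \<Rightarrow> nat \<Rightarrow> 'w \<Rightarrow> real" and \<theta> \<theta>' :: "nat \<Rightarrow> real \<Rightarrow> 'w \<Rightarrow> real"
  assumes T: "0 < T" and n: "1 \<le> n" and p: "0 < p" and b: "1 \<le> b" and L: "0 \<le> L"
    and W_bounds: "\<And>z. 0 \<le> W z" "\<And>z. W z \<le> W_max" "\<And>z. p * W z \<le> 1"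
    and W_sym: "\<And>u v. W (u, v) = W (v, u)" and W_cont: "continuous_on UNIV W"
    and \<phi>_bound: "\<And>z. \<bar>\<phi> z\<bar> \<le> b" and \<phi>_cont: "continuous_on UNIV \<phi>"
    and \<phi>_lipschitz: "\<And>x y x' y' u v. \<bar>\<phi> (x, y, u, v) - \<phi> (x', y', u, v)\<bar> \<le> L * (\<bar>x - x'\<bar> + \<bar>y - y'\<bar>)"
    and \<psi>_cont: "continuous_on UNIV \<psi>"
    and \<psi>_lipschitz: "\<And>x x' u. \<bar>\<psi> (x, u) - \<psi> (x', u)\<bar> \<le> L * \<bar>x - x'\<bar>"
    and inputs: "independent_inputs M T n lam \<mu> \<xi> \<omega> B"
    and graph: "random_symmetric_graph M (input_sigma M T n \<xi> \<omega> B) n (\<lambda>i j w. p * W (\<omega> i w, \<omega> j w)) A"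
    and \<theta>: "strong_solution M T n (system_filtration M n \<xi> \<omega> B A) \<xi> (graph_drift n p \<phi> \<psi> A \<omega>) B \<theta>"
    and \<theta>': "strong_solution M T n (system_filtration M n \<xi> \<omega> B A) \<xi>
      (mean_field_drift n (weighted_interaction W \<phi>) \<psi> \<omega>) B \<theta>'"
begin

abbreviation G :: "'w measure" where "G \<equiv> input_sigma M T n \<xi> \<omega> B"

lemma input_measurable_M:
  assumes "i \<in> {1..n}"
  shows "\<xi> i \<in> borel_measurable M" "\<omega> i \<in> borel_measurable M" "t \<in> {0..T} \<Longrightarrow> B i t \<in> borel_measurable M"
    and "AE w in M. B i 0 w = 0"
proof -
  show "\<xi> i \<in> borel_measurable M" "\<omega> i \<in> borel_measurable M"
    using inputs assms unfolding independent_inputs_def by blast+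
  have "standard_brownian_motion M T (B i)"
    using inputs assms unfolding independent_inputs_def by blast
  then show "t \<in> {0..T} \<Longrightarrow> B i t \<in> borel_measurable M" "AE w in M. B i 0 w = 0"
    unfolding standard_brownian_motion_def by blast+
qed

lemma input_algebra_subset:
  assumes k: "k \<in> inputs n" and t: "t \<in> {0..T}"
  shows "sets (input_algebra M t \<xi> \<omega> B k) \<subseteq> sets M"
proof (cases k)
  case (Init i)
  then have "i \<in> {1..n}" using k by (auto simp: inputs_def)
  from measurable_imp_vimage_algebra_subset[OF input_measurable_M(1)[OF this]] show ?thesis
    by (simp add: input_algebra_def Init)
next
  case (Env i)
  then have "i \<in> {1..n}" using k by (auto simp: inputs_def)
  from measurable_imp_vimage_algebra_subset[OF input_measurable_M(2)[OF this]] show ?thesis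
    by (simp add: input_algebra_def Env)
next
  case (Noise i)
  then have "(\<lambda>w. \<lambda>s\<in>{0..t}. B i s w) \<in> measurable M (Pi\<^sub>M {0..t} (\<lambda>_. borel))"
    using k t by (intro measurable_restrict input_measurable_M(3)) (force simp: inputs_def)+
  from measurable_imp_vimage_algebra_subset[OF this] show ?thesis
    by (simp add: input_algebra_def Noise)
qed

lemma space_input_algebra [simp]: "space (input_algebra M t \<xi> \<omega> B k) = space M"
  by (simp add: input_algebra_def split: input.splits)

lemma space_G [simp]: "space G = space M"
  by (simp add: input_sigma_def space_measure_of_conv)

lemma sets_G: "sets G = sigma_sets (space M) (\<Union>k\<in>inputs n. sets (input_algebra M T \<xi> \<omega> B k))"
proof -
  have "sets (input_algebra M T \<xi> \<omega> B k) \<subseteq> Pow (space M)" for k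
    using sets.space_closed[of "input_algebra M T \<xi> \<omega> B k"] by simp
  then show ?thesis
    unfolding input_sigma_def by (intro sets_measure_of UN_least)
qed

lemma subalgebra_G: "subalgebra M G"
  unfolding subalgebra_def space_G sets_G
  using input_algebra_subset[of _ T] T by (auto intro!: sets.sigma_sets_subset)

lemma input_algebra_subset_G:
  assumes "k \<in> inputs n"
  shows "sets (input_algebra M T \<xi> \<omega> B k) \<subseteq> sets G"
  unfolding sets_G using assms by auto

lemma input_measurable_G:
  assumes i: "i \<in> {1..n}"
  shows "\<xi> i \<in> borel_measurable G" "\<omega> i \<in> borel_measurable G" "t \<in> {0..T} \<Longrightarrow> B i t \<in> borel_measurable G"
proof -
  have "Init i \<in> inputs n" "Env i \<in> inputs n" "Noise i \<in> inputs n"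
    using i by (auto simp: inputs_def)
  note sub = this[THEN input_algebra_subset_G, unfolded input_algebra_def, simplified]
  show "\<xi> i \<in> borel_measurable G" "\<omega> i \<in> borel_measurable G"
    using sub unfolding measurable_iff_sets by auto
  have "(\<lambda>w. \<lambda>s\<in>{0..T}. B i s w) \<in> measurable G (Pi\<^sub>M {0..T} (\<lambda>_. borel))"
    using sub unfolding measurable_iff_sets by (auto simp: space_PiM)
  then have "(\<lambda>w. (\<lambda>s\<in>{0..T}. B i s w) t) \<in> borel_measurable G" if "t \<in> {0..T}" for t
    using that by (rule measurable_compose[OF _ measurable_component_singleton])
  from this[of t] show "B i t \<in> borel_measurable G" if "t \<in> {0..T}"
    using that by simp
qed

lemma W_measurable:
  assumes "i \<in> {1..n}" "j \<in> {1..n}"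
  shows "(\<lambda>w. W (\<omega> i w, \<omega> j w)) \<in> borel_measurable G"
  using assms by (intro borel_measurable_continuous_on[OF W_cont] borel_measurable_Pair input_measurable_G)

sublocale random_graph M G n "\<lambda>i j w. p * W (\<omega> i w, \<omega> j w)" A "p * W_max"
proof (intro random_graph.intro random_graph_axioms.intro)
  show "subalgebra M G" by (rule subalgebra_G)
  show "random_symmetric_graph M G n (\<lambda>i j w. p * W (\<omega> i w, \<omega> j w)) A" by (rule graph)
  show "(\<lambda>w. p * W (\<omega> i w, \<omega> j w)) \<in> borel_measurable G" if "i \<in> {1..n}" "j \<in> {1..n}" for i j
    using W_measurable[OF that] by (intro borel_measurable_times) auto
  show "0 \<le> p * W (\<omega> i w, \<omega> j w) \<and> p * W (\<omega> i w, \<omega> j w) \<le> p * W_max \<and> p * W (\<omega> i w, \<omega> j w) \<le> 1" for i j w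
    using W_bounds p by (auto intro: mult_nonneg_nonneg mult_left_mono)
  show "p * W (\<omega> i w, \<omega> j w) = p * W (\<omega> j w, \<omega> i w)" for i j w
    using W_sym by simp
qed (rule prob_space_axioms)

lemma filtration_subset:
  assumes t: "t \<in> {0..T}"
  shows "sets (system_filtration M n \<xi> \<omega> B A t) \<subseteq> sets M"
proof -
  let ?S = "(\<Union>k\<in>inputs n. sets (input_algebra M t \<xi> \<omega> B k)) \<union>
      (\<Union>(i, j)\<in>{1..n} \<times> {1..n}. sets (vimage_algebra (space M) (A i j) borel)) \<union> null_sets M"
  have S: "?S \<subseteq> sets M"
    using input_algebra_subset[OF _ t] measurable_imp_vimage_algebra_subset[OF A_measurable] by fastforce
  then have "?S \<subseteq> Pow (space M)" using sets.space_closed by (rule subset_trans)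
  then show ?thesis
    unfolding system_filtration_def using sets.sigma_sets_subset[OF S] by (simp add: sets_measure_of)
qed

text \<open>Adaptedness is used only for measurability with respect to \<open>M\<close>; the
  filtration also carries the graph, so it does not give measurability with respect to
  \<open>G\<close>.\<close>

lemma solution_measurable:
  assumes "strong_solution M T n (system_filtration M n \<xi> \<omega> B A) \<xi> d B X" "i \<in> {1..n}" "t \<in> {0..T}"
  shows "X i t \<in> borel_measurable M"
proof -
  have "X i t \<in> borel_measurable (system_filtration M n \<xi> \<omega> B A t)"
    using assms unfolding strong_solution_def by auto
  moreover have "space (system_filtration M n \<xi> \<omega> B A t) = space M"
    by (simp add: system_filtration_def space_measure_of_conv)
  ultimately show ?thesis
    using filtration_subset[OF assms(3)] unfolding measurable_def by auto
qed

lemma solution_continuous: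
  assumes "strong_solution M T n F \<xi> d B X" "i \<in> {1..n}" "w \<in> space M"
  shows "continuous_on {0..T} (\<lambda>t. X i t w)"
  using assms unfolding strong_solution_def by blast

lemma empirical_measurable:
  assumes "strong_solution M T n (system_filtration M n \<xi> \<omega> B A) \<xi> d B X"
  shows "(\<lambda>w. double_layer_empirical T n (\<lambda>i t. X i t w) (\<lambda>i. \<omega> i w))
    \<in> measurable M (borel_of_metric (BL_metric (double_layer_metric T)))"
  using solution_continuous[OF assms] solution_measurable[OF assms] input_measurable_M(2)
  by (intro double_layer_empirical_measurable n T) auto

lemma interaction: "interaction n b L (\<lambda>i j x y. \<phi> (x, y, \<omega> i w, \<omega> j w)) (\<lambda>i x. \<psi> (x, \<omega> i w))"
  using n b L \<phi>_bound \<phi>_lipschitz \<psi>_lipschitz by unfold_locales auto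

lemma W_max_nonneg: "0 \<le> W_max"
  using W_bounds(1,2) order_trans by blast

lemma stability_const_pos: "0 < interaction.stability_const b L W_max T"
proof -
  interpret I: interaction n b L "\<lambda>i j x y. \<phi> (x, y, \<omega> i w, \<omega> j w)" "\<lambda>i x. \<psi> (x, \<omega> i w)" for w
    by (rule interaction)
  show ?thesis
    unfolding I.stability_const_def I.growth_const_def using b L T W_max_nonneg
    by (intro mult_pos_pos add_nonneg_pos mult_nonneg_nonneg add_nonneg_nonneg) auto
qed

abbreviation "drift w \<equiv> interaction.interaction_drift n (\<lambda>i j x y. \<phi> (x, y, \<omega> i w, \<omega> j w)) (\<lambda>i x. \<psi> (x, \<omega> i w))"

lemma graph_drift_eq:
  "graph_drift n p \<phi> \<psi> A \<omega> i v w = drift w (\<lambda>i j. A i j w / (real n * p)) i v"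
  by (simp add: graph_drift_def interaction.interaction_drift_def[OF interaction] sum_divide_distrib)

lemma mean_field_drift_eq:
  "mean_field_drift n (weighted_interaction W \<phi>) \<psi> \<omega> i v w = drift w (\<lambda>i j. W (\<omega> i w, \<omega> j w) / real n) i v"
  by (simp add: mean_field_drift_def weighted_interaction_def interaction.interaction_drift_def[OF interaction]
      sum_divide_distrib)

section \<open>The mean-field system as a limit of explicit functions of the inputs\<close>

definition mean_field_euler :: "nat \<Rightarrow> nat \<Rightarrow> nat \<Rightarrow> 'w \<Rightarrow> real" where
  "mean_field_euler N k i w = euler (drift w (\<lambda>i j. W (\<omega> i w, \<omega> j w) / real n))
     (T / real N) (\<lambda>i. \<xi> i w) (\<lambda>i t. B i t w) k i"

lemma interaction_measurable:
  assumes Y: "\<And>i. i \<in> {1..n} \<Longrightarrow> Y i \<in> borel_measurable G" and ij: "i \<in> {1..n}" "j \<in> {1..n}"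
  shows "(\<lambda>w. \<phi> (Y i w, Y j w, \<omega> i w, \<omega> j w)) \<in> borel_measurable G"
  using ij by (intro borel_measurable_continuous_on[OF \<phi>_cont] borel_measurable_Pair Y input_measurable_G)

text \<open>A step composes continuous functions with environments, earlier values and noise at grid
  times. The condition \<open>k \<le> N\<close> keeps these times in [0,T], where the noise belongs
  to \<open>G\<close>.\<close>

lemma mean_field_euler_measurable:
  assumes "k \<le> N" "i \<in> {1..n}"
  shows "mean_field_euler N k i \<in> borel_measurable G"
  using assms
proof (induction k arbitrary: i)
  case 0
  then show ?case
    using input_measurable_G(1) by (simp add: mean_field_euler_def[abs_def])
next
  case (Suc k)
  let ?Y = "mean_field_euler N k"
  have Y: "?Y j \<in> borel_measurable G" if "j \<in> {1..n}" for j
    using Suc that by simp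
  have grid: "real l * (T / real N) \<in> {0..T}" if "l \<le> N" for l
  proof -
    have "real l / real N \<le> 1" using that by (cases "N = 0") auto
    from mult_right_mono[OF this, of T] show ?thesis using T by simp
  qed
  have eq: "mean_field_euler N (Suc k) i = (\<lambda>w. ?Y i w + T / real N *
      ((\<Sum>j=1..n. W (\<omega> i w, \<omega> j w) / real n * \<phi> (?Y i w, ?Y j w, \<omega> i w, \<omega> j w)) + \<psi> (?Y i w, \<omega> i w)) +
      (B i (real (Suc k) * (T / real N)) w - B i (real k * (T / real N)) w))"
    by (simp add: mean_field_euler_def interaction.interaction_drift_def[OF interaction] fun_eq_iff)
  show ?case
    unfolding eq using Suc.prems
    by (intro borel_measurable_add borel_measurable_times borel_measurable_diff borel_measurable_sum
        borel_measurable_divide borel_measurable_const input_measurable_G grid W_measurable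
        interaction_measurable Y borel_measurable_continuous_on[OF \<psi>_cont] borel_measurable_Pair) auto
qed

abbreviation excess :: "'w \<Rightarrow> nat \<Rightarrow> nat \<Rightarrow> real" where
  "excess w i j \<equiv> A i j w - p * W (\<omega> i w, \<omega> j w)"

text \<open>Division by \<open>b\<close> makes the coefficients at most 1 in absolute value, as the
  tail estimate requires; the average over \<open>k\<close> stands for the normalised time
  integral.\<close>

definition euler_fluctuation :: "nat \<Rightarrow> 'w \<Rightarrow> real" where
  "euler_fluctuation N w = (\<Sum>k<N. fluctuation n (\<lambda>i j. excess w i j *
     (\<phi> (mean_field_euler N k i w, mean_field_euler N k j w, \<omega> i w, \<omega> j w) / b))) / real N"

text \<open>The Euler comparison holds for all large \<open>N\<close> and the small fluctuation for
  infinitely many, so some \<open>N\<close> satisfies both. The Riemann sum contributes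
  \<open>T * b * \<epsilon>\<close>, where \<open>b\<close> undoes the normalisation, and the
  approximation error contributes \<epsilon>.\<close>

lemma integral_fluctuation_le:
  assumes w: "w \<in> space M" and B0: "\<And>i. i \<in> {1..n} \<Longrightarrow> B i 0 w = 0"
    and eq: "\<And>i t. i \<in> {1..n} \<Longrightarrow> t \<in> {0..T} \<Longrightarrow> \<theta>' i t w = \<xi> i w +
      integral {0..t} (\<lambda>s. mean_field_drift n (weighted_interaction W \<phi>) \<psi> \<omega> i (\<lambda>j. \<theta>' j s w) w) + B i t w"
    and freq: "\<exists>\<^sub>F N in sequentially. euler_fluctuation N w \<le> \<epsilon> * ((real n)\<^sup>2 * p)" and \<epsilon>: "0 < \<epsilon>"
  shows "integral {0..T} (\<lambda>s. fluctuation n (\<lambda>i j. excess w i j * \<phi> (\<theta>' i s w, \<theta>' j s w, \<omega> i w, \<omega> j w)) /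
    ((real n)\<^sup>2 * p)) \<le> (T * b + 1) * \<epsilon>"
proof -
  interpret I: interaction n b L "\<lambda>i j x y. \<phi> (x, y, \<omega> i w, \<omega> j w)" "\<lambda>i x. \<psi> (x, \<omega> i w)"
    by (rule interaction)
  let ?n2p = "(real n)\<^sup>2 * p"
  define F where "F v = fluctuation n (\<lambda>i j. excess w i j * \<phi> (v i, v j, \<omega> i w, \<omega> j w)) / ?n2p" for v :: "nat \<Rightarrow> real"
  let ?c = "\<lambda>i j. W (\<omega> i w, \<omega> j w) / real n"
  have n2p: "0 < ?n2p" using n p by simp
  have cont: "continuous_on {0..T} (\<lambda>t. \<theta>' i t w)" if "i \<in> {1..n}" for i
    by (rule solution_continuous[OF \<theta>' that w])
  have "\<forall>\<^sub>F N in sequentially. integral {0..T} (\<lambda>s. F (\<lambda>j. \<theta>' j s w)) \<le>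
      T * ((\<Sum>k<N. F (euler (drift w ?c) (T / real N) (\<lambda>i. \<xi> i w) (\<lambda>i t. B i t w) k)) / real N) + \<epsilon>"
  proof (rule integral_le_euler_sum[where y="\<lambda>i t. \<theta>' i t w", OF T _ _ \<epsilon>])
    show "\<bar>drift w ?c i u - drift w ?c i v\<bar> \<le> (2 * L * (\<Sum>i=1..n. \<Sum>j=1..n. \<bar>?c i j\<bar>) + L) * (\<Sum>j=1..n. \<bar>u j - v j\<bar>)"
      if "i \<in> {1..n}" for i u v
      by (rule I.interaction_drift_lipschitz[OF that])
    show "0 \<le> 2 * L * (\<Sum>i=1..n. \<Sum>j=1..n. \<bar>?c i j\<bar>) + L"
      using L by (intro add_nonneg_nonneg mult_nonneg_nonneg sum_nonneg) auto
    show "(\<lambda>s. drift w ?c i (\<lambda>j. \<theta>' j s w)) integrable_on {0..T}" if "i \<in> {1..n}" for i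
      using cont that by (intro integrable_continuous_interval I.continuous_on_interaction_drift)
    show "\<theta>' i t w = \<xi> i w + integral {0..t} (\<lambda>s. drift w ?c i (\<lambda>j. \<theta>' j s w)) + B i t w"
      if "i \<in> {1..n}" "t \<in> {0..T}" for i t
      using eq[OF that] unfolding mean_field_drift_eq .
    show "\<bar>F u - F v\<bar> \<le> 2 * L * (\<Sum>i=1..n. \<Sum>j=1..n. \<bar>excess w i j\<bar>) / ?n2p * (\<Sum>j=1..n. \<bar>u j - v j\<bar>)" for u v
      using divide_right_mono[OF I.fluctuation_lipschitz[of "excess w" u v], of ?n2p] n2p
      unfolding F_def by (simp flip: diff_divide_distrib)
    show "0 \<le> 2 * L * (\<Sum>i=1..n. \<Sum>j=1..n. \<bar>excess w i j\<bar>) / ?n2p"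
      using L n2p by (intro divide_nonneg_pos mult_nonneg_nonneg sum_nonneg) auto
    show "(\<lambda>s. F (\<lambda>j. \<theta>' j s w)) integrable_on {0..T}"
      unfolding F_def using cont n2p n
      by (intro integrable_continuous_interval continuous_on_divide I.continuous_on_fluctuation continuous_on_const) auto
  qed (use cont B0 in auto)
  from frequently_ex[OF frequently_eventually_frequently[OF freq this]] obtain N
    where N: "euler_fluctuation N w \<le> \<epsilon> * ?n2p"
      "integral {0..T} (\<lambda>s. F (\<lambda>j. \<theta>' j s w)) \<le>
        T * ((\<Sum>k<N. F (euler (drift w ?c) (T / real N) (\<lambda>i. \<xi> i w) (\<lambda>i t. B i t w) k)) / real N) + \<epsilon>"
    by blast
  have "(\<Sum>k<N. F (euler (drift w ?c) (T / real N) (\<lambda>i. \<xi> i w) (\<lambda>i t. B i t w) k)) / real N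
      = b / ?n2p * euler_fluctuation N w"
  proof -
    have "euler_fluctuation N w = (\<Sum>k<N. fluctuation n (\<lambda>i j. excess w i j *
        \<phi> (mean_field_euler N k i w, mean_field_euler N k j w, \<omega> i w, \<omega> j w)) / b) / real N"
      unfolding euler_fluctuation_def using b by (subst fluctuation_divide) auto
    then show ?thesis
      using b by (simp add: F_def mean_field_euler_def flip: sum_divide_distrib)
  qed
  also have "\<dots> \<le> b / ?n2p * (\<epsilon> * ?n2p)"
    using N(1) b n2p by (intro mult_left_mono) auto
  also have "\<dots> = b * \<epsilon>" using n p by simp
  finally have "T * ((\<Sum>k<N. F (euler (drift w ?c) (T / real N) (\<lambda>i. \<xi> i w) (\<lambda>i t. B i t w) k)) / real N) \<le> T * (b * \<epsilon>)"
    using T by (intro mult_left_mono) auto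
  then have "integral {0..T} (\<lambda>s. F (\<lambda>j. \<theta>' j s w)) \<le> (T * b + 1) * \<epsilon>"
    using N(2) by (simp add: distrib_right)
  then show ?thesis by (simp add: F_def)
qed

text \<open>The deterministic core: on a realisation where the equations hold and both error terms
  are small, stability bounds the average of the suprema \<open>D i\<close>. In the last factor,
  \<open>T\<close> comes from the excess degree and \<open>T * b + 1\<close> from the fluctuation
  along \<open>\<theta>'\<close>. The environments coincide and contribute nothing to the
  distance.\<close>

lemma BL_dist_le:
  assumes w: "w \<in> space M" and B0: "\<And>i. i \<in> {1..n} \<Longrightarrow> B i 0 w = 0"
    and eq: "\<And>i t. i \<in> {1..n} \<Longrightarrow> t \<in> {0..T} \<Longrightarrow> \<theta> i t w = \<xi> i w +
      integral {0..t} (\<lambda>s. graph_drift n p \<phi> \<psi> A \<omega> i (\<lambda>j. \<theta> j s w) w) + B i t w"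
    and eq': "\<And>i t. i \<in> {1..n} \<Longrightarrow> t \<in> {0..T} \<Longrightarrow> \<theta>' i t w = \<xi> i w +
      integral {0..t} (\<lambda>s. mean_field_drift n (weighted_interaction W \<phi>) \<psi> \<omega> i (\<lambda>j. \<theta>' j s w) w) + B i t w"
    and deg: "fluctuation n (excess w) \<le> \<epsilon> * ((real n)\<^sup>2 * p)"
    and freq: "\<exists>\<^sub>F N in sequentially. euler_fluctuation N w \<le> \<epsilon> * ((real n)\<^sup>2 * p)" and \<epsilon>: "0 < \<epsilon>"
  shows "mdist (BL_metric (double_layer_metric T)) (double_layer_empirical T n (\<lambda>i t. \<theta> i t w) (\<lambda>i. \<omega> i w))
      (double_layer_empirical T n (\<lambda>i t. \<theta>' i t w) (\<lambda>i. \<omega> i w))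
    \<le> interaction.stability_const b L W_max T * ((T + T * b + 1) * \<epsilon>)"
proof -
  interpret I: interaction n b L "\<lambda>i j x y. \<phi> (x, y, \<omega> i w, \<omega> j w)" "\<lambda>i x. \<psi> (x, \<omega> i w)"
    by (rule interaction)
  let ?n2p = "(real n)\<^sup>2 * p" and ?m = "double_layer_metric T :: ((real \<Rightarrow> real) \<times> (real^'d)) metric"
  have n2p: "0 < ?n2p" using n p by simp
  have cont: "continuous_on {0..T} (\<lambda>t. \<theta> i t w)" "continuous_on {0..T} (\<lambda>t. \<theta>' i t w)" if "i \<in> {1..n}" for i
    using solution_continuous[OF \<theta> that w] solution_continuous[OF \<theta>' that w] by auto
  obtain D where D: "\<And>i t. i \<in> {1..n} \<Longrightarrow> t \<in> {0..T} \<Longrightarrow> \<bar>\<theta> i t w - \<theta>' i t w\<bar> \<le> D i"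
    and D_avg: "(\<Sum>i=1..n. D i) / real n \<le> I.stability_const W_max T *
      (T * (fluctuation n (excess w) / ?n2p) +
       integral {0..T} (\<lambda>s. fluctuation n (\<lambda>i j. excess w i j * \<phi> (\<theta>' i s w, \<theta>' j s w, \<omega> i w, \<omega> j w)) / ?n2p))"
  proof (rule I.interaction_stability[OF T p W_max_nonneg, of "\<lambda>i j. A i j w" "\<lambda>i j. W (\<omega> i w, \<omega> j w)"
        "\<lambda>i t. \<theta> i t w" "\<lambda>i t. \<theta>' i t w"])
    show "0 \<le> A i j w" "A i j w = A j i w" if "i \<in> {1..n}" "j \<in> {1..n}" for i j
      using A_01[OF that w] A_sym[OF that w] by auto
    show "\<theta> i t w - \<theta>' i t w = integral {0..t} (\<lambda>s. drift w (\<lambda>i j. A i j w / (real n * p)) i (\<lambda>j. \<theta> j s w)) -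
        integral {0..t} (\<lambda>s. drift w (\<lambda>i j. W (\<omega> i w, \<omega> j w) / real n) i (\<lambda>j. \<theta>' j s w))"
      if "i \<in> {1..n}" "t \<in> {0..T}" for i t
      using eq[OF that] eq'[OF that] unfolding graph_drift_eq mean_field_drift_eq by simp
  qed (use W_bounds(2) cont in auto)
  have "T * (fluctuation n (excess w) / ?n2p) \<le> T * \<epsilon>"
    using deg T n2p by (intro mult_left_mono) (auto simp: pos_divide_le_eq)
  then have "T * (fluctuation n (excess w) / ?n2p) +
       integral {0..T} (\<lambda>s. fluctuation n (\<lambda>i j. excess w i j * \<phi> (\<theta>' i s w, \<theta>' j s w, \<omega> i w, \<omega> j w)) / ?n2p)
     \<le> (T + T * b + 1) * \<epsilon>"
    using integral_fluctuation_le[OF w B0 eq' freq \<epsilon>] by (simp add: distrib_right)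
  moreover have "0 \<le> I.stability_const W_max T"
    using stability_const_pos by simp
  ultimately have D_le: "(\<Sum>i=1..n. D i) / real n \<le> I.stability_const W_max T * ((T + T * b + 1) * \<epsilon>)"
    using D_avg mult_left_mono order_trans by blast
  have x_in: "(restrict (\<lambda>t. \<theta> i t w) {0..T}, \<omega> i w) \<in> mspace ?m"
    and y_in: "(restrict (\<lambda>t. \<theta>' i t w) {0..T}, \<omega> i w) \<in> mspace ?m" if "i \<in> {1..n}" for i
    using restrict_in_mspace cont[OF that] by (auto simp: double_layer_metric_def)
  have "mdist (BL_metric ?m) (double_layer_empirical T n (\<lambda>i t. \<theta> i t w) (\<lambda>i. \<omega> i w))
      (double_layer_empirical T n (\<lambda>i t. \<theta>' i t w) (\<lambda>i. \<omega> i w))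
    = BL_dist ?m (double_layer_empirical T n (\<lambda>i t. \<theta> i t w) (\<lambda>i. \<omega> i w))
      (double_layer_empirical T n (\<lambda>i t. \<theta>' i t w) (\<lambda>i. \<omega> i w))"
    unfolding double_layer_empirical_def
    by (intro mdist_BL_metric empirical_measure_in_prob_measures n x_in y_in)
  also have "\<dots> \<le> (\<Sum>i=1..n. mdist ?m (restrict (\<lambda>t. \<theta> i t w) {0..T}, \<omega> i w) (restrict (\<lambda>t. \<theta>' i t w) {0..T}, \<omega> i w)) / real n"
    unfolding double_layer_empirical_def by (intro BL_dist_empirical_measure_le x_in y_in)
  also have "\<dots> \<le> (\<Sum>i=1..n. D i) / real n"
  proof (intro divide_right_mono sum_mono)
    fix i assume i: "i \<in> {1..n}"
    have "mdist (path_metric T) (restrict (\<lambda>t. \<theta> i t w) {0..T}) (restrict (\<lambda>t. \<theta>' i t w) {0..T}) \<le> D i"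
      using T D[OF i] by (intro mdist_path_metric_le restrict_in_mspace cont i) auto
    then show "mdist ?m (restrict (\<lambda>t. \<theta> i t w) {0..T}, \<omega> i w) (restrict (\<lambda>t. \<theta>' i t w) {0..T}, \<omega> i w) \<le> D i"
      by (simp add: double_layer_metric_def)
  qed simp
  finally show ?thesis using D_le by linarith
qed

text \<open>Up to null sets a large distance forces a large excess degree or a large Euler
  fluctuation for all large numbers of steps. Both events have the same tail bound, hence the factor
  2.\<close>

lemma deviation_probability_le:
  assumes \<epsilon>: "0 < \<epsilon>" and s: "0 < s" "s \<le> 1 / 2"
  shows "prob {w \<in> space M. mdist (BL_metric (double_layer_metric T))
      (double_layer_empirical T n (\<lambda>i t. \<theta> i t w) (\<lambda>i. \<omega> i w))
      (double_layer_empirical T n (\<lambda>i t. \<theta>' i t w) (\<lambda>i. \<omega> i w))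
      > interaction.stability_const b L W_max T * ((T + T * b + 1) * \<epsilon>)}
    \<le> 2 * 2 ^ n * exp ((real n)\<^sup>2 * p * s * (4 * W_max * s - \<epsilon>))"
    (is "prob ?D \<le> 2 * 2 ^ n * exp ?x")
proof -
  let ?t = "\<epsilon> * ((real n)\<^sup>2 * p)"
  have x: "4 * (p * W_max) * s\<^sup>2 * (real n)\<^sup>2 - s * ?t = ?x"
    by (simp add: algebra_simps power2_eq_square)
  \<comment> \<open>The excess degree is the case of one grid time with all coefficients equal to
    1.\<close>
  have one: "(\<Sum>k<1::nat. fluctuation n (\<lambda>i j. excess w i j * 1)) / real 1 = fluctuation n (excess w)" for w
    by simp
  have deg: "(\<lambda>w. fluctuation n (excess w)) \<in> borel_measurable M"
    using fluctuation_average_tail(1)[of 1 "\<lambda>_ _ _ _. 1" s, unfolded one] s by simp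
  have deg_prob: "prob {w \<in> space M. ?t < fluctuation n (excess w)} \<le> 2 ^ n * exp ?x"
    using fluctuation_average_tail(2)[of 1 "\<lambda>_ _ _ _. 1" s ?t, unfolded one x] s by simp
  have eul: "euler_fluctuation N \<in> borel_measurable M"
    and eul_prob: "prob {w \<in> space M. ?t < euler_fluctuation N w} \<le> 2 ^ n * exp ?x" if N: "0 < N" for N
  proof -
    let ?c = "\<lambda>k i j w. \<phi> (mean_field_euler N k i w, mean_field_euler N k j w, \<omega> i w, \<omega> j w) / b"
    have c: "?c k i j \<in> borel_measurable G" if "k < N" "i \<in> {1..n}" "j \<in> {1..n}" for k i j
      using that by (intro borel_measurable_divide interaction_measurable mean_field_euler_measurable) auto
    have c1: "\<bar>?c k i j w\<bar> \<le> 1" for k i j w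
      using \<phi>_bound[of "(mean_field_euler N k i w, mean_field_euler N k j w, \<omega> i w, \<omega> j w)"] b
      by (simp add: abs_divide)
    show "euler_fluctuation N \<in> borel_measurable M"
      unfolding euler_fluctuation_def[abs_def]
      by (rule fluctuation_average_tail(1)[of N ?c s, OF N c c1 s])
    show "prob {w \<in> space M. ?t < euler_fluctuation N w} \<le> 2 ^ n * exp ?x"
      unfolding euler_fluctuation_def
      by (rule fluctuation_average_tail(2)[of N ?c s ?t, OF N c c1 s, unfolded x])
  qed
  \<comment> \<open>The shift by one excludes the empty grid; it does not affect statements about
    all large \<open>N\<close>.\<close>
  define E where "E N = {w \<in> space M. ?t < euler_fluctuation (Suc N) w}" for N
  have E: "E N \<in> sets M" "prob (E N) \<le> 2 ^ n * exp ?x" for N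
    unfolding E_def using eul[of "Suc N"] eul_prob[of "Suc N"] by auto
  define V where "V = (\<Union>m. \<Inter>N\<in>{m..}. E N)"
  note V = measure_liminf_le[of E, OF E, folded V_def]
  let ?U = "{w \<in> space M. ?t < fluctuation n (excess w)}"
  have U: "?U \<in> sets M" using deg by auto
  have "AE w in M. \<forall>i\<in>{1..n}. B i 0 w = 0"
    using input_measurable_M(4) by (intro AE_finite_allI) auto
  moreover have "AE w in M. \<forall>i\<in>{1..n}. \<forall>t\<in>{0..T}. \<theta> i t w = \<xi> i w +
      integral {0..t} (\<lambda>s. graph_drift n p \<phi> \<psi> A \<omega> i (\<lambda>j. \<theta> j s w) w) + B i t w"
    using \<theta> unfolding strong_solution_def by (auto elim: AE_mp)
  moreover have "AE w in M. \<forall>i\<in>{1..n}. \<forall>t\<in>{0..T}. \<theta>' i t w = \<xi> i w +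
      integral {0..t} (\<lambda>s. mean_field_drift n (weighted_interaction W \<phi>) \<psi> \<omega> i (\<lambda>j. \<theta>' j s w) w) + B i t w"
    using \<theta>' unfolding strong_solution_def by (auto elim: AE_mp)
  ultimately have "AE w in M. w \<in> ?D \<longrightarrow> w \<in> ?U \<union> V"
  proof eventually_elim
    case (elim w)
    show ?case
    proof (intro impI, rule ccontr)
      assume D: "w \<in> ?D" and not: "w \<notin> ?U \<union> V"
      then have w: "w \<in> space M" by simp
      \<comment> \<open>Outside \<open>V\<close> the threshold is respected for infinitely many
        numbers of steps, which is all that the pathwise estimate asks for.\<close>
      have "\<exists>\<^sub>F N in sequentially. euler_fluctuation N w \<le> ?t"
        unfolding frequently_def eventually_sequentially
      proof
        assume "\<exists>m. \<forall>N\<ge>m. \<not> euler_fluctuation N w \<le> ?t"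
        then obtain m where "\<And>N. m \<le> N \<Longrightarrow> ?t < euler_fluctuation N w" by force
        then have "w \<in> (\<Inter>N\<in>{m..}. E N)" using w by (auto simp: E_def)
        then show False using not by (auto simp: V_def)
      qed
      moreover have "fluctuation n (excess w) \<le> ?t" using not w by auto
      ultimately show False
        using BL_dist_le[OF w _ _ _ _ _ \<epsilon>] elim D by (simp add: not_le[symmetric])
    qed
  qed
  then have "prob ?D \<le> prob (?U \<union> V)"
    using U V(1) by (intro finite_measure_mono_AE) auto
  also have "\<dots> \<le> prob ?U + prob V"
    by (intro measure_subadditive U V(1)) auto
  also have "\<dots> \<le> 2 * 2 ^ n * exp ?x"
    using deg_prob V(2) by simp
  finally show ?thesis .
qed

end

section \<open>Exponential equivalence\<close>

text \<open>The constant \<open>a\<close> absorbs every factor that is exponential in n. When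
  \<open>P n\<close> is 0 the logarithm is minus infinity and the bound is trivial, as 1/n is
  positive.\<close>

lemma limsup_log_eq_minus_infinity:
  fixes P r :: "nat \<Rightarrow> real"
  assumes le: "\<And>n. 1 \<le> n \<Longrightarrow> P n \<le> exp (real n * (a - c * r n))" and nonneg: "\<And>n. 0 \<le> P n"
    and c: "0 < c" and r: "filterlim r at_top sequentially"
  shows "limsup (\<lambda>n. ereal (1 / real n) * ereal_log (P n)) = - \<infinity>"
proof -
  have bound: "ereal (1 / real n) * ereal_log (P n) \<le> ereal (a - c * r n)" if n: "1 \<le> n" for n
  proof (cases "P n = 0")
    case True
    then show ?thesis using n by (simp add: ereal_log_def)
  next
    case False
    then have "ln (P n) \<le> real n * (a - c * r n)"
      using le[OF n] nonneg[of n] by (subst ln_exp[symmetric], subst ln_le_cancel_iff) auto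
    then have "1 / real n * ln (P n) \<le> a - c * r n"
      using n by (simp add: field_simps)
    then show ?thesis using False by (simp add: ereal_log_def)
  qed
  have "(\<lambda>n. ereal (1 / real n) * ereal_log (P n)) \<longlonglongrightarrow> - \<infinity>"
    unfolding tendsto_MInfty
  proof
    fix x :: real
    have "\<forall>\<^sub>F n in sequentially. (a - x + 1) / c \<le> r n"
      using r by (simp add: filterlim_at_top)
    then show "\<forall>\<^sub>F n in sequentially. ereal (1 / real n) * ereal_log (P n) < ereal x"
      using eventually_ge_at_top[of 1]
    proof eventually_elim
      case (elim n)
      have "a - c * r n < x" using elim(1) c by (simp add: field_simps)
      then show ?case using bound[OF elim(2)] by (simp add: le_less_trans)
    qed
  qed
  then show ?thesis by (intro lim_imp_Limsup) auto
qed

theorem theorem2: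
  fixes T r :: real
    and p :: "nat \<Rightarrow> real"
    and lam :: "real measure"
    and g :: "real \<Rightarrow> real"
    and \<mu> :: "(real^'d) measure"
    and W :: "(real^'d) \<times> (real^'d) \<Rightarrow> real"
    and \<phi> :: "real \<times> real \<times> (real^'d) \<times> (real^'d) \<Rightarrow> real"
    and \<psi> :: "real \<times> (real^'d) \<Rightarrow> real"
    and M :: "nat \<Rightarrow> 'w measure"
    and \<xi> :: "nat \<Rightarrow> nat \<Rightarrow> 'w \<Rightarrow> real"
    and \<omega> :: "nat \<Rightarrow> nat \<Rightarrow> 'w \<Rightarrow> real^'d"
    and B :: "nat \<Rightarrow> nat \<Rightarrow> real \<Rightarrow> 'w \<Rightarrow> real"
    and A :: "nat \<Rightarrow> nat \<Rightarrow> nat \<Rightarrow> 'w \<Rightarrow> real"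
    and \<theta> \<theta>' :: "nat \<Rightarrow> nat \<Rightarrow> real \<Rightarrow> 'w \<Rightarrow> real"
  assumes "T > 0"
    and "\<And>n. n \<ge> 1 \<Longrightarrow> 0 < p n \<and> p n \<le> 1"
    and "filterlim (\<lambda>n. real n * p n) at_top sequentially"
    and "prob_space \<mu>" "sets \<mu> = sets borel"
    and "prob_space lam" "lam = density lborel (\<lambda>x. ennreal (g x))"
    and "\<And>x. 0 \<le> g x" "integrable lborel g"
    and "r > 1" "integrable lborel (\<lambda>x. g x powr r)"
    and "\<And>z. 0 \<le> W z" "bounded (range W)" "\<And>u v. W (u, v) = W (v, u)" "\<exists>L. L-lipschitz_on UNIV W"
    and "\<And>n. n \<ge> 1 \<Longrightarrow> p n * (SUP z. \<bar>W z\<bar>) \<le> 1"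
    and "bounded_with_bounded_derivative \<phi>" "bounded_with_bounded_derivative \<psi>"
    and "\<And>n. n \<ge> 1 \<Longrightarrow> prob_space (M n)"
    and "\<And>n. n \<ge> 1 \<Longrightarrow> independent_inputs (M n) T n lam \<mu> (\<xi> n) (\<omega> n) (B n)"
    and "\<And>n. n \<ge> 1 \<Longrightarrow>
      random_symmetric_graph (M n) (input_sigma (M n) T n (\<xi> n) (\<omega> n) (B n)) n
        (\<lambda>i j w. p n * W (\<omega> n i w, \<omega> n j w)) (A n)"
    and "\<And>n. n \<ge> 1 \<Longrightarrow>
      strong_solution (M n) T n (system_filtration (M n) n (\<xi> n) (\<omega> n) (B n) (A n)) (\<xi> n)
        (graph_drift n (p n) \<phi> \<psi> (A n) (\<omega> n)) (B n) (\<theta> n)"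
    and "\<And>n. n \<ge> 1 \<Longrightarrow>
      strong_solution (M n) T n (system_filtration (M n) n (\<xi> n) (\<omega> n) (B n) (A n)) (\<xi> n)
        (mean_field_drift n (weighted_interaction W \<phi>) \<psi> (\<omega> n)) (B n) (\<theta>' n)"
  shows "exponentially_equivalent M (BL_metric (double_layer_metric T))
    (\<lambda>n w. double_layer_empirical T n (\<lambda>i t. \<theta> n i t w) (\<lambda>i. \<omega> n i w))
    (\<lambda>n w. double_layer_empirical T n (\<lambda>i t. \<theta>' n i t w) (\<lambda>i. \<omega> n i w))"
proof -
  obtain b\<^sub>0 where b\<^sub>0: "\<And>z. \<bar>\<phi> z\<bar> \<le> b\<^sub>0"
    using bounded_with_bounded_derivativeD(1)[OF assms(17)] by blast
  obtain L\<^sub>1 where L\<^sub>1: "\<And>z z'. \<bar>\<phi> z - \<phi> z'\<bar> \<le> L\<^sub>1 * norm (z - z')"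
    using bounded_with_bounded_derivativeD(2)[OF assms(17)] by blast
  obtain L\<^sub>2 where L\<^sub>2: "\<And>z z'. \<bar>\<psi> z - \<psi> z'\<bar> \<le> L\<^sub>2 * norm (z - z')"
    using bounded_with_bounded_derivativeD(2)[OF assms(18)] by blast
  \<comment> \<open>Enlarged to at least 1 so that division by \<open>b\<close> is safe; likewise
    \<open>L\<close> is made nonnegative and common to \<phi> and \<psi>.\<close>
  define b where "b = max 1 b\<^sub>0"
  define L where "L = max 0 (max L\<^sub>1 L\<^sub>2)"
  define W_max where "W_max = (SUP z. \<bar>W z\<bar>)"
  have \<phi>_lipschitz: "\<bar>\<phi> (x, y, u, v) - \<phi> (x', y', u, v)\<bar> \<le> L * (\<bar>x - x'\<bar> + \<bar>y - y'\<bar>)" for x y x' y' u v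
  proof -
    have "norm ((x, y, u, v) - (x', y', u, v)) \<le> \<bar>x - x'\<bar> + \<bar>y - y'\<bar>"
      using norm_Pair_le[of "x - x'" "(y - y', 0 :: (real^'d) \<times> (real^'d))"]
        norm_Pair_le[of "y - y'" "0 :: (real^'d) \<times> (real^'d)"] by (simp add: zero_prod_def)
    then have "L\<^sub>1 * norm ((x, y, u, v) - (x', y', u, v)) \<le> L * (\<bar>x - x'\<bar> + \<bar>y - y'\<bar>)"
      by (intro mult_mono) (auto simp: L_def)
    then show ?thesis using L\<^sub>1[of "(x, y, u, v)" "(x', y', u, v)"] by linarith
  qed
  have \<psi>_lipschitz: "\<bar>\<psi> (x, u) - \<psi> (x', u)\<bar> \<le> L * \<bar>x - x'\<bar>" for x x' u
  proof -
    have "L\<^sub>2 * norm ((x, u) - (x', u)) \<le> L * \<bar>x - x'\<bar>"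
      by (intro mult_mono) (auto simp: L_def norm_Pair)
    then show ?thesis using L\<^sub>2[of "(x, u)" "(x', u)"] by linarith
  qed
  have W_max: "W z \<le> W_max" for z
  proof -
    have "bdd_above (range (\<lambda>z. \<bar>W z\<bar>))"
    proof -
      obtain a where "\<And>z. \<bar>W z\<bar> \<le> a"
        using assms(13) unfolding bounded_iff by auto
      then show ?thesis by (intro bdd_aboveI2)
    qed
    then have "\<bar>W z\<bar> \<le> W_max" unfolding W_max_def by (rule cSUP_upper2[of _ _ z]) auto
    then show ?thesis by linarith
  qed
  have system: "particle_system (M n) T (p n) b L W_max n lam \<mu> W \<phi> \<psi> (\<xi> n) (\<omega> n) (B n) (A n) (\<theta> n) (\<theta>' n)"
    if n: "1 \<le> n" for n
  proof (intro particle_system.intro particle_system_axioms.intro)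
    show "p n * W z \<le> 1" for z
    proof -
      have "p n * W z \<le> p n * W_max"
        using assms(2)[OF n] by (intro mult_left_mono W_max) simp
      then show ?thesis using assms(16)[OF n] by (simp only: W_max_def order_trans)
    qed
    show "\<bar>\<phi> z\<bar> \<le> b" for z using b\<^sub>0[of z] by (simp add: b_def)
    show "continuous_on UNIV W" using assms(15) lipschitz_on_continuous_on by blast
    show "continuous_on UNIV \<phi>" "continuous_on UNIV \<psi>"
      using bounded_with_bounded_derivativeD(3) assms(17,18) by blast+
  qed (use assms(1,2,12,14,19-23) n W_max \<phi>_lipschitz \<psi>_lipschitz in \<open>simp_all add: b_def L_def\<close>)
  define C where "C = interaction.stability_const b L W_max T * (T + T * b + 1)"
  have "0 < T + T * b + 1"
    using assms(1) by (intro add_nonneg_pos) (auto simp: b_def)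
  then have C: "0 < C"
    unfolding C_def using particle_system.stability_const_pos[OF system[of 1]] by simp
  have W0: "0 \<le> W_max" using W_max assms(12) order_trans by blast
  show ?thesis
    unfolding exponentially_equivalent_def
  proof (intro conjI allI impI)
    fix n :: nat assume "1 \<le> n"
    then interpret particle_system "M n" T "p n" b L W_max n lam \<mu> W \<phi> \<psi> "\<xi> n" "\<omega> n" "B n" "A n" "\<theta> n" "\<theta>' n"
      by (rule system)
    show "(\<lambda>w. double_layer_empirical T n (\<lambda>i t. \<theta> n i t w) (\<lambda>i. \<omega> n i w))
        \<in> measurable (M n) (borel_of_metric (BL_metric (double_layer_metric T)))"
      by (rule empirical_measurable[OF \<theta>])
    show "(\<lambda>w. double_layer_empirical T n (\<lambda>i t. \<theta>' n i t w) (\<lambda>i. \<omega> n i w))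
        \<in> measurable (M n) (borel_of_metric (BL_metric (double_layer_metric T)))"
      by (rule empirical_measurable[OF \<theta>'])
  next
    fix \<eta> :: real assume \<eta>: "0 < \<eta>"
    \<comment> \<open>With this choice the threshold in \<open>deviation_probability_le\<close> is
      exactly \<eta>.\<close>
    define \<epsilon> where "\<epsilon> = \<eta> / C"
    \<comment> \<open>The quadratic term \<open>4 * W_max * s\<close> then uses up at most half of
      \<epsilon>, while 1/2 is the range of the moment bound; \<open>W_max + 1\<close> covers a
      vanishing \<open>W\<close>. No \<open>n\<close> enters, so the rate stays fixed.\<close>
    define s where "s = min (1 / 2) (\<epsilon> / (8 * (W_max + 1)))"
    have \<epsilon>: "0 < \<epsilon>" using \<eta> C by (simp add: \<epsilon>_def)
    have s: "0 < s" "s \<le> 1 / 2"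
      unfolding s_def using \<epsilon> W0 by (simp_all only: min.cobounded1) simp
    have "s * (8 * (W_max + 1)) \<le> \<epsilon> / (8 * (W_max + 1)) * (8 * (W_max + 1))"
      using W0 by (intro mult_right_mono) (auto simp: s_def)
    also have "\<dots> = \<epsilon>" using W0 by simp
    finally have s\<epsilon>: "4 * W_max * s - \<epsilon> \<le> - \<epsilon> / 2"
      using s by (simp add: algebra_simps)
    show "limsup (\<lambda>n. ereal (1 / real n) * ereal_log (measure (M n) {w \<in> space (M n).
        \<eta> < mdist (BL_metric (double_layer_metric T))
          (double_layer_empirical T n (\<lambda>i t. \<theta> n i t w) (\<lambda>i. \<omega> n i w))
          (double_layer_empirical T n (\<lambda>i t. \<theta>' n i t w) (\<lambda>i. \<omega> n i w))})) = - \<infinity>"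
    proof (rule limsup_log_eq_minus_infinity[where a=2 and c="s * \<epsilon> / 2", OF _ measure_nonneg _ assms(3)])
      fix n :: nat assume n: "1 \<le> n"
      have \<eta>_eq: "interaction.stability_const b L W_max T * ((T + T * b + 1) * \<epsilon>) = \<eta>"
      proof -
        have "C * \<epsilon> = \<eta>" using C by (simp add: \<epsilon>_def)
        then show ?thesis unfolding C_def mult.assoc .
      qed
      have "measure (M n) {w \<in> space (M n). \<eta> < mdist (BL_metric (double_layer_metric T))
            (double_layer_empirical T n (\<lambda>i t. \<theta> n i t w) (\<lambda>i. \<omega> n i w))
            (double_layer_empirical T n (\<lambda>i t. \<theta>' n i t w) (\<lambda>i. \<omega> n i w))}
          \<le> 2 * 2 ^ n * exp ((real n)\<^sup>2 * p n * s * (4 * W_max * s - \<epsilon>))"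
        using particle_system.deviation_probability_le[OF system[OF n] \<epsilon> s] unfolding \<eta>_eq .
      also have "\<dots> \<le> exp (2 * real n) * exp ((real n)\<^sup>2 * p n * s * (- \<epsilon> / 2))"
      proof (intro mult_mono)
        have e: "2 \<le> exp (1 :: real)" using exp_ge_add_one_self[of 1] by simp
        \<comment> \<open>The two events and the sign choices together cost at most exp (2 n),
          whence \<open>a = 2\<close>.\<close>
        have "(2 :: real) * 2 ^ n \<le> exp 1 * exp 1 ^ n"
          using e by (intro mult_mono power_mono) auto
        also have "\<dots> = exp (1 + real n)" by (simp add: exp_add flip: exp_of_nat_mult)
        also have "\<dots> \<le> exp (2 * real n)" using n by simp
        finally show "(2 :: real) * 2 ^ n \<le> exp (2 * real n)" .
        show "exp ((real n)\<^sup>2 * p n * s * (4 * W_max * s - \<epsilon>)) \<le> exp ((real n)\<^sup>2 * p n * s * (- \<epsilon> / 2))"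
          unfolding exp_le_cancel_iff using s assms(2)[OF n] by (intro mult_left_mono s\<epsilon>) auto
      qed auto
      \<comment> \<open>Since n^2 p = n (n p), the rate per particle is a multiple of n p, which
        tends to infinity and beats the constant 2.\<close>
      also have "\<dots> = exp (real n * (2 - s * \<epsilon> / 2 * (real n * p n)))"
        by (simp add: algebra_simps power2_eq_square flip: exp_add)
      finally show "measure (M n) {w \<in> space (M n). \<eta> < mdist (BL_metric (double_layer_metric T))
            (double_layer_empirical T n (\<lambda>i t. \<theta> n i t w) (\<lambda>i. \<omega> n i w))
            (double_layer_empirical T n (\<lambda>i t. \<theta>' n i t w) (\<lambda>i. \<omega> n i w))}
          \<le> exp (real n * (2 - s * \<epsilon> / 2 * (real n * p n)))" .
    qed (use s \<epsilon> in auto)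
  qed
qed

end
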